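(* Let $m$ be a positive integer, $n\in\mathbb N$, let $\mathcal{T}_1,\mathcal{T}_2,\dots$ be operators in $\mathbb A$, and let $\beta_j\in\mathbb N_0$, $\alpha_l\in\mathbb N_0$. Then $\tilde H^m_{\kappa,0}(I)$ is closed under the operator $\sum_{l=1}^n\prod_{j=1}^{\alpha_l}\mathcal{T}_j^{\beta_j}$, i.e. this operator maps $\tilde H^m_{\kappa,0}(I)$ into itself.
   Context: $I=[-1,1]$; $\kappa\in(1,\infty)$; functions are complex-valued. A $\kappa$-parameterized function is a family $u=(u_\kappa)_{\kappa>1}$; operators depending on $\kappa$ act $\kappa$-wise. $H^m(I)$ is the Sobolev space with $\|u\|_{H^m}=(\sum_{j=0}^m\|u^{(j)}\|_{L^2(I)}^2)^{1/2}$. $H^m_{\kappa,0}(I)$: $\kappa$-parameterized $u$ with $u\in H^m(I)$ for every $\kappa$ and constants $c,\kappa_0>0$ with $\|u\|_{H^m}\le c$ for $\kappa\ge\kappa_0$. $\tilde H^m_{\kappa,0}(I)=\{u_0+u_1e^{i\kappa t}+u_2e^{-i\kappa t}:u_j\in H^m_{\kappa,0}(I)\}$. $C^{[m]}(I^2)$: functions on $I^2$ with continuous $\partial_s^\alpha\partial_t^\beta L$ for $\alpha,\beta\le m$, $\|L\|_{C^{[m]}}=\max_{\alpha,\beta\le m}\|\partial_s^\alpha\partial_t^\beta L\|_\infty$; $C^{[m]}_{\kappa,0}(I^2)$: $\kappa$-parameterized $L\in C^{[m]}(I^2)$ with $\|L\|_{C^{[m]}}\le c$ for all $\kappa\ge\kappa_0$,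 for some $c,\kappa_0>0$. For $L_1,L_2\in C(I^2)$, $\epsilon\in\{0,1\}$: $(\mathcal{A}_\epsilon[L_1,L_2]u)(s)=\int_{-1}^sL_1(s,t)e^{i\kappa(s-t)}u(t)dt+(-1)^\epsilon\int_s^1L_2(s,t)e^{i\kappa(t-s)}u(t)dt$. $\mathbb A=\{\mathcal{A}_\epsilon[L_1,L_2]:\epsilon\in\{0,1\},\ L_1,L_2\in C^{[m]}_{\kappa,0}(I^2)\}$. *)

theory Defs
  imports "HOL-Analysis.Analysis"
begin

text \<open>Conventions. The interval I = [-1,1] is written {-1..1}. A kappa-parameterized
function is a map  u :: real \<Rightarrow> real \<Rightarrow> complex,  u kappa t; only kappa > 1 and t in I matter.
A kappa-parameterized kernel is  L :: real \<Rightarrow> real \<Rightarrow> real \<Rightarrow> complex,  L kappa s t.\<close>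

type_synonym kfun = "real \<Rightarrow> real \<Rightarrow> complex"
type_synonym kop = "kfun \<Rightarrow> kfun"

definition test_fun :: "(real \<Rightarrow> real) \<Rightarrow> bool" where
  "test_fun \<phi> \<longleftrightarrow> (\<forall>k x. (deriv ^^ k) \<phi> differentiable (at x)) \<and>
     (\<exists>a b. -1 < a \<and> b < 1 \<and> (\<forall>t. t \<notin> {a..b} \<longrightarrow> \<phi> t = 0))"

definition L2I :: "(real \<Rightarrow> complex) \<Rightarrow> bool" where
  "L2I f \<longleftrightarrow> set_borel_measurable lborel {-1..1} f \<and>
     set_integrable lborel {-1..1} (\<lambda>t. (cmod (f t))^2)"

definition weak_derivs :: "nat \<Rightarrow> (real \<Rightarrow> complex) \<Rightarrow> (nat \<Rightarrow> real \<Rightarrow> complex) \<Rightarrow> bool" where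
  "weak_derivs m u v \<longleftrightarrow> (\<forall>t\<in>{-1..1}. v 0 t = u t) \<and> (\<forall>j\<le>m. L2I (v j)) \<and>
     (\<forall>j\<le>m. \<forall>\<phi>. test_fun \<phi> \<longrightarrow>
        (LINT t:{-1..1}|lborel. u t * complex_of_real ((deriv ^^ j) \<phi> t)) =
        (-1)^j * (LINT t:{-1..1}|lborel. v j t * complex_of_real (\<phi> t)))"

text \<open>Sobolev space H^m(I) and its norm (weak derivatives are unique a.e., so the norm is well defined).\<close>
definition in_Hm :: "nat \<Rightarrow> (real \<Rightarrow> complex) \<Rightarrow> bool" where
  "in_Hm m u \<longleftrightarrow> (\<exists>v. weak_derivs m u v)"

definition Hm_norm :: "nat \<Rightarrow> (real \<Rightarrow> complex) \<Rightarrow> real" where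
  "Hm_norm m u = (let v = (SOME v. weak_derivs m u v) in
     sqrt (\<Sum>j\<le>m. LINT t:{-1..1}|lborel. (cmod (v j t))^2))"

definition Hk0 :: "nat \<Rightarrow> kfun set" where
  "Hk0 m = {u. (\<forall>\<kappa>>1. in_Hm m (u \<kappa>)) \<and>
     (\<exists>c \<kappa>0. c > 0 \<and> \<kappa>0 > 0 \<and> (\<forall>\<kappa>. \<kappa> \<ge> \<kappa>0 \<and> \<kappa> > 1 \<longrightarrow> Hm_norm m (u \<kappa>) \<le> c))}"

definition tHk0 :: "nat \<Rightarrow> kfun set" where
  "tHk0 m = {u. \<exists>u0 u1 u2. u0 \<in> Hk0 m \<and> u1 \<in> Hk0 m \<and> u2 \<in> Hk0 m \<and>
     (\<forall>\<kappa>>1. \<forall>t\<in>{-1..1}. u \<kappa> t = u0 \<kappa> t + u1 \<kappa> t * exp (\<i> * complex_of_real (\<kappa> * t))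
                                       + u2 \<kappa> t * exp (- (\<i> * complex_of_real (\<kappa> * t))))}"

definition Cm_family :: "nat \<Rightarrow> (real \<Rightarrow> real \<Rightarrow> complex) \<Rightarrow> (nat \<Rightarrow> nat \<Rightarrow> real \<Rightarrow> real \<Rightarrow> complex) \<Rightarrow> bool" where
  "Cm_family m L P \<longleftrightarrow>
     (\<forall>s\<in>{-1..1}. \<forall>t\<in>{-1..1}. P 0 0 s t = L s t) \<and>
     (\<forall>\<beta><m. \<forall>s\<in>{-1..1}. \<forall>t\<in>{-1..1}.
        ((\<lambda>t. P 0 \<beta> s t) has_vector_derivative P 0 (Suc \<beta>) s t) (at t within {-1..1})) \<and>
     (\<forall>\<alpha><m. \<forall>\<beta>\<le>m. \<forall>s\<in>{-1..1}. \<forall>t\<in>{-1..1}.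
        ((\<lambda>s. P \<alpha> \<beta> s t) has_vector_derivative P (Suc \<alpha>) \<beta> s t) (at s within {-1..1})) \<and>
     (\<forall>\<alpha>\<le>m. \<forall>\<beta>\<le>m. continuous_on ({-1..1} \<times> {-1..1}) (\<lambda>(s,t). P \<alpha> \<beta> s t))"

definition Ck0 :: "nat \<Rightarrow> (real \<Rightarrow> real \<Rightarrow> real \<Rightarrow> complex) set" where
  "Ck0 m = {L. (\<forall>\<kappa>>1. \<exists>P. Cm_family m (L \<kappa>) P) \<and>
     (\<exists>c \<kappa>0. c > 0 \<and> \<kappa>0 > 0 \<and> (\<forall>\<kappa>. \<kappa> \<ge> \<kappa>0 \<and> \<kappa> > 1 \<longrightarrow>
        (\<exists>P. Cm_family m (L \<kappa>) P \<and>
             (\<forall>\<alpha>\<le>m. \<forall>\<beta>\<le>m. \<forall>s\<in>{-1..1}. \<forall>t\<in>{-1..1}. cmod (P \<alpha> \<beta> s t) \<le> c))))}"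

definition opA :: "nat \<Rightarrow> (real \<Rightarrow> real \<Rightarrow> real \<Rightarrow> complex) \<Rightarrow> (real \<Rightarrow> real \<Rightarrow> real \<Rightarrow> complex) \<Rightarrow> kop" where
  "opA \<epsilon> L1 L2 u = (\<lambda>\<kappa> s.
      (LINT t:{-1..s}|lborel. L1 \<kappa> s t * exp (\<i> * complex_of_real (\<kappa> * (s - t))) * u \<kappa> t)
    + (-1)^\<epsilon> * (LINT t:{s..1}|lborel. L2 \<kappa> s t * exp (\<i> * complex_of_real (\<kappa> * (t - s))) * u \<kappa> t))"

definition opsA :: "nat \<Rightarrow> kop set" where
  "opsA m = {T. \<exists>\<epsilon> L1 L2. \<epsilon> \<in> {0,1} \<and> L1 \<in> Ck0 m \<and> L2 \<in> Ck0 m \<and> T = opA \<epsilon> L1 L2}"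

fun op_prod :: "(nat \<Rightarrow> kop) \<Rightarrow> (nat \<Rightarrow> nat) \<Rightarrow> nat \<Rightarrow> kop" where
  "op_prod T b 0 = id"
| "op_prod T b (Suc k) = op_prod T b k \<circ> (T (Suc k) ^^ b (Suc k))"

end

(* The operators are integrals against e^{i w (s-t)}, and (d/ds + d/dt) annihilates this factor.  Hence, if the
   rest of the integrand vanishes to high order at t = -1, then differentiating the integral over [-1,s]
   produces no power of the frequency w: integrating by parts in t moves the boundary term at t = s back under
   the integral, and the result is a function bounded in C^m uniformly in w.  The same holds for the integral
   over [s,1] when the integrand vanishes at t = 1.  For general u in H^m split u = (1 - eta) u + eta u with a
   cutoff eta that is flat at both ends, equal to 1 at -1 and to 0 at 1.  The first part is of the good type; for
   the second write
     int_{-1}^s = e^{i w s} int_{-1}^1 L(s,t) e^{-i w t} eta(t) u(t) dt - int_s^1,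
   whose terms are again bounded in C^m up to the factor e^{i w s}.  Applied with w = 0, +-kappa, +-2 kappa to the
   three components of an element of the oscillatory space this shows that the space is invariant.
   On the Sobolev side only the L^1 norms of the weak derivatives enter. *)

theory Submission
  imports Defs
begin

section \<open>Parametric integrals on a square\<close>

text \<open>Differentiating \<open>osc \<omega> (s - t)\<close> in \<open>s\<close> costs a factor
  \<omega> each time, so a direct bound on m derivatives grows like |\<omega>|^m; avoiding this
  shapes the whole proof. Every integration by parts may put a derivative on the cutoff, and the new
  integrand must again vanish at the endpoint. Hence flatness to all orders up to m: \<eta> at 1 for
  the integrals over \<open>{s..1}\<close>, 1 - \<eta> at -1 for those over \<open>{-1..s}\<close>.
  Both come from one smooth bump, which is also the source of test functions. An element of H^m is
  known only through its action on test functions, and up to null sets. The du Bois-Reymond lemma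
  turns its weak derivatives into a chain of absolutely continuous functions whose last member is
  merely integrable. The Leibniz rules and the integration by parts are therefore derived from
  Fubini's theorem, without any pointwise derivative of the density. Since the top derivative occurs
  only under an integral sign, an L^1 bound on it yields a C^m bound on the result.\<close>

abbreviation I11 :: "real set" where "I11 \<equiv> {-1..1}"

lemma set_integrable_continuous_mult:
  fixes f g :: "real \<Rightarrow> complex"
  assumes f: "continuous_on {a..b} f" and g: "set_integrable lborel {a..b} g"
  shows "set_integrable lborel {a..b} (\<lambda>t. f t * g t)"
proof -
  obtain B where B: "\<And>t. t \<in> {a..b} \<Longrightarrow> norm (f t) \<le> B"
    using compact_continuous_image[OF f compact_Icc, THEN compact_imp_bounded]
    unfolding bounded_iff by blast
  have fm: "(\<lambda>t. indicator {a..b} t *\<^sub>R f t) \<in> borel_measurable borel"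
    by (rule borel_measurable_continuous_on_indicator[OF _ f]) simp
  have gm: "(\<lambda>t. indicator {a..b} t *\<^sub>R g t) \<in> borel_measurable lborel"
    using g unfolding set_integrable_def by auto
  have "integrable lborel (\<lambda>t. (indicator {a..b} t *\<^sub>R f t) * (indicator {a..b} t *\<^sub>R g t))"
  proof (rule Bochner_Integration.integrable_bound)
    show "integrable lborel (\<lambda>t. of_real B * (indicator {a..b} t *\<^sub>R g t))"
      using g unfolding set_integrable_def by (rule integrable_mult_right)
    show "AE t in lborel. norm ((indicator {a..b} t *\<^sub>R f t) * (indicator {a..b} t *\<^sub>R g t))
        \<le> norm (of_real B * (indicator {a..b} t *\<^sub>R g t))"
    proof (rule AE_I2)
      fix t
      show "norm ((indicator {a..b} t *\<^sub>R f t) * (indicator {a..b} t *\<^sub>R g t))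
        \<le> norm (of_real B * (indicator {a..b} t *\<^sub>R g t))"
        using B[of t] norm_ge_zero[of "f t"]
        by (auto simp: indicator_def norm_mult intro!: mult_right_mono)
    qed
  qed (use borel_measurable_times[OF fm gm[simplified]] in simp)
  also have "(\<lambda>t. (indicator {a..b} t *\<^sub>R f t) * (indicator {a..b} t *\<^sub>R g t))
      = (\<lambda>t. indicator {a..b} t *\<^sub>R (f t * g t))"
    by (auto simp: indicator_def)
  finally show ?thesis by (simp add: set_integrable_def)
qed

text \<open>Keeping the L^1 norm over all of \<open>I11\<close> even when \<open>{a..b}\<close> is
  smaller makes the estimate uniform in a moving endpoint. All bounds on kernel integrals reduce to
  it.\<close>

lemma norm_set_integral_mult_le:
  fixes f g :: "real \<Rightarrow> complex"
  assumes f: "continuous_on {a..b} f" and g: "set_integrable lborel I11 g"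
    and sub: "{a..b} \<subseteq> I11" and B: "\<And>t. t \<in> {a..b} \<Longrightarrow> norm (f t) \<le> B" and B0: "0 \<le> B"
  shows "norm (LINT t:{a..b}|lborel. f t * g t) \<le> B * (LINT t:I11|lborel. norm (g t))"
proof -
  have g': "set_integrable lborel {a..b} g" by (rule set_integrable_subset[OF g _ sub]) simp
  have "norm (LINT t:{a..b}|lborel. f t * g t)
      \<le> (\<integral>t. norm (indicator {a..b} t *\<^sub>R (f t * g t)) \<partial>lborel)"
    unfolding set_lebesgue_integral_def by (rule integral_norm_bound)
  also have "\<dots> \<le> (\<integral>t. B * (indicator I11 t *\<^sub>R norm (g t)) \<partial>lborel)"
  proof (rule integral_mono)
    show "integrable lborel (\<lambda>t. norm (indicator {a..b} t *\<^sub>R (f t * g t)))"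
      using set_integrable_continuous_mult[OF f g'] unfolding set_integrable_def
      by (rule integrable_norm)
    have "integrable lborel (\<lambda>t. B * norm (indicator I11 t *\<^sub>R (g t)))"
      using g unfolding set_integrable_def by (intro integrable_mult_right integrable_norm)
    then show "integrable lborel (\<lambda>t. B * (indicator I11 t *\<^sub>R norm (g t)))"
      by simp
    show "norm (indicator {a..b} t *\<^sub>R (f t * g t)) \<le> B * (indicator I11 t *\<^sub>R norm (g t))" for t
      using B[of t] sub norm_ge_zero[of "f t"] B0
      by (auto simp: indicator_def norm_mult intro!: mult_right_mono)
  qed
  also have "\<dots> = B * (LINT t:I11|lborel. norm (g t))"
    unfolding set_lebesgue_integral_def by simp
  finally show ?thesis .
qed

text \<open>Fubini's theorem: the indicator in the bound confines \<open>r\<close> to a bounded set,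
  while in \<open>t\<close> the integrability of \<open>g\<close> provides convergence.\<close>

lemma integral_swap_weighted:
  fixes H :: "real \<Rightarrow> real \<Rightarrow> complex" and g :: "real \<Rightarrow> complex"
  assumes Hm: "(\<lambda>(r,t). H r t) \<in> borel_measurable (lborel \<Otimes>\<^sub>M lborel)"
    and Hb: "\<And>r t. norm (H r t) \<le> N * indicator I11 r"
    and g: "integrable lborel g"
  shows "(\<integral>t. (\<integral>r. H r t \<partial>lborel) * g t \<partial>lborel) = (\<integral>r. (\<integral>t. H r t * g t \<partial>lborel) \<partial>lborel)"
proof -
  have gm [measurable]: "g \<in> borel_measurable lborel" using g by auto
  note Hm [measurable]
  have mm: "(\<lambda>(r,t). H r t * g t) \<in> borel_measurable (lborel \<Otimes>\<^sub>M lborel)"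
    by measurable
  have Ht: "(\<lambda>t. H r t) \<in> borel_measurable lborel" for r
    using measurable_compose[OF measurable_Pair1' Hm, of r] by simp
  have int_t: "integrable lborel (\<lambda>t. H r t * g t)" for r
  proof (rule Bochner_Integration.integrable_bound)
    show "integrable lborel (\<lambda>t. of_real (N * indicator I11 r) * g t)" using g by auto
    show "AE t in lborel. norm (H r t * g t) \<le> norm (of_real (N * indicator I11 r) * g t)"
    proof (rule AE_I2)
      fix t show "norm (H r t * g t) \<le> norm (of_real (N * indicator I11 r) * g t)"
        unfolding norm_mult norm_of_real
        by (rule mult_right_mono[OF order_trans[OF Hb abs_ge_self]]) simp
    qed
  qed (use Ht in measurable)
  have "integrable (lborel \<Otimes>\<^sub>M lborel) (\<lambda>(r,t). H r t * g t)"
  proof (rule lborel_pair.Fubini_integrable)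
    show "integrable lborel (\<lambda>r. \<integral>t. norm (case (r,t) of (r,t) \<Rightarrow> H r t * g t) \<partial>lborel)"
    proof (rule Bochner_Integration.integrable_bound)
      show "integrable lborel (\<lambda>r. indicator I11 r * (N * (\<integral>t. norm (g t) \<partial>lborel)))"
        by (intro integrable_mult_left) (simp add: integrable_indicator_iff)
      show "AE r in lborel. norm (\<integral>t. norm (case (r,t) of (r,t) \<Rightarrow> H r t * g t) \<partial>lborel)
          \<le> norm (indicator I11 r * (N * (\<integral>t. norm (g t) \<partial>lborel)))"
      proof (rule AE_I2)
        fix r
        have "norm (\<integral>t. norm (case (r,t) of (r,t) \<Rightarrow> H r t * g t) \<partial>lborel)
            = (\<integral>t. norm (H r t * g t) \<partial>lborel)" by simp
        also have "\<dots> \<le> (\<integral>t. (N * indicator I11 r) * norm (g t) \<partial>lborel)"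
        proof (rule integral_mono)
          show "integrable lborel (\<lambda>t. norm (H r t * g t))" using int_t by (rule integrable_norm)
          show "integrable lborel (\<lambda>t. (N * indicator I11 r) * norm (g t))"
            using g by (intro integrable_mult_right integrable_norm)
          show "norm (H r t * g t) \<le> (N * indicator I11 r) * norm (g t)" for t
            unfolding norm_mult by (rule mult_right_mono[OF Hb]) simp
        qed
        also have "\<dots> = indicator I11 r * (N * (\<integral>t. norm (g t) \<partial>lborel))" by simp
        also have "\<dots> \<le> norm (indicator I11 r * (N * (\<integral>t. norm (g t) \<partial>lborel)))" by simp
        finally show "norm (\<integral>t. norm (case (r,t) of (r,t) \<Rightarrow> H r t * g t) \<partial>lborel)
          \<le> norm (indicator I11 r * (N * (\<integral>t. norm (g t) \<partial>lborel)))" .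
      qed
      show "(\<lambda>r. \<integral>t. norm (case (r,t) of (r,t) \<Rightarrow> H r t * g t) \<partial>lborel) \<in> borel_measurable lborel"
        using mm by measurable
    qed
  qed (use mm int_t in auto)
  from lborel_pair.Fubini_integral[OF this]
  have "(\<integral>t. (\<integral>r. H r t * g t \<partial>lborel) \<partial>lborel) = (\<integral>r. (\<integral>t. H r t * g t \<partial>lborel) \<partial>lborel)" .
  then show ?thesis by simp
qed

lemma continuous_on_square_measurable:
  fixes H :: "real \<Rightarrow> real \<Rightarrow> complex"
  assumes "continuous_on (I11 \<times> I11) (\<lambda>(r,t). H r t)"
  shows "(\<lambda>(r,t). indicator (I11 \<times> I11) (r,t) *\<^sub>R H r t) \<in> borel_measurable (lborel \<Otimes>\<^sub>M lborel)"
proof -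
  have "(\<lambda>x. indicator (I11 \<times> I11) x *\<^sub>R (case x of (r,t) \<Rightarrow> H r t)) \<in> borel_measurable borel"
    by (rule borel_measurable_continuous_on_indicator[OF _ assms])
       (intro borel_closed closed_Times; simp)
  then show ?thesis
    by (simp add: lborel_prod split_beta')
qed

lemma continuous_on_square_bound:
  fixes H :: "real \<Rightarrow> real \<Rightarrow> complex"
  assumes "continuous_on (I11 \<times> I11) (\<lambda>(r,t). H r t)"
  obtains N where "N \<ge> 0" "\<And>r t. r \<in> I11 \<Longrightarrow> t \<in> I11 \<Longrightarrow> norm (H r t) \<le> N"
proof -
  have "bounded ((\<lambda>(r,t). H r t) ` (I11 \<times> I11))"
    by (intro compact_imp_bounded compact_continuous_image assms compact_Times) auto
  then obtain N where "\<And>r t. r \<in> I11 \<Longrightarrow> t \<in> I11 \<Longrightarrow> norm (H r t) \<le> N"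
    unfolding bounded_iff by fastforce
  then show thesis by (intro that[of "max N 0"]) fastforce+
qed

lemma continuous_on_square_section:
  fixes H :: "real \<Rightarrow> real \<Rightarrow> complex"
  assumes "continuous_on (I11 \<times> I11) (\<lambda>(r,t). H r t)"
  shows "r \<in> I11 \<Longrightarrow> continuous_on I11 (H r)" "t \<in> I11 \<Longrightarrow> continuous_on I11 (\<lambda>r. H r t)"
proof -
  show "r \<in> I11 \<Longrightarrow> continuous_on I11 (H r)"
    using continuous_on_compose2[OF assms, of I11 "\<lambda>t. (r,t)"]
    by (force intro!: continuous_intros)
  show "t \<in> I11 \<Longrightarrow> continuous_on I11 (\<lambda>r. H r t)"
    using continuous_on_compose2[OF assms, of I11 "\<lambda>r. (r,t)"]
    by (force intro!: continuous_intros)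
qed

lemma continuous_on_square_diag:
  fixes H :: "real \<Rightarrow> real \<Rightarrow> complex"
  assumes "continuous_on (I11 \<times> I11) (\<lambda>(r,t). H r t)"
  shows "continuous_on I11 (\<lambda>r. H r r)"
  using continuous_on_compose2[OF assms, of I11 "\<lambda>t. (t,t)"]
  by (force intro!: continuous_intros)

text \<open>Both identities are Fubini for \<open>H\<close> extended by zero outside the square and
  cut down to the closed set t \<le> r \<le> s or r \<le> s; on each section the indicators collapse
  to the stated limits of integration.\<close>

lemma set_integral_swap:
  fixes H :: "real \<Rightarrow> real \<Rightarrow> complex" and g :: "real \<Rightarrow> complex"
  assumes H: "continuous_on (I11 \<times> I11) (\<lambda>(r,t). H r t)"
    and g: "set_integrable lborel I11 g" and s: "s \<in> I11"
  shows set_integral_swap_triangle: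
      "(LINT t:{-1..s}|lborel. (LINT r:{t..s}|lborel. H r t) * g t)
     = (LINT r:{-1..s}|lborel. (LINT t:{-1..r}|lborel. H r t * g t))"
    and set_integral_swap_rectangle:
      "(LINT t:I11|lborel. (LINT r:{-1..s}|lborel. H r t) * g t)
     = (LINT r:{-1..s}|lborel. (LINT t:I11|lborel. H r t * g t))"
proof -
  let ?H = "\<lambda>r t. indicator (I11 \<times> I11) (r,t) *\<^sub>R H r t"
  let ?T = "\<lambda>r t. indicator {x. snd x \<le> fst x \<and> fst x \<le> s} (r,t) *\<^sub>R ?H r t"
  let ?R = "\<lambda>r t. indicator {x::real \<times> real. fst x \<le> s} (r,t) *\<^sub>R ?H r t"
  let ?g = "\<lambda>t. indicator I11 t *\<^sub>R g t"
  obtain N where N: "N \<ge> 0" "\<And>r t. r \<in> I11 \<Longrightarrow> t \<in> I11 \<Longrightarrow> norm (H r t) \<le> N"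
    using continuous_on_square_bound[OF H] by metis
  note Hm = continuous_on_square_measurable[OF H]
  have gi: "integrable lborel ?g" using g by (simp add: set_integrable_def)
  have ind: "(\<lambda>x. indicator C x *\<^sub>R (case x of (r,t) \<Rightarrow> ?H r t)) \<in> borel_measurable (lborel \<Otimes>\<^sub>M lborel)"
    if "closed C" for C
    by (rule borel_measurable_scaleR[OF borel_measurable_indicator Hm])
       (simp only: lborel_prod sets_lborel borel_closed[OF that])
  have "closed {x::real \<times> real. snd x \<le> fst x \<and> fst x \<le> s}"
    by (intro closed_Collect_conj closed_Collect_le continuous_intros)
  from ind[OF this] have Tm: "(\<lambda>(r,t). ?T r t) \<in> borel_measurable (lborel \<Otimes>\<^sub>M lborel)"
    by (simp only: case_prod_beta' prod.collapse)
  have "closed {x::real \<times> real. fst x \<le> s}"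
    by (intro closed_Collect_le continuous_intros)
  from ind[OF this] have Rm: "(\<lambda>(r,t). ?R r t) \<in> borel_measurable (lborel \<Otimes>\<^sub>M lborel)"
    by (simp only: case_prod_beta' prod.collapse)
  have Tb: "norm (?T r t) \<le> N * indicator I11 r" for r t
    using N(1) N(2)[of r t] by (auto simp: indicator_def)
  have Rb: "norm (?R r t) \<le> N * indicator I11 r" for r t
    using N(1) N(2)[of r t] by (auto simp: indicator_def)
  from integral_swap_weighted[OF Tm Tb gi]
  have "(\<integral>t. (\<integral>r. ?T r t \<partial>lborel) * ?g t \<partial>lborel) = (\<integral>r. (\<integral>t. ?T r t * ?g t \<partial>lborel) \<partial>lborel)" .
  also have "(\<lambda>t. (\<integral>r. ?T r t \<partial>lborel) * ?g t)
      = (\<lambda>t. indicator {-1..s} t *\<^sub>R ((LINT r:{t..s}|lborel. H r t) * g t))"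
  proof
    fix t
    show "(\<integral>r. ?T r t \<partial>lborel) * ?g t = indicator {-1..s} t *\<^sub>R ((LINT r:{t..s}|lborel. H r t) * g t)"
    proof (cases "t \<in> {-1..s}")
      case True
      then have "(\<lambda>r. ?T r t) = (\<lambda>r. indicator {t..s} r *\<^sub>R H r t)"
        using s by (auto simp: indicator_def fun_eq_iff)
      then show ?thesis using True s by (simp add: set_lebesgue_integral_def)
    next
      case False
      then have "(\<lambda>r. ?T r t) = (\<lambda>r. 0)" using s by (auto simp: indicator_def fun_eq_iff)
      then show ?thesis using False by simp
    qed
  qed
  also have "(\<lambda>r. (\<integral>t. ?T r t * ?g t \<partial>lborel))
      = (\<lambda>r. indicator {-1..s} r *\<^sub>R (LINT t:{-1..r}|lborel. H r t * g t))"
  proof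
    fix r
    show "(\<integral>t. ?T r t * ?g t \<partial>lborel) = indicator {-1..s} r *\<^sub>R (LINT t:{-1..r}|lborel. H r t * g t)"
    proof (cases "r \<in> {-1..s}")
      case True
      then have "(\<lambda>t. ?T r t * ?g t) = (\<lambda>t. indicator {-1..r} t *\<^sub>R (H r t * g t))"
        using s by (auto simp: indicator_def fun_eq_iff)
      then show ?thesis using True s by (simp add: set_lebesgue_integral_def)
    next
      case False
      then have "(\<lambda>t. ?T r t * ?g t) = (\<lambda>t. 0)" using s by (auto simp: indicator_def fun_eq_iff)
      then show ?thesis using False by simp
    qed
  qed
  finally show "(LINT t:{-1..s}|lborel. (LINT r:{t..s}|lborel. H r t) * g t)
     = (LINT r:{-1..s}|lborel. (LINT t:{-1..r}|lborel. H r t * g t))"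
    by (simp add: set_lebesgue_integral_def)
  from integral_swap_weighted[OF Rm Rb gi]
  have "(\<integral>t. (\<integral>r. ?R r t \<partial>lborel) * ?g t \<partial>lborel) = (\<integral>r. (\<integral>t. ?R r t * ?g t \<partial>lborel) \<partial>lborel)" .
  also have "(\<lambda>t. (\<integral>r. ?R r t \<partial>lborel) * ?g t)
      = (\<lambda>t. indicator I11 t *\<^sub>R ((LINT r:{-1..s}|lborel. H r t) * g t))"
  proof
    fix t
    show "(\<integral>r. ?R r t \<partial>lborel) * ?g t = indicator I11 t *\<^sub>R ((LINT r:{-1..s}|lborel. H r t) * g t)"
    proof (cases "t \<in> I11")
      case True
      then have "(\<lambda>r. ?R r t) = (\<lambda>r. indicator {-1..s} r *\<^sub>R H r t)"
        using s by (auto simp: indicator_def fun_eq_iff)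
      then show ?thesis using True s by (simp add: set_lebesgue_integral_def)
    qed simp
  qed
  also have "(\<lambda>r. (\<integral>t. ?R r t * ?g t \<partial>lborel))
      = (\<lambda>r. indicator {-1..s} r *\<^sub>R (LINT t:I11|lborel. H r t * g t))"
  proof
    fix r
    show "(\<integral>t. ?R r t * ?g t \<partial>lborel) = indicator {-1..s} r *\<^sub>R (LINT t:I11|lborel. H r t * g t)"
    proof (cases "r \<in> {-1..s}")
      case True
      then have "(\<lambda>t. ?R r t * ?g t) = (\<lambda>t. indicator I11 t *\<^sub>R (H r t * g t))"
        using s by (auto simp: indicator_def fun_eq_iff)
      then show ?thesis using True s by (simp add: set_lebesgue_integral_def)
    next
      case False
      then have "(\<lambda>t. ?R r t * ?g t) = (\<lambda>t. 0)" using s by (auto simp: indicator_def fun_eq_iff)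
      then show ?thesis using False by simp
    qed
  qed
  finally show "(LINT t:I11|lborel. (LINT r:{-1..s}|lborel. H r t) * g t)
     = (LINT r:{-1..s}|lborel. (LINT t:I11|lborel. H r t * g t))"
    by (simp add: set_lebesgue_integral_def)
qed

text \<open>Dominated convergence along sequences. The majorant N |g| asks of \<open>g\<close> only
  integrability, which is all that the top weak derivative offers.\<close>

lemma continuous_on_parametric_integral:
  fixes K :: "real \<Rightarrow> real \<Rightarrow> complex" and g :: "real \<Rightarrow> complex"
  assumes K: "continuous_on (I11 \<times> I11) (\<lambda>(r,t). K r t)"
    and g: "set_integrable lborel I11 g"
  shows "continuous_on I11 (\<lambda>s. LINT t:{-1..s}|lborel. K s t * g t)"
    and "continuous_on I11 (\<lambda>s. LINT t:I11|lborel. K s t * g t)"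
proof -
  obtain N where N: "N \<ge> 0" "\<And>r t. r \<in> I11 \<Longrightarrow> t \<in> I11 \<Longrightarrow> norm (K r t) \<le> N"
    using continuous_on_square_bound[OF K] by metis
  have gi: "integrable lborel (\<lambda>t. of_real N * (indicator I11 t *\<^sub>R g t))"
    using integrable_mult_right[OF g[unfolded set_integrable_def]] .
  have meas: "(\<lambda>t. indicator S t *\<^sub>R (K r t * g t)) \<in> borel_measurable lborel"
    if "r \<in> I11" "S = I11 \<or> S = {-1..r}" for r S
  proof -
    have "set_integrable lborel I11 (\<lambda>t. K r t * g t)"
      by (rule set_integrable_continuous_mult[OF continuous_on_square_section(1)[OF K that(1)] g])
    then have "set_integrable lborel S (\<lambda>t. K r t * g t)"
      by (rule set_integrable_subset) (use that in auto)
    then show ?thesis by (auto simp: set_integrable_def)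
  qed
  have bd: "norm (indicator S t *\<^sub>R (K r t * g t)) \<le> norm (of_real N * (indicator I11 t *\<^sub>R g t))"
    if "r \<in> I11" "S \<subseteq> I11" for r S t
    using N(1) N(2)[of r t] that
    by (auto simp: indicator_def norm_mult intro!: mult_right_mono)
  have lim: "(\<lambda>n. K (x n) t) \<longlonglongrightarrow> K s t"
    if "\<And>n. x n \<in> I11" "x \<longlonglongrightarrow> s" "s \<in> I11" "t \<in> I11" for x :: "nat \<Rightarrow> real" and s t
    using continuous_on_tendsto_compose[OF continuous_on_square_section(2)[OF K that(4)] that(2,3)] that(1)
    by simp
  have "(\<lambda>n. LINT t:I11|lborel. K (x n) t * g t) \<longlonglongrightarrow> (LINT t:I11|lborel. K s t * g t)"
    if x: "\<And>n. x n \<in> I11" "x \<longlonglongrightarrow> s" "s \<in> I11" for x :: "nat \<Rightarrow> real" and s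
    unfolding set_lebesgue_integral_def
  proof (rule integral_dominated_convergence[where w="\<lambda>t. norm (of_real N * (indicator I11 t *\<^sub>R g t))"])
    show "AE t in lborel. (\<lambda>n. indicator I11 t *\<^sub>R (K (x n) t * g t)) \<longlonglongrightarrow> indicator I11 t *\<^sub>R (K s t * g t)"
      using lim[OF x] by (intro AE_I2) (auto simp: indicator_def intro!: tendsto_intros)
    show "integrable lborel (\<lambda>t. norm (of_real N * (indicator I11 t *\<^sub>R g t)))"
      using gi by (rule integrable_norm)
    show "AE t in lborel. norm (indicator I11 t *\<^sub>R (K (x n) t * g t))
        \<le> norm (of_real N * (indicator I11 t *\<^sub>R g t))" for n
      using bd[OF x(1)[of n] order_refl] by (intro AE_I2)
  qed (use meas x in auto)
  then show "continuous_on I11 (\<lambda>s. LINT t:I11|lborel. K s t * g t)"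
    unfolding continuous_on_sequentially comp_def by blast
  have "(\<lambda>n. LINT t:{-1..x n}|lborel. K (x n) t * g t) \<longlonglongrightarrow> (LINT t:{-1..s}|lborel. K s t * g t)"
    if x: "\<And>n. x n \<in> I11" "x \<longlonglongrightarrow> s" "s \<in> I11" for x :: "nat \<Rightarrow> real" and s
    unfolding set_lebesgue_integral_def
  proof (rule integral_dominated_convergence[where w="\<lambda>t. norm (of_real N * (indicator I11 t *\<^sub>R g t))"])
    \<comment> \<open>With a moving endpoint the indicators converge at every \<open>t\<close>
      except \<open>s\<close>, a null set; on either side of \<open>s\<close> they are eventually
      constant.\<close>
    have ev: "(\<lambda>n. indicator {-1..x n} t *\<^sub>R (K (x n) t * g t)) \<longlonglongrightarrow> indicator {-1..s} t *\<^sub>R (K s t * g t)"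
      if "t \<noteq> s" for t
    proof (cases "t \<in> {-1..s}")
      case True
      then have "t < s" using that by auto
      with x(2) have "\<forall>\<^sub>F n in sequentially. t < x n" by (rule order_tendstoD(1))
      then have "\<forall>\<^sub>F n in sequentially. K (x n) t * g t = indicator {-1..x n} t *\<^sub>R (K (x n) t * g t)"
        by eventually_elim (use True in \<open>auto simp: indicator_def\<close>)
      moreover have "(\<lambda>n. K (x n) t * g t) \<longlonglongrightarrow> K s t * g t"
        using True x(3) by (intro tendsto_intros lim[OF x]) auto
      ultimately have "(\<lambda>n. indicator {-1..x n} t *\<^sub>R (K (x n) t * g t)) \<longlonglongrightarrow> K s t * g t"
        using Lim_transform_eventually by fast
      then show ?thesis using True by simp
    next
      case False
      have "\<forall>\<^sub>F n in sequentially. 0 = indicator {-1..x n} t *\<^sub>R (K (x n) t * g t)"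
      proof (cases "t < -1")
        case True then show ?thesis by simp
      next
        case F: False
        then have "s < t" using False that by auto
        with x(2) have "\<forall>\<^sub>F n in sequentially. x n < t" by (rule order_tendstoD(2))
        then show ?thesis by eventually_elim auto
      qed
      from Lim_transform_eventually[OF tendsto_const this] False show ?thesis by simp
    qed
    show "AE t in lborel. (\<lambda>n. indicator {-1..x n} t *\<^sub>R (K (x n) t * g t)) \<longlonglongrightarrow> indicator {-1..s} t *\<^sub>R (K s t * g t)"
      using AE_lborel_singleton[of s] by eventually_elim (rule ev)
    show "integrable lborel (\<lambda>t. norm (of_real N * (indicator I11 t *\<^sub>R g t)))"
      using gi by (rule integrable_norm)
    show "AE t in lborel. norm (indicator {-1..x n} t *\<^sub>R (K (x n) t * g t))
        \<le> norm (of_real N * (indicator I11 t *\<^sub>R g t))" for n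
      by (rule AE_I2, rule bd[OF x(1)[of n]]) (use x(1)[of n] in auto)
  qed (use meas x in auto)
  then show "continuous_on I11 (\<lambda>s. LINT t:{-1..s}|lborel. K s t * g t)"
    unfolding continuous_on_sequentially comp_def by blast
qed

section \<open>Integration by parts and differentiation of Volterra integrals\<close>

lemma set_integral_split:
  fixes f :: "real \<Rightarrow> complex"
  assumes f: "set_integrable lborel I11 f" and s: "s \<in> I11"
  shows "(LINT t:I11|lborel. f t) = (LINT t:{-1..s}|lborel. f t) + (LINT t:{s..1}|lborel. f t)"
proof -
  have "I11 = {-1..s} \<union> {s..1}" using s by auto
  moreover have "(LINT t:{-1..s} \<union> {s..1}|lborel. f t) = (LINT t:{-1..s}|lborel. f t) + (LINT t:{s..1}|lborel. f t)"
  proof (rule set_integral_Un_AE)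
    show "AE x in lborel. \<not> (x \<in> {-1..s} \<and> x \<in> {s..1})"
      using AE_lborel_singleton[of s] by eventually_elim auto
  qed (use f s in \<open>auto intro: set_integrable_subset\<close>)
  ultimately show ?thesis by simp
qed

lemma set_integral_derivative:
  fixes f f' :: "real \<Rightarrow> complex"
  assumes d: "\<And>t. t \<in> I11 \<Longrightarrow> (f has_vector_derivative f' t) (at t within I11)"
    and c: "continuous_on I11 f'" and ab: "a \<in> I11" "b \<in> I11" "a \<le> b"
  shows "(LINT r:{a..b}|lborel. f' r) = f b - f a"
proof -
  have sub: "{a..b} \<subseteq> I11" using ab by auto
  have "set_integrable lborel {a..b} f'"
    using continuous_on_subset[OF c sub] by (rule borel_integrable_atLeastAtMost')
  then have "(LINT r:{a..b}|lborel. f' r) = integral {a..b} f'"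
    by (rule set_borel_integral_eq_integral(2))
  also have "(f' has_integral (f b - f a)) {a..b}"
    using d sub by (intro fundamental_theorem_of_calculus ab(3)) (meson has_vector_derivative_within_subset subsetD)
  then have "integral {a..b} f' = f b - f a" by (rule integral_unique)
  finally show ?thesis .
qed

lemma indefinite_integral_has_derivative:
  fixes h :: "real \<Rightarrow> complex"
  assumes h: "continuous_on I11 h" and s: "s \<in> I11"
  shows "((\<lambda>s. LINT r:{-1..s}|lborel. h r) has_vector_derivative h s) (at s within I11)"
proof (rule has_vector_derivative_transform[OF s _ integral_has_vector_derivative[OF h s]])
  fix x assume x: "x \<in> I11"
  have "set_integrable lborel {-1..x} h"
    using continuous_on_subset[OF h] x by (intro borel_integrable_atLeastAtMost') auto
  then show "(LINT r:{-1..x}|lborel. h r) = integral {-1..x} h"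
    by (rule set_borel_integral_eq_integral(2))
qed

text \<open>Absolute continuity with density \<open>g\<close>, stated through the integral because
  the last function in a Sobolev chain is only integrable and has no pointwise meaning.\<close>

definition primitive_of :: "(real \<Rightarrow> complex) \<Rightarrow> (real \<Rightarrow> complex) \<Rightarrow> bool" where
  "primitive_of b g \<longleftrightarrow> set_integrable lborel I11 g \<and>
     (\<forall>t\<in>I11. b t = b (-1) + (LINT r:{-1..t}|lborel. g r))"

lemma primitive_ofD:
  assumes "primitive_of b g"
  shows primitive_of_integrable: "set_integrable lborel I11 g"
    and primitive_of_eq: "\<And>t. t \<in> I11 \<Longrightarrow> b t = b (-1) + (LINT r:{-1..t}|lborel. g r)"
  using assms unfolding primitive_of_def by blast+

lemma primitive_of_continuous: "primitive_of b g \<Longrightarrow> continuous_on I11 b"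
proof -
  assume bg: "primitive_of b g"
  have "continuous_on I11 (\<lambda>s. b (-1) + (LINT t:{-1..s}|lborel. 1 * g t))"
    by (intro continuous_intros continuous_on_parametric_integral primitive_of_integrable[OF bg])
       (simp add: split_beta')
  then show ?thesis
    by (rule continuous_on_eq) (simp add: primitive_of_eq[OF bg, symmetric])
qed

lemma primitive_of_set_integrable: "primitive_of b g \<Longrightarrow> set_integrable lborel I11 b"
  by (intro borel_integrable_atLeastAtMost' primitive_of_continuous)

lemma primitive_of_derivative:
  assumes "\<And>t. t \<in> I11 \<Longrightarrow> (f has_vector_derivative f' t) (at t within I11)"
    and c: "continuous_on I11 f'"
  shows "primitive_of f f'"
  unfolding primitive_of_def
proof (intro conjI ballI)
  show "f t = f (-1) + (LINT r:{-1..t}|lborel. f' r)" if "t \<in> I11" for t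
    by (subst set_integral_derivative[OF assms]) (use that in auto)
qed (rule borel_integrable_atLeastAtMost'[OF c])

text \<open>\<open>b\<close> is only absolutely continuous, so no pointwise product rule is
  available. Instead f s - f t is written as the integral of \<open>f'\<close> over
  \<open>{t..s}\<close> and the order of integration is exchanged over the triangle; the inner
  integral of \<open>g\<close> is then b r - b (-1).\<close>

lemma integration_by_parts_primitive:
  fixes f f' b g :: "real \<Rightarrow> complex"
  assumes d: "\<And>t. t \<in> I11 \<Longrightarrow> (f has_vector_derivative f' t) (at t within I11)"
    and c: "continuous_on I11 f'" and bg: "primitive_of b g" and s: "s \<in> I11"
  shows "(LINT t:{-1..s}|lborel. f t * g t)
     = f s * b s - f (-1) * b (-1) - (LINT t:{-1..s}|lborel. f' t * b t)"
proof -
  have sub: "{-1..s} \<subseteq> I11" using s by auto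
  note gi = primitive_of_integrable[OF bg]
  have gis: "set_integrable lborel {-1..s} g" by (rule set_integrable_subset[OF gi _ sub]) simp
  have cf: "continuous_on I11 f" using d has_vector_derivative_continuous continuous_on_eq_continuous_within by blast
  have c': "continuous_on (I11 \<times> I11) (\<lambda>(r,t::real). f' r)"
    unfolding split_beta' by (rule continuous_on_compose2[OF c]) (auto intro!: continuous_intros)
  have fi: "set_integrable lborel {-1..s} (\<lambda>t. f t * g t)"
    by (rule set_integrable_continuous_mult[OF continuous_on_subset[OF cf sub] gis])
  have c's: "continuous_on {-1..s} f'" by (rule continuous_on_subset[OF c sub])
  have bs: "set_integrable lborel {-1..s} b"
    by (rule set_integrable_subset[OF primitive_of_set_integrable[OF bg] _ sub]) simp
  have "(LINT t:{-1..s}|lborel. (LINT r:{t..s}|lborel. f' r) * g t)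
      = (LINT t:{-1..s}|lborel. f s * g t - f t * g t)"
  proof (rule set_lebesgue_integral_cong)
    show "\<forall>x. x \<in> {-1..s} \<longrightarrow> (LINT r:{x..s}|lborel. f' r) * g x = f s * g x - f x * g x"
      using set_integral_derivative[OF d c] s by (auto simp: left_diff_distrib)
  qed simp
  also have "\<dots> = f s * (LINT t:{-1..s}|lborel. g t) - (LINT t:{-1..s}|lborel. f t * g t)"
    using fi gis by simp
  also have "(LINT t:{-1..s}|lborel. g t) = b s - b (-1)"
    using primitive_of_eq[OF bg s] by simp
  finally have 1: "(LINT t:{-1..s}|lborel. (LINT r:{t..s}|lborel. f' r) * g t)
     = f s * (b s - b (-1)) - (LINT t:{-1..s}|lborel. f t * g t)" .
  have "(LINT t:{-1..s}|lborel. (LINT r:{t..s}|lborel. f' r) * g t)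
     = (LINT r:{-1..s}|lborel. (LINT t:{-1..r}|lborel. f' r * g t))"
    by (rule set_integral_swap_triangle[OF c' gi s])
  also have "\<dots> = (LINT r:{-1..s}|lborel. f' r * b r - f' r * b (-1))"
  proof (rule set_lebesgue_integral_cong)
    show "\<forall>x. x \<in> {-1..s} \<longrightarrow> (LINT t:{-1..x}|lborel. f' x * g t) = f' x * b x - f' x * b (-1)"
    proof (intro allI impI)
      fix x assume "x \<in> {-1..s}"
      then have "b x = b (-1) + (LINT r:{-1..x}|lborel. g r)"
        using s by (intro primitive_of_eq[OF bg]) auto
      then show "(LINT t:{-1..x}|lborel. f' x * g t) = f' x * b x - f' x * b (-1)"
        by (simp add: algebra_simps)
    qed
  qed simp
  also have "\<dots> = (LINT r:{-1..s}|lborel. f' r * b r) - (LINT r:{-1..s}|lborel. f' r * b (-1))"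
    using set_integrable_continuous_mult[OF c's bs] borel_integrable_atLeastAtMost'[OF c's]
    by (intro set_integral_diff(2)) auto
  also have "(LINT r:{-1..s}|lborel. f' r * b (-1)) = (f s - f (-1)) * b (-1)"
    using set_integral_derivative[OF d c, of "-1" s] s by simp
  finally show ?thesis using 1 by algebra
qed

text \<open>No difference quotients: K x t - K t t is the integral of A r t over r from t to x, so
  by Fubini over the triangle the function is the indefinite integral of the continuous
  \<open>?h\<close>, and the fundamental theorem of calculus gives its derivative.\<close>

lemma leibniz_triangle:
  fixes K A :: "real \<Rightarrow> real \<Rightarrow> complex" and b :: "real \<Rightarrow> complex"
  assumes K: "continuous_on (I11 \<times> I11) (\<lambda>(s,t). K s t)"
    and A: "continuous_on (I11 \<times> I11) (\<lambda>(s,t). A s t)"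
    and KA: "\<And>s t. s \<in> I11 \<Longrightarrow> t \<in> I11 \<Longrightarrow> ((\<lambda>s. K s t) has_vector_derivative A s t) (at s within I11)"
    and b: "continuous_on I11 b" and s: "s \<in> I11"
  shows "((\<lambda>s. LINT t:{-1..s}|lborel. K s t * b t) has_vector_derivative
     (K s s * b s + (LINT t:{-1..s}|lborel. A s t * b t))) (at s within I11)"
proof -
  let ?h = "\<lambda>r. K r r * b r + (LINT t:{-1..r}|lborel. A r t * b t)"
  have bi: "set_integrable lborel I11 b" by (rule borel_integrable_atLeastAtMost'[OF b])
  have cKd: "continuous_on I11 (\<lambda>r. K r r * b r)"
    by (intro continuous_intros continuous_on_square_diag[OF K] b)
  have cA: "continuous_on I11 (\<lambda>r. LINT t:{-1..r}|lborel. A r t * b t)"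
    by (rule continuous_on_parametric_integral[OF A bi])
  have ch: "continuous_on I11 ?h" by (intro continuous_intros cKd cA)
  have eq: "(LINT t:{-1..x}|lborel. K x t * b t) = (LINT r:{-1..x}|lborel. ?h r)" if x: "x \<in> I11" for x
  proof -
    have sub: "{-1..x} \<subseteq> I11" using x by auto
    have i1: "set_integrable lborel {-1..x} (\<lambda>r. K r r * b r)"
      by (rule borel_integrable_atLeastAtMost'[OF continuous_on_subset[OF cKd sub]])
    have i2: "set_integrable lborel {-1..x} (\<lambda>r. LINT t:{-1..r}|lborel. A r t * b t)"
      by (rule borel_integrable_atLeastAtMost'[OF continuous_on_subset[OF cA sub]])
    have i3: "set_integrable lborel {-1..x} (\<lambda>t. K x t * b t)"
      by (intro borel_integrable_atLeastAtMost' continuous_intros continuous_on_subset[OF b sub]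
          continuous_on_subset[OF continuous_on_square_section(1)[OF K x] sub])
    have "(LINT r:{-1..x}|lborel. ?h r) = (LINT r:{-1..x}|lborel. K r r * b r)
       + (LINT r:{-1..x}|lborel. LINT t:{-1..r}|lborel. A r t * b t)"
      by (rule set_integral_add(2)[OF i1 i2])
    also have "(LINT r:{-1..x}|lborel. LINT t:{-1..r}|lborel. A r t * b t)
       = (LINT t:{-1..x}|lborel. (LINT r:{t..x}|lborel. A r t) * b t)"
      by (rule set_integral_swap_triangle[OF A bi x, symmetric])
    also have "\<dots> = (LINT t:{-1..x}|lborel. K x t * b t - K t t * b t)"
    proof (rule set_lebesgue_integral_cong)
      show "\<forall>t. t \<in> {-1..x} \<longrightarrow> (LINT r:{t..x}|lborel. A r t) * b t = K x t * b t - K t t * b t"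
      proof (intro allI impI)
        fix t assume t: "t \<in> {-1..x}"
        then have t': "t \<in> I11" using x by auto
        have "(LINT r:{t..x}|lborel. A r t) = K x t - K t t"
          by (rule set_integral_derivative[OF KA continuous_on_square_section(2)[OF A t'] t' x])
             (use t t' in auto)
        then show "(LINT r:{t..x}|lborel. A r t) * b t = K x t * b t - K t t * b t"
          by (simp only: left_diff_distrib)
      qed
    qed simp
    also have "\<dots> = (LINT t:{-1..x}|lborel. K x t * b t) - (LINT t:{-1..x}|lborel. K t t * b t)"
      by (rule set_integral_diff(2)[OF i3 i1])
    finally show ?thesis by simp
  qed
  show ?thesis
    by (rule has_vector_derivative_transform[OF s eq indefinite_integral_has_derivative[OF ch s]])
qed

text \<open>Fubini over a rectangle exhibits the function as a constant plus an indefinite integral.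
  With fixed limits there is no diagonal term, so an integrable \<open>g\<close> suffices where the
  triangle version works with a continuous \<open>b\<close>.\<close>

lemma leibniz_rectangle:
  fixes K A :: "real \<Rightarrow> real \<Rightarrow> complex" and g :: "real \<Rightarrow> complex"
  assumes K: "continuous_on (I11 \<times> I11) (\<lambda>(s,t). K s t)"
    and A: "continuous_on (I11 \<times> I11) (\<lambda>(s,t). A s t)"
    and KA: "\<And>s t. s \<in> I11 \<Longrightarrow> t \<in> I11 \<Longrightarrow> ((\<lambda>s. K s t) has_vector_derivative A s t) (at s within I11)"
    and g: "set_integrable lborel I11 g" and s: "s \<in> I11"
  shows "((\<lambda>s. LINT t:I11|lborel. K s t * g t) has_vector_derivative
     (LINT t:I11|lborel. A s t * g t)) (at s within I11)"
proof -
  have cA: "continuous_on I11 (\<lambda>r. LINT t:I11|lborel. A r t * g t)"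
    by (rule continuous_on_parametric_integral[OF A g])
  have Ki: "set_integrable lborel I11 (\<lambda>t. K x t * g t)" if "x \<in> I11" for x
    by (rule set_integrable_continuous_mult[OF continuous_on_square_section(1)[OF K that] g])
  have eq: "(LINT t:I11|lborel. K x t * g t)
      = (LINT t:I11|lborel. K (-1) t * g t) + (LINT r:{-1..x}|lborel. LINT t:I11|lborel. A r t * g t)"
    if x: "x \<in> I11" for x
  proof -
    have "(LINT r:{-1..x}|lborel. LINT t:I11|lborel. A r t * g t)
       = (LINT t:I11|lborel. (LINT r:{-1..x}|lborel. A r t) * g t)"
      by (rule set_integral_swap_rectangle[OF A g x, symmetric])
    also have "\<dots> = (LINT t:I11|lborel. K x t * g t - K (-1) t * g t)"
    proof (rule set_lebesgue_integral_cong)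
      show "\<forall>t. t \<in> I11 \<longrightarrow> (LINT r:{-1..x}|lborel. A r t) * g t = K x t * g t - K (-1) t * g t"
      proof (intro allI impI)
        fix t assume t: "t \<in> I11"
        have "(LINT r:{-1..x}|lborel. A r t) = K x t - K (-1) t"
          by (rule set_integral_derivative[OF KA continuous_on_square_section(2)[OF A t]])
             (use t x in auto)
        then show "(LINT r:{-1..x}|lborel. A r t) * g t = K x t * g t - K (-1) t * g t"
          by (simp only: left_diff_distrib)
      qed
    qed simp
    also have "\<dots> = (LINT t:I11|lborel. K x t * g t) - (LINT t:I11|lborel. K (-1) t * g t)"
      by (rule set_integral_diff(2)[OF Ki Ki]) (use x in auto)
    finally show ?thesis by simp
  qed
  show ?thesis
  proof (rule has_vector_derivative_transform[OF s eq])
    show "((\<lambda>x. (LINT t:I11|lborel. K (-1) t * g t) + (LINT r:{-1..x}|lborel. LINT t:I11|lborel. A r t * g t))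
       has_vector_derivative (LINT t:I11|lborel. A s t * g t)) (at s within I11)"
      using has_vector_derivative_add[OF has_vector_derivative_const indefinite_integral_has_derivative[OF cA s]]
      by simp
  qed
qed

text \<open>Leibniz leaves the diagonal term K s s * b s, and integrating K g by parts gives the
  same term minus the integral of B b. Eliminating it replaces \<open>A\<close> by
  \<open>A + B\<close>. The sum is a parameter \<open>C\<close> of its own because in the
  application \<open>A\<close> and \<open>B\<close> contain the frequency while \<open>C\<close>
  does not. The right half is the full integral minus the left half.\<close>

lemma volterra_derivative:
  fixes K A B C :: "real \<Rightarrow> real \<Rightarrow> complex" and b g :: "real \<Rightarrow> complex"
  assumes K: "continuous_on (I11 \<times> I11) (\<lambda>(s,t). K s t)"
    and A: "continuous_on (I11 \<times> I11) (\<lambda>(s,t). A s t)"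
    and B: "continuous_on (I11 \<times> I11) (\<lambda>(s,t). B s t)"
    and KA: "\<And>s t. s \<in> I11 \<Longrightarrow> t \<in> I11 \<Longrightarrow> ((\<lambda>s. K s t) has_vector_derivative A s t) (at s within I11)"
    and KB: "\<And>s t. s \<in> I11 \<Longrightarrow> t \<in> I11 \<Longrightarrow> ((\<lambda>t. K s t) has_vector_derivative B s t) (at t within I11)"
    and C: "\<And>s t. s \<in> I11 \<Longrightarrow> t \<in> I11 \<Longrightarrow> A s t + B s t = C s t"
    and bg: "primitive_of b g" and s: "s \<in> I11"
  shows "K s (-1) = 0 \<Longrightarrow> ((\<lambda>s. LINT t:{-1..s}|lborel. K s t * b t) has_vector_derivative
      ((LINT t:{-1..s}|lborel. C s t * b t) + (LINT t:{-1..s}|lborel. K s t * g t))) (at s within I11)"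
    and "K s 1 = 0 \<Longrightarrow> ((\<lambda>s. LINT t:{s..1}|lborel. K s t * b t) has_vector_derivative
      ((LINT t:{s..1}|lborel. C s t * b t) + (LINT t:{s..1}|lborel. K s t * g t))) (at s within I11)"
proof -
  note b = primitive_of_continuous[OF bg] and bi = primitive_of_set_integrable[OF bg]
    and gi = primitive_of_integrable[OF bg]
  have Ki: "set_integrable lborel I11 (\<lambda>t. K x t * h t)" if "x \<in> I11" "set_integrable lborel I11 h" for x h
    by (rule set_integrable_continuous_mult[OF continuous_on_square_section(1)[OF K that(1)] that(2)])
  have Ai: "set_integrable lborel I11 (\<lambda>t. A x t * h t)" if "x \<in> I11" "set_integrable lborel I11 h" for x h
    by (rule set_integrable_continuous_mult[OF continuous_on_square_section(1)[OF A that(1)] that(2)])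
  have Bi: "set_integrable lborel I11 (\<lambda>t. B x t * h t)" if "x \<in> I11" "set_integrable lborel I11 h" for x h
    by (rule set_integrable_continuous_mult[OF continuous_on_square_section(1)[OF B that(1)] that(2)])
  have Ceq: "(LINT t:S|lborel. C s t * b t) = (LINT t:S|lborel. A s t * b t) + (LINT t:S|lborel. B s t * b t)"
    if S: "S \<subseteq> I11" "S \<in> sets lborel" for S
  proof -
    have "(LINT t:S|lborel. C s t * b t) = (LINT t:S|lborel. A s t * b t + B s t * b t)"
    proof (rule set_lebesgue_integral_cong[OF S(2)], intro allI impI)
      fix t assume "t \<in> S"
      then have "C s t = A s t + B s t" using C[OF s] S by force
      then show "C s t * b t = A s t * b t + B s t * b t" by (simp add: algebra_simps)
    qed
    also have "\<dots> = (LINT t:S|lborel. A s t * b t) + (LINT t:S|lborel. B s t * b t)"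
      using set_integrable_subset[OF Ai[OF s bi] S(2,1)] set_integrable_subset[OF Bi[OF s bi] S(2,1)]
      by (rule set_integral_add(2))
    finally show ?thesis .
  qed
  have ibp: "(LINT t:{-1..x}|lborel. K s t * g t)
      = K s x * b x - K s (-1) * b (-1) - (LINT t:{-1..x}|lborel. B s t * b t)" if "x \<in> I11" for x
    by (rule integration_by_parts_primitive[OF KB[OF s] continuous_on_square_section(1)[OF B s] bg that])
  note tri = leibniz_triangle[OF K A KA b s]
  have sub: "{-1..s} \<subseteq> I11" using s by auto
  show "((\<lambda>s. LINT t:{-1..s}|lborel. K s t * b t) has_vector_derivative
      ((LINT t:{-1..s}|lborel. C s t * b t) + (LINT t:{-1..s}|lborel. K s t * g t))) (at s within I11)"
    if "K s (-1) = 0"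
    using tri ibp[OF s] that Ceq[OF sub] by (simp add: algebra_simps)
  have "((\<lambda>s. (LINT t:I11|lborel. K s t * b t) - (LINT t:{-1..s}|lborel. K s t * b t)) has_vector_derivative
     (LINT t:I11|lborel. A s t * b t) - (K s s * b s + (LINT t:{-1..s}|lborel. A s t * b t))) (at s within I11)"
    by (rule has_vector_derivative_diff[OF leibniz_rectangle[OF K A KA bi s] tri])
  then have full: "((\<lambda>s. LINT t:{s..1}|lborel. K s t * b t) has_vector_derivative
     (LINT t:I11|lborel. A s t * b t) - (K s s * b s + (LINT t:{-1..s}|lborel. A s t * b t))) (at s within I11)"
    by (rule has_vector_derivative_transform[OF s, rotated])
       (use set_integral_split[OF Ki[OF _ bi]] in auto)
  show "((\<lambda>s. LINT t:{s..1}|lborel. K s t * b t) has_vector_derivative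
      ((LINT t:{s..1}|lborel. C s t * b t) + (LINT t:{s..1}|lborel. K s t * g t))) (at s within I11)"
    if "K s 1 = 0"
  proof -
    have "(LINT t:{s..1}|lborel. C s t * b t) + (LINT t:{s..1}|lborel. K s t * g t)
      = (LINT t:I11|lborel. A s t * b t) - (K s s * b s + (LINT t:{-1..s}|lborel. A s t * b t))"
    proof -
      have one: "(1::real) \<in> I11" and set1: "{s..1} \<subseteq> I11" "{s..1} \<in> sets lborel" using s by auto
      show ?thesis
        using ibp[OF s] ibp[OF one] that Ceq[OF set1] set_integral_split[OF Ki[OF s gi] s]
          set_integral_split[OF Ai[OF s bi] s] set_integral_split[OF Bi[OF s bi] s]
        by algebra
    qed
    with full show ?thesis by simp
  qed
qed

section \<open>Test functions\<close>

text \<open>The functions p(1/x) e^(-1/x), continued by 0 to x \<le> 0. Admitting a polynomial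
  factor closes the class under differentiation, so a single derivative computation settles all
  orders.\<close>

definition flat_exp :: "real poly \<Rightarrow> real \<Rightarrow> real" where
  "flat_exp p x = (if x > 0 then poly p (inverse x) * exp (- inverse x) else 0)"

lemma poly_times_exp_tendsto_0:
  fixes p :: "real poly"
  shows "((\<lambda>y. poly p y * exp (- y)) \<longlongrightarrow> 0) at_top"
proof -
  have "((\<lambda>y. \<Sum>i\<le>degree p. coeff p i * (y ^ i / exp y)) \<longlongrightarrow> (\<Sum>i\<le>degree p. coeff p i * 0)) at_top"
    by (intro tendsto_intros tendsto_power_div_exp_0)
  then show ?thesis
    by (simp add: poly_altdef sum_distrib_right exp_minus divide_inverse mult.assoc)
qed

text \<open>With y = 1/x, the rule d/dx = -y^2 d/dy turns p(y) e^(-y) into y^2 (p(y) - p'(y))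
  e^(-y). At 0 the right difference quotient is y p(y) e^(-y), which tends to 0 as y tends to
  infinity.\<close>

lemma flat_exp_has_derivative:
  "(flat_exp p has_real_derivative flat_exp (monom 1 2 * (p - pderiv p)) x) (at x)"
proof -
  consider "x > 0" | "x < 0" | "x = 0" by linarith
  then show ?thesis
  proof cases
    case 1
    have "((\<lambda>x. poly p (inverse x) * exp (- inverse x)) has_real_derivative
        flat_exp (monom 1 2 * (p - pderiv p)) x) (at x)"
      using 1 by (auto intro!: derivative_eq_intros DERIV_chain'[OF _ poly_DERIV]
          simp: flat_exp_def poly_monom power2_eq_square algebra_simps)
    then show ?thesis
      by (rule has_field_derivative_transform_within_open[where S="{0<..}"])
         (use 1 in \<open>auto simp: flat_exp_def\<close>)
  next
    case 2
    have "((\<lambda>x. 0) has_real_derivative 0) (at x)" by simp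
    then have "(flat_exp p has_real_derivative 0) (at x)"
      by (rule has_field_derivative_transform_within_open[where S="{..<0}"])
         (use 2 in \<open>auto simp: flat_exp_def\<close>)
    then show ?thesis using 2 by (simp add: flat_exp_def)
  next
    case 3
    have "((\<lambda>h. poly (monom 1 1 * p) (inverse h) * exp (- inverse h)) \<longlongrightarrow> 0) (at_right (0::real))"
      by (rule filterlim_compose[OF poly_times_exp_tendsto_0 filterlim_inverse_at_top_right])
    then have "((\<lambda>h. (flat_exp p (0 + h) - flat_exp p 0) / h) \<longlongrightarrow> 0) (at_right 0)"
      by (rule Lim_transform_eventually)
         (auto simp: flat_exp_def poly_monom divide_inverse eventually_at_right_field intro!: exI[of _ 1])
    moreover have "((\<lambda>h. (flat_exp p (0 + h) - flat_exp p 0) / h) \<longlongrightarrow> 0) (at_left 0)"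
      by (rule tendsto_eventually) (auto simp: flat_exp_def eventually_at_left_field intro!: exI[of _ "-1"])
    ultimately have "((\<lambda>h. (flat_exp p (0 + h) - flat_exp p 0) / h) \<longlongrightarrow> 0) (at 0)"
      by (rule filterlim_split_at[rotated])
    then show ?thesis using 3 by (simp add: DERIV_def flat_exp_def)
  qed
qed

text \<open>Sums are included because the product rule yields two terms. The parameter
  \<open>c\<close> is the steepness of the flanks; it is sent to infinity when indicators are
  approximated.\<close>

inductive_set bumps :: "real \<Rightarrow> real \<Rightarrow> real \<Rightarrow> (real \<Rightarrow> real) set" for c a b where
  bumps_base: "(\<lambda>x. flat_exp p (c * (x - a)) * flat_exp q (c * (b - x))) \<in> bumps c a b"
| bumps_add: "f \<in> bumps c a b \<Longrightarrow> g \<in> bumps c a b \<Longrightarrow> (\<lambda>x. f x + g x) \<in> bumps c a b"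

lemma flat_exp_smult: "flat_exp (smult k p) x = k * flat_exp p x"
  by (simp add: flat_exp_def)

lemma bumps_derivative:
  assumes "f \<in> bumps c a b"
  shows "\<exists>g \<in> bumps c a b. \<forall>x. (f has_real_derivative g x) (at x)"
  using assms
proof induction
  case (bumps_base p q)
  let ?D = "\<lambda>p. monom 1 2 * (p - pderiv p)"
  \<comment> \<open>The chain-rule factors \<open>c\<close> and \<open>- c\<close> are absorbed into
    the polynomials, so the derivative is again a sum of generators.\<close>
  let ?g = "\<lambda>x. flat_exp (smult c (?D p)) (c * (x - a)) * flat_exp q (c * (b - x))
     + flat_exp p (c * (x - a)) * flat_exp (smult (- c) (?D q)) (c * (b - x))"
  have "?g \<in> bumps c a b" by (intro bumps.intros)
  moreover have "((\<lambda>x. flat_exp p (c * (x - a)) * flat_exp q (c * (b - x))) has_real_derivative ?g x) (at x)" for x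
    unfolding flat_exp_smult
    by (rule derivative_eq_intros DERIV_chain'[OF _ flat_exp_has_derivative] refl | simp add: algebra_simps)+
  ultimately show ?case by (intro bexI[of _ ?g]) simp_all
next
  case (bumps_add f g)
  then obtain f' g' where "f' \<in> bumps c a b" "g' \<in> bumps c a b"
    "\<And>x. (f has_real_derivative f' x) (at x)" "\<And>x. (g has_real_derivative g' x) (at x)" by blast
  then show ?case
    by (intro bexI[of _ "\<lambda>x. f' x + g' x"]) (auto intro: bumps.intros DERIV_add)
qed

lemma bumps_smooth:
  assumes "f \<in> bumps c a b"
  shows "(deriv ^^ k) f \<in> bumps c a b"
proof (induction k)
  case (Suc k)
  then obtain g where g: "g \<in> bumps c a b" "\<forall>x. ((deriv ^^ k) f has_real_derivative g x) (at x)"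
    using bumps_derivative by blast
  then have "deriv ((deriv ^^ k) f) = g" by (auto intro: DERIV_imp_deriv)
  then show ?case using g by simp
qed (use assms in simp)

lemma bump_test_fun:
  assumes "f \<in> bumps c a b" "-1 < a" "b < 1" "c > 0"
  shows "test_fun f"
  unfolding test_fun_def
proof (intro conjI allI exI)
  show "(deriv ^^ k) f differentiable at x" for k x
    using bumps_derivative[OF bumps_smooth[OF assms(1)]] unfolding real_differentiable_def by blast
  have "\<forall>t. t \<notin> {a..b} \<longrightarrow> f t = 0" using assms(1)
  proof induction
    case (bumps_base p q)
    then show ?case using \<open>c > 0\<close> by (auto simp: flat_exp_def zero_less_mult_iff)
  qed auto
  then show "t \<notin> {a..b} \<longrightarrow> f t = 0" for t by blast
qed (use assms in auto)

lemma flat_exp_1: "flat_exp 1 x = (if x > 0 then exp (- inverse x) else 0)"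
  by (simp add: flat_exp_def)

lemma flat_exp_bounds: "0 \<le> flat_exp 1 x" "flat_exp 1 x \<le> 1"
  by (simp_all add: flat_exp_1)

lemma test_funD:
  assumes "test_fun \<phi>"
  shows test_fun_has_derivative: "((deriv ^^ k) \<phi> has_real_derivative (deriv ^^ Suc k) \<phi> x) (at x)"
    and test_fun_continuous: "continuous_on S ((deriv ^^ k) \<phi>)"
    and test_fun_zero: "t \<le> -1 \<or> 1 \<le> t \<Longrightarrow> (deriv ^^ k) \<phi> t = 0"
proof -
  have d: "((deriv ^^ k) \<phi> has_real_derivative (deriv ^^ Suc k) \<phi> x) (at x)" for k x
    using assms DERIV_deriv_iff_real_differentiable unfolding test_fun_def by auto
  then show "((deriv ^^ k) \<phi> has_real_derivative (deriv ^^ Suc k) \<phi> x) (at x)" .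
  show "continuous_on S ((deriv ^^ k) \<phi>)"
    by (intro continuous_at_imp_continuous_on ballI DERIV_isCont[OF d])
  obtain a b where ab: "-1 < a" "b < 1" "\<And>t. t \<notin> {a..b} \<Longrightarrow> \<phi> t = 0"
    using assms unfolding test_fun_def by blast
  have "\<forall>t. t \<notin> {a..b} \<longrightarrow> (deriv ^^ k) \<phi> t = 0"
  proof (induction k)
    case (Suc k)
    show ?case
    proof (intro allI impI)
      fix t assume t: "t \<notin> {a..b}"
      have "((\<lambda>x. 0) has_real_derivative 0) (at t)" by simp
      then have "((deriv ^^ k) \<phi> has_real_derivative 0) (at t)"
        by (rule has_field_derivative_transform_within_open[where S="- {a..b}"]) (use t Suc in auto)
      then show "(deriv ^^ Suc k) \<phi> t = 0" by (simp add: DERIV_imp_deriv)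
    qed
  qed (use ab in auto)
  then show "t \<le> -1 \<or> 1 \<le> t \<Longrightarrow> (deriv ^^ k) \<phi> t = 0" using ab by auto
qed

lemma test_fun_deriv: assumes "test_fun \<phi>" shows "test_fun (deriv \<phi>)"
proof -
  obtain a b where ab: "-1 < a" "b < 1" "\<And>t. t \<notin> {a..b} \<Longrightarrow> \<phi> t = 0"
    using assms unfolding test_fun_def by blast
  have "deriv \<phi> t = 0" if t: "t \<notin> {a..b}" for t
  proof -
    have "((\<lambda>x. 0) has_real_derivative 0) (at t)" by simp
    then have "(\<phi> has_real_derivative 0) (at t)"
      by (rule has_field_derivative_transform_within_open[where S="- {a..b}"]) (use t ab in auto)
    then show ?thesis by (rule DERIV_imp_deriv)
  qed
  moreover have "(deriv ^^ k) (deriv \<phi>) differentiable at x" for k x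
    using assms unfolding test_fun_def by (metis comp_apply funpow_Suc_right)
  ultimately show ?thesis unfolding test_fun_def using ab by blast
qed

text \<open>A primitive of a test function can have compact support only if the total integral
  vanishes; subtracting \<open>c * \<psi>\<close> removes that integral.\<close>

lemma test_fun_primitive:
  assumes \<phi>: "test_fun \<phi>" and \<psi>: "test_fun \<psi>"
    and zero: "integral I11 \<phi> = c * integral I11 \<psi>"
  obtains \<Phi> where "test_fun \<Phi>" "deriv \<Phi> = (\<lambda>t. \<phi> t - c * \<psi> t)"
proof -
  let ?h = "\<lambda>t. \<phi> t - c * \<psi> t"
  have h: "(deriv ^^ k) ?h = (\<lambda>t. (deriv ^^ k) \<phi> t - c * (deriv ^^ k) \<psi> t)" for k
  proof (induction k)
    case (Suc k)
    show ?case
    proof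
      fix t
      have "((deriv ^^ k) ?h has_real_derivative (deriv ^^ Suc k) \<phi> t - c * (deriv ^^ Suc k) \<psi> t) (at t)"
        unfolding Suc by (intro DERIV_diff DERIV_cmult test_fun_has_derivative \<phi> \<psi>)
      then show "(deriv ^^ Suc k) ?h t = (deriv ^^ Suc k) \<phi> t - c * (deriv ^^ Suc k) \<psi> t"
        by (simp add: DERIV_imp_deriv)
    qed
  qed simp
  have hd: "(deriv ^^ k) ?h differentiable at t" for k t
    unfolding h real_differentiable_def
    by (rule exI, rule DERIV_diff[OF test_fun_has_derivative[OF \<phi>] DERIV_cmult[OF test_fun_has_derivative[OF \<psi>]]])
  have ch: "continuous_on S ?h" for S
    using test_fun_continuous[OF \<phi>, of S 0] test_fun_continuous[OF \<psi>, of S 0] by (auto intro!: continuous_intros)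
  obtain a b where ab: "-1 < a" "b < 1" "\<And>t. t \<notin> {a..b} \<Longrightarrow> \<phi> t = 0"
    using \<phi> unfolding test_fun_def by blast
  obtain a' b' where ab': "-1 < a'" "b' < 1" "\<And>t. t \<notin> {a'..b'} \<Longrightarrow> \<psi> t = 0"
    using \<psi> unfolding test_fun_def by blast
  \<comment> \<open>Enlarging both supports to contain 0 gives -1 < a0 \<le> 0 \<le> b0 < 1, a
    common nonempty support interval.\<close>
  define a0 where "a0 = min (min a a') 0"
  define b0 where "b0 = max (max b b') 0"
  have ab0: "-1 < a0" "a0 \<le> 0" "0 \<le> b0" "b0 < 1" using ab ab' by (auto simp: a0_def b0_def)
  have h0: "?h t = 0" if "t \<notin> {a0..b0}" for t
    proof -
    have "t \<notin> {a..b}" "t \<notin> {a'..b'}" using that by (auto simp: a0_def b0_def)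
    then show ?thesis using ab(3) ab'(3) by simp
  qed
  define \<Phi> where "\<Phi> t = (if t < -1 then 0 else integral {-1..t} ?h)" for t
  have ci: "?h integrable_on {x..y}" for x y by (intro integrable_continuous_interval ch)
  have \<Phi>lo: "\<Phi> t = 0" if "t < a0" for t
  proof (cases "t < -1")
    case False
    have "integral {-1..t} ?h = integral {-1..t} (\<lambda>_. 0)"
      by (rule integral_cong) (use that h0 in auto)
    with False show ?thesis by (simp add: \<Phi>_def)
  qed (simp add: \<Phi>_def)
  have full: "integral I11 ?h = 0"
  proof -
    have "integral I11 ?h = integral I11 \<phi> - integral I11 (\<lambda>t. c * \<psi> t)"
      using test_fun_continuous[OF \<phi>, of I11 0] test_fun_continuous[OF \<psi>, of I11 0]
      by (intro integral_diff integrable_continuous_interval) (auto intro!: continuous_intros)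
    also have "\<dots> = 0" using zero by simp
    finally show ?thesis .
  qed
  have \<Phi>hi: "\<Phi> t = 0" if "t > b0" for t
  proof -
    have z: "integral {b0..y} ?h = 0" for y
    proof -
      have "integral {b0..y} ?h = integral {b0..y} (\<lambda>_. 0)"
        by (rule integral_spike[of "{b0}"]) (use h0 in auto)
      then show ?thesis by simp
    qed
    have "integral {-1..y} ?h = integral {-1..b0} ?h" if "y \<ge> b0" for y
      using Henstock_Kurzweil_Integration.integral_combine[of "-1" b0 y ?h] ab0 that ci z by simp
    from this[of 1] this[of t] full that ab0 show ?thesis by (simp add: \<Phi>_def)
  qed
  have d\<Phi>: "(\<Phi> has_real_derivative ?h t) (at t)" for t
  \<comment> \<open>The right end 2 makes t = 1 an interior point for the fundamental theorem of
    calculus; a point outside this range lies off the support.\<close>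
  proof (cases "t \<in> {-1<..<2}")
    case True
    have "((\<lambda>t. integral {-1..t} ?h) has_real_derivative ?h t) (at t within {-1..2})"
      by (rule integral_has_real_derivative[OF ch]) (use True in auto)
    then have "((\<lambda>t. integral {-1..t} ?h) has_real_derivative ?h t) (at t)"
      using True by (simp add: at_within_Icc_at)
    then show ?thesis
      by (rule has_field_derivative_transform_within_open[where S="{-1<..<2}"]) (use True in \<open>auto simp: \<Phi>_def\<close>)
  next
    case False
    then have t: "t \<notin> {a0..b0}" using ab0 by auto
    have "((\<lambda>x. 0) has_real_derivative 0) (at t)" by simp
    then have "(\<Phi> has_real_derivative 0) (at t)"
      by (rule has_field_derivative_transform_within_open[where S="- {a0..b0}"]) (use t \<Phi>lo \<Phi>hi in auto)
    then show ?thesis using h0[OF t] by simp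
  qed
  have dd: "deriv \<Phi> = ?h" using d\<Phi> by (auto intro: DERIV_imp_deriv)
  have "test_fun \<Phi>"
    unfolding test_fun_def
  proof (intro conjI allI exI)
    show "(deriv ^^ k) \<Phi> differentiable at x" for k x
    proof (cases k)
      case 0 then show ?thesis using d\<Phi> by (auto simp: real_differentiable_def)
    next
      case (Suc j) then show ?thesis using hd[of j x] dd by (simp add: funpow_Suc_right del: funpow.simps)
    qed
    show "t \<notin> {a0..b0} \<longrightarrow> \<Phi> t = 0" for t using \<Phi>lo \<Phi>hi by auto
  qed (use ab0 in auto)
  then show thesis using dd that by blast
qed

lemma test_fun_unit:
  obtains \<psi> where "test_fun \<psi>" "integral I11 \<psi> = 1"
proof -
  let ?f = "\<lambda>x. flat_exp 1 (1 * (x - (-1/2))) * flat_exp 1 (1 * (1/2 - x))"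
  have "?f \<in> bumps 1 (-1/2) (1/2)" by (rule bumps_base)
  then have f: "test_fun ?f" by (rule bump_test_fun) auto
  have cf: "continuous_on I11 ?f" using test_fun_continuous[OF f, of I11 0] by simp
  have pos: "0 \<le> ?f x" for x by (intro mult_nonneg_nonneg flat_exp_bounds)
  have "integral I11 ?f \<noteq> 0"
  proof
    assume "integral I11 ?f = 0"
    then have "(?f has_integral 0) (cbox (-1) 1)"
      using integrable_integral[OF integrable_continuous_interval[OF cf]] by simp
    then have "?f 0 = 0"
      by (rule has_integral_0_cbox_imp_0[rotated 2]) (use cf pos in auto)
    then show False by (simp add: flat_exp_1)
  qed
  define c where "c = 1 / integral I11 ?f"
  \<comment> \<open>The normalising constant is put into the polynomial so that the function stays
    in \<open>bumps\<close>.\<close>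
  let ?g = "\<lambda>x. flat_exp [:c:] (1 * (x - (-1/2))) * flat_exp 1 (1 * (1/2 - x))"
  have g: "?g x = c * ?f x" for x by (simp add: flat_exp_def)
  have "?g \<in> bumps 1 (-1/2) (1/2)" by (rule bumps_base)
  then have "test_fun ?g" by (rule bump_test_fun) auto
  moreover have "integral I11 ?g = 1"
    unfolding g using \<open>integral I11 ?f \<noteq> 0\<close> by (simp add: c_def)
  ultimately show thesis by (rule that)
qed

section \<open>Fundamental lemma of the calculus of variations and du Bois-Reymond lemma\<close>

lemma set_integrable_test_mult:
  assumes "set_integrable lborel I11 g" "test_fun \<phi>"
  shows "set_integrable lborel I11 (\<lambda>t. g t * complex_of_real ((deriv ^^ k) \<phi> t))"
proof -
  have "set_integrable lborel I11 (\<lambda>t. complex_of_real ((deriv ^^ k) \<phi> t) * g t)"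
    by (intro set_integrable_continuous_mult assms continuous_intros test_fun_continuous)
  then show ?thesis by (simp add: mult.commute)
qed

text \<open>The rays generate the Borel sets and are stable under intersection, and the sets with
  vanishing integral form a Dynkin system, so every Borel integral vanishes. Complements require the
  integral over the whole line, a limit of integrals over rays.\<close>

lemma AE_zero_of_initial_integrals:
  fixes g :: "real \<Rightarrow> complex"
  assumes g: "integrable lborel g" and z: "\<And>a. (LINT x:{..a}|lborel. g x) = 0"
  shows "AE x in lborel. g x = 0"
proof (rule sigma_finite_measure.density_zero[OF lborel.sigma_finite_measure_axioms g])
  fix A :: "real set" assume "A \<in> sets lborel"
  then have A: "A \<in> sigma_sets UNIV (range (\<lambda>a. {..a}))"
    by (simp add: borel_eq_atMost)
  have stable: "Int_stable (range (\<lambda>a::real. {..a}))"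
    by (auto simp: Int_stable_def)
  have sets: "sigma_sets UNIV (range (\<lambda>a::real. {..a})) = sets lborel"
    by (simp add: borel_eq_atMost)
  have gi: "set_integrable lborel B g" if "B \<in> sets lborel" for B
    using g that unfolding set_integrable_def by (intro integrable_mult_indicator)
  have UN: "(LINT x:UNIV|lborel. g x) = 0"
  proof -
    have "(\<lambda>n. LINT x:{..real n}|lborel. g x) \<longlonglongrightarrow> (LINT x:(\<Union>n. {..real n})|lborel. g x)"
      by (rule set_integral_cont_up) (auto intro!: gi incseq_SucI)
    moreover have "(\<Union>n. {..real n}) = UNIV" using real_arch_simple by auto
    ultimately show ?thesis using LIMSEQ_unique[OF tendsto_const, of "0::complex"] z by simp
  qed
  from stable subset_UNIV[of "range (\<lambda>a::real. {..a})", unfolded Pow_UNIV[symmetric]] A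
  show "set_lebesgue_integral lborel A g = 0"
  proof (induction rule: sigma_sets_induct_disjoint[consumes 3, case_names basic empty compl union])
    case (basic B) then show ?case using z by auto
  next
    case empty then show ?case by (simp add: set_lebesgue_integral_def)
  next
    case (compl B)
    have "(LINT x:UNIV - B \<union> B|lborel. g x) = (LINT x:UNIV - B|lborel. g x) + (LINT x:B|lborel. g x)"
      by (rule set_integral_Un) (use compl sets in \<open>auto intro!: gi\<close>)
    then show ?case using compl UN by simp
  next
    case (union B)
    have "(LINT x:(\<Union>n. B n)|lborel. g x) = (\<Sum>n. (LINT x:B n|lborel. g x))"
      by (rule lebesgue_integral_countable_add) (use union sets in \<open>auto simp: disjoint_family_on_def intro!: gi\<close>)
    then show ?case using union by simp
  qed
qed

lemma flat_exp_tendsto_1: "(flat_exp 1 \<longlongrightarrow> 1) at_top"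
proof -
  have "((\<lambda>x::real. exp (- inverse x)) \<longlongrightarrow> exp (- 0)) at_top"
    by (intro tendsto_intros tendsto_inverse_0_at_top filterlim_ident)
  moreover have "\<forall>\<^sub>F x::real in at_top. exp (- inverse x) = flat_exp 1 x"
    using eventually_gt_at_top[of 0] by eventually_elim (simp add: flat_exp_1)
  ultimately show ?thesis using Lim_transform_eventually by fastforce
qed

lemma flat_exp_scaled_tendsto:
  assumes "d > 0"
  shows "(\<lambda>n. flat_exp 1 ((real (Suc n))\<^sup>2 * (d - 1 / real (Suc n)))) \<longlonglongrightarrow> 1"
proof (rule filterlim_compose[OF flat_exp_tendsto_1])
  show "filterlim (\<lambda>n. (real (Suc n))\<^sup>2 * (d - 1 / real (Suc n))) at_top sequentially"
  proof (rule filterlim_at_top_mono[OF filterlim_real_sequentially])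
    \<comment> \<open>From n + 1 \<ge> 2 / d follows d (n + 1) - 1 \<ge> 1, which makes the argument
      of \<open>flat_exp\<close> at least n + 1.\<close>
    obtain k where k: "2 / d \<le> real k" using real_arch_simple by blast
    show "\<forall>\<^sub>F n in sequentially. real n \<le> (real (Suc n))\<^sup>2 * (d - 1 / real (Suc n))"
      using eventually_ge_at_top[of k]
    proof eventually_elim
      case (elim n)
      have "2 / d \<le> real (Suc n)" using k elim by simp
      then have "1 \<le> d * real (Suc n) - 1" using assms by (simp add: field_simps)
      then have "real (Suc n) * 1 \<le> real (Suc n) * (d * real (Suc n) - 1)" by (rule mult_left_mono) simp
      also have "\<dots> = (real (Suc n))\<^sup>2 * (d - 1 / real (Suc n))"
        by (simp add: power2_eq_square field_simps)
      finally show ?case by simp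
    qed
  qed
qed

text \<open>Test functions that converge boundedly to the indicator of (-1, a) show that all
  integrals of \<open>g\<close> over rays vanish.\<close>

theorem fundamental_lemma_test_fun:
  fixes g :: "real \<Rightarrow> complex"
  assumes g: "set_integrable lborel I11 g"
    and z: "\<And>\<phi>. test_fun \<phi> \<Longrightarrow> (LINT t:I11|lborel. g t * complex_of_real (\<phi> t)) = 0"
  shows "AE t in lborel. t \<in> I11 \<longrightarrow> g t = 0"
proof -
  let ?g = "\<lambda>t. indicator I11 t *\<^sub>R g t"
  have gi: "integrable lborel ?g" using g by (simp add: set_integrable_def)
  have 1: "(LINT x:{..a}|lborel. ?g x) = 0" if a: "a \<le> 1" for a
  proof -
    \<comment> \<open>Moving the edges inwards by 1 / (n + 1) keeps the support inside the open
      interval even for a = 1; the steepness (n + 1)^2 drives the value at each interior point to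
      1.\<close>
    define \<phi> where "\<phi> n x = flat_exp 1 ((real (Suc n))\<^sup>2 * (x - (-1 + 1 / real (Suc n))))
        * flat_exp 1 ((real (Suc n))\<^sup>2 * ((a - 1 / real (Suc n)) - x))" for n x
    have "\<phi> n \<in> bumps ((real (Suc n))\<^sup>2) (-1 + 1 / real (Suc n)) (a - 1 / real (Suc n))" for n
      unfolding \<phi>_def by (rule bumps_base)
    then have \<phi>: "test_fun (\<phi> n)" for n
    proof (rule bump_test_fun)
      have "0 < 1 / real (Suc n)" by simp
      then show "-1 < -1 + 1 / real (Suc n)" "a - 1 / real (Suc n) < 1" using a by linarith+
    qed simp
    have bd: "\<bar>\<phi> n x\<bar> \<le> 1" for n x
      using flat_exp_bounds by (simp add: \<phi>_def abs_mult mult_le_one)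
    have zero: "\<phi> n x = 0" if "x \<notin> {-1<..<a}" for n x
    proof -
      have "x - (-1 + 1 / real (Suc n)) \<le> 0 \<or> (a - 1 / real (Suc n)) - x \<le> 0"
      proof -
        have "0 < 1 / real (Suc n)" by simp
        moreover have "x \<le> -1 \<or> a \<le> x" using that by auto
        ultimately show ?thesis by linarith
      qed
      then have "(real (Suc n))\<^sup>2 * (x - (-1 + 1 / real (Suc n))) \<le> 0
          \<or> (real (Suc n))\<^sup>2 * ((a - 1 / real (Suc n)) - x) \<le> 0"
        using mult_nonneg_nonpos[OF zero_le_power2] by blast
      then show ?thesis by (auto simp: \<phi>_def flat_exp_1)
    qed
    have lim: "(\<lambda>n. \<phi> n x) \<longlonglongrightarrow> indicator {-1<..<a} x" for x
    proof (cases "x \<in> {-1<..<a}")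
      case True
      have "(\<lambda>n. flat_exp 1 ((real (Suc n))\<^sup>2 * ((x + 1) - 1 / real (Suc n)))
         * flat_exp 1 ((real (Suc n))\<^sup>2 * ((a - x) - 1 / real (Suc n)))) \<longlonglongrightarrow> 1 * 1"
        by (intro tendsto_mult flat_exp_scaled_tendsto) (use True in auto)
      then show ?thesis using True unfolding \<phi>_def by (simp add: algebra_simps)
    qed (simp add: zero)
    have "(\<lambda>n. LINT t:I11|lborel. g t * complex_of_real (\<phi> n t)) \<longlonglongrightarrow> (LINT x:{..a}|lborel. ?g x)"
      unfolding set_lebesgue_integral_def
    proof (rule integral_dominated_convergence[where w="\<lambda>t. norm (?g t)"])
      show "integrable lborel (\<lambda>t. norm (?g t))" using gi by (rule integrable_norm)
      show "(\<lambda>x. indicator {..a} x *\<^sub>R ?g x) \<in> borel_measurable lborel"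
        by (rule borel_measurable_scaleR[OF borel_measurable_indicator borel_measurable_integrable[OF gi]]) simp
      show "(\<lambda>t. indicator I11 t *\<^sub>R (g t * complex_of_real (\<phi> n t))) \<in> borel_measurable lborel" for n
        using set_integrable_test_mult[OF g \<phi>[of n], of 0] by (auto simp: set_integrable_def)
      show "AE t in lborel. norm (indicator I11 t *\<^sub>R (g t * complex_of_real (\<phi> n t))) \<le> norm (?g t)" for n
        using bd[of n] by (intro AE_I2) (auto simp: indicator_def norm_mult mult_left_le)
      show "AE t in lborel. (\<lambda>n. indicator I11 t *\<^sub>R (g t * complex_of_real (\<phi> n t)))
          \<longlonglongrightarrow> indicator {..a} t *\<^sub>R ?g t"
        using AE_lborel_singleton[of a] AE_lborel_singleton[of "-1"]
      proof eventually_elim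
        case (elim t)
        have "(\<lambda>n. indicator I11 t *\<^sub>R (g t * complex_of_real (\<phi> n t)))
          \<longlonglongrightarrow> indicator I11 t *\<^sub>R (g t * complex_of_real (indicator {-1<..<a} t))"
          by (intro tendsto_intros lim)
        also have "indicator I11 t *\<^sub>R (g t * complex_of_real (indicator {-1<..<a} t)) = indicator {..a} t *\<^sub>R ?g t"
          using elim a by (auto simp: indicator_def)
        finally show ?case .
      qed
    qed
    then show ?thesis using z[OF \<phi>] LIMSEQ_unique[OF tendsto_const, of "0::complex"] by simp
  qed
  have "(LINT x:{..a}|lborel. ?g x) = 0" for a
  proof (cases "a \<le> 1")
    case False
    then have "(\<lambda>x. indicator {..a} x *\<^sub>R ?g x) = (\<lambda>x. indicator {..1} x *\<^sub>R ?g x)"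
      by (auto simp: indicator_def fun_eq_iff)
    then show ?thesis using 1[of 1] by (simp add: set_lebesgue_integral_def)
  qed (rule 1)
  from AE_zero_of_initial_integrals[OF gi this] show ?thesis
    by eventually_elim (auto simp: indicator_def)
qed

text \<open>For a test function \<phi>, subtracting its integral times \<psi> leaves the derivative
  of a test function. So the integral of g \<phi> is c times the integral of \<phi>, with c the
  integral of g \<psi>, and the fundamental lemma applies to g - c.\<close>

theorem du_bois_reymond:
  fixes g :: "real \<Rightarrow> complex"
  assumes g: "set_integrable lborel I11 g"
    and z: "\<And>\<phi>. test_fun \<phi> \<Longrightarrow> (LINT t:I11|lborel. g t * complex_of_real (deriv \<phi> t)) = 0"
  obtains c where "AE t in lborel. t \<in> I11 \<longrightarrow> g t = c"
proof -
  obtain \<psi> where \<psi>: "test_fun \<psi>" "integral I11 \<psi> = 1" by (rule test_fun_unit)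
  define c where "c = (LINT t:I11|lborel. g t * complex_of_real (\<psi> t))"
  note gm = set_integrable_test_mult[where k=0, simplified]
  have "AE t in lborel. t \<in> I11 \<longrightarrow> g t - c = 0"
  proof (rule fundamental_lemma_test_fun)
    have ci: "set_integrable lborel I11 (\<lambda>t. c)" by (intro borel_integrable_atLeastAtMost' continuous_intros)
    show "set_integrable lborel I11 (\<lambda>t. g t - c)" using g ci by (rule set_integral_diff(1))
    fix \<phi> assume \<phi>: "test_fun \<phi>"
    let ?a = "integral I11 \<phi>"
    obtain \<Phi> where \<Phi>: "test_fun \<Phi>" "deriv \<Phi> = (\<lambda>t. \<phi> t - ?a * \<psi> t)"
      using test_fun_primitive[OF \<phi> \<psi>(1), of ?a] \<psi>(2) by auto
    have "0 = (LINT t:I11|lborel. g t * complex_of_real (\<phi> t) - of_real ?a * (g t * complex_of_real (\<psi> t)))"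
      using z[OF \<Phi>(1)] by (simp add: \<Phi>(2) algebra_simps)
    also have "\<dots> = (LINT t:I11|lborel. g t * complex_of_real (\<phi> t)) - of_real ?a * c"
      using gm[OF g \<phi>] gm[OF g \<psi>(1)] by (simp add: c_def)
    finally have 1: "(LINT t:I11|lborel. g t * complex_of_real (\<phi> t)) = of_real ?a * c" by simp
    have "set_integrable lborel I11 \<phi>"
      using test_fun_continuous[OF \<phi>, of I11 0] by (intro borel_integrable_atLeastAtMost') simp
    then have "(LINT t:I11|lborel. \<phi> t) = ?a" by (rule set_borel_integral_eq_integral(2))
    then have 2: "(LINT t:I11|lborel. complex_of_real (\<phi> t)) = of_real ?a"
      by (simp add: set_integral_complex_of_real)
    have "(LINT t:I11|lborel. (g t - c) * complex_of_real (\<phi> t))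
        = (LINT t:I11|lborel. g t * complex_of_real (\<phi> t) - c * complex_of_real (\<phi> t))"
      by (simp add: algebra_simps)
    also have "\<dots> = (LINT t:I11|lborel. g t * complex_of_real (\<phi> t)) - (LINT t:I11|lborel. c * complex_of_real (\<phi> t))"
      by (rule set_integral_diff(2)[OF gm[OF g \<phi>] gm[OF ci \<phi>]])
    also have "\<dots> = 0" using 1 2 by simp
    finally show "(LINT t:I11|lborel. (g t - c) * complex_of_real (\<phi> t)) = 0" .
  qed
  then show thesis by (intro that[of c]) simp
qed

section \<open>Weak derivatives and the Sobolev norm\<close>

lemma set_integral_AE_eq:
  fixes f g :: "real \<Rightarrow> 'a::{banach,second_countable_topology}"
  assumes "set_integrable lborel I11 f" "set_integrable lborel I11 g"
    and ae: "AE t in lborel. t \<in> I11 \<longrightarrow> f t = g t"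
    and S: "S \<subseteq> I11" "S \<in> sets lborel"
  shows "(LINT t:S|lborel. f t) = (LINT t:S|lborel. g t)"
  unfolding set_lebesgue_integral_def
proof (rule integral_cong_AE)
  show "AE x in lborel. indicator S x *\<^sub>R f x = indicator S x *\<^sub>R g x"
    using ae by eventually_elim (use S in \<open>auto simp: indicator_def\<close>)
qed (use assms(1,2)[THEN set_integrable_subset, OF S(2,1)] in \<open>auto simp: set_integrable_def\<close>)

lemma set_integral_square_nonneg: "0 \<le> (LINT t:A|M. (cmod (f t))\<^sup>2)"
  unfolding set_lebesgue_integral_def by (rule Bochner_Integration.integral_nonneg) simp

text \<open>The pointwise bound |f| \<le> (1 + |f|^2) / 2 on an interval of length 2 replaces
  Cauchy-Schwarz. It is the source of the expression 1 + c^2 in the later constants.\<close>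

lemma L2I_integrable:
  assumes "L2I f"
  shows L2I_imp_set_integrable: "set_integrable lborel I11 f"
    and L2I_imp_L1_bound: "(LINT t:I11|lborel. norm (f t)) \<le> 1 + (LINT t:I11|lborel. (cmod (f t))\<^sup>2)"
proof -
  have one: "set_integrable lborel I11 (\<lambda>t. 1::real)"
    by (intro borel_integrable_atLeastAtMost' continuous_intros)
  have sq: "set_integrable lborel I11 (\<lambda>t. (cmod (f t))\<^sup>2)" using assms by (simp add: L2I_def)
  have le: "x \<le> (1 + x\<^sup>2) / 2" for x :: real
    using sum_squares_bound[of x 1] by simp
  have bi: "set_integrable lborel I11 (\<lambda>t. (1 + (cmod (f t))\<^sup>2) / 2)"
    by (intro set_integrable_divide set_integral_add(1) one sq)
  show f: "set_integrable lborel I11 f"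
    unfolding set_integrable_def
  proof (rule Bochner_Integration.integrable_bound[OF bi[unfolded set_integrable_def]])
    show "(\<lambda>x. indicator I11 x *\<^sub>R f x) \<in> borel_measurable lborel"
      using assms by (simp add: L2I_def set_borel_measurable_def)
    show "AE x in lborel. norm (indicator I11 x *\<^sub>R f x) \<le> norm (indicator I11 x *\<^sub>R ((1 + (cmod (f x))\<^sup>2) / 2))"
      using le by (intro AE_I2) (auto simp: indicator_def abs_of_nonneg)
  qed
  have "(LINT t:I11|lborel. norm (f t)) \<le> (LINT t:I11|lborel. (1 + (cmod (f t))\<^sup>2) / 2)"
  proof (rule set_integral_mono[OF _ bi])
    show "set_integrable lborel I11 (\<lambda>t. norm (f t))"
      using f by (rule set_integrable_norm)
  qed (rule le)
  also have "\<dots> = ((LINT t:I11|lborel. 1) + (LINT t:I11|lborel. (cmod (f t))\<^sup>2)) / 2"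
    using set_integral_add(2)[OF one sq] by simp
  also have "(LINT t:I11|lborel. (1::real)) = 2"
    by (simp add: set_lebesgue_integral_def)
  also have "(2 + (LINT t:I11|lborel. (cmod (f t))\<^sup>2)) / 2 \<le> 1 + (LINT t:I11|lborel. (cmod (f t))\<^sup>2)"
    using set_integral_square_nonneg[of lborel I11 f] by simp
  finally show "(LINT t:I11|lborel. norm (f t)) \<le> 1 + (LINT t:I11|lborel. (cmod (f t))\<^sup>2)" .
qed

lemma L2I_plus:
  assumes "L2I f" "L2I g"
  shows L2I_add: "L2I (\<lambda>t. f t + g t)"
    and L2I_add_bound: "(LINT t:I11|lborel. (cmod (f t + g t))\<^sup>2)
      \<le> 2 * (LINT t:I11|lborel. (cmod (f t))\<^sup>2) + 2 * (LINT t:I11|lborel. (cmod (g t))\<^sup>2)"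
proof -
  have sq: "set_integrable lborel I11 (\<lambda>t. (cmod (f t))\<^sup>2)" "set_integrable lborel I11 (\<lambda>t. (cmod (g t))\<^sup>2)"
    using assms by (simp_all add: L2I_def)
  have m: "(\<lambda>x. indicator I11 x *\<^sub>R (f x + g x)) \<in> borel_measurable lborel"
    unfolding scaleR_add_right
    by (rule borel_measurable_add) (use assms in \<open>simp_all add: L2I_def set_borel_measurable_def\<close>)
  have le: "(cmod (x + y))\<^sup>2 \<le> 2 * (cmod x)\<^sup>2 + 2 * (cmod y)\<^sup>2" for x y
  proof -
    have "(cmod (x + y))\<^sup>2 \<le> (cmod x + cmod y)\<^sup>2" by (intro power_mono norm_triangle_ineq) simp
    also have "\<dots> \<le> 2 * (cmod x)\<^sup>2 + 2 * (cmod y)\<^sup>2"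
      using sum_squares_bound[of "cmod x" "cmod y"] by (simp add: power2_sum)
    finally show ?thesis .
  qed
  have bi: "set_integrable lborel I11 (\<lambda>t. 2 * (cmod (f t))\<^sup>2 + 2 * (cmod (g t))\<^sup>2)"
    using sq by (intro set_integral_add(1)) auto
  have i: "set_integrable lborel I11 (\<lambda>t. (cmod (f t + g t))\<^sup>2)"
    unfolding set_integrable_def
  proof (rule Bochner_Integration.integrable_bound[OF bi[unfolded set_integrable_def]])
    have "(\<lambda>x. (cmod (indicator I11 x *\<^sub>R (f x + g x)))\<^sup>2) \<in> borel_measurable lborel"
      using m by measurable
    also have "(\<lambda>x. (cmod (indicator I11 x *\<^sub>R (f x + g x)))\<^sup>2) = (\<lambda>x. indicator I11 x *\<^sub>R (cmod (f x + g x))\<^sup>2)"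
      by (auto simp: indicator_def)
    finally show "(\<lambda>x. indicator I11 x *\<^sub>R (cmod (f x + g x))\<^sup>2) \<in> borel_measurable lborel" .
    show "AE x in lborel. norm (indicator I11 x *\<^sub>R (cmod (f x + g x))\<^sup>2)
        \<le> norm (indicator I11 x *\<^sub>R (2 * (cmod (f x))\<^sup>2 + 2 * (cmod (g x))\<^sup>2))"
      using le by (intro AE_I2) (auto simp: indicator_def)
  qed
  then show "L2I (\<lambda>t. f t + g t)" using m by (simp add: L2I_def set_borel_measurable_def)
  have "(LINT t:I11|lborel. (cmod (f t + g t))\<^sup>2) \<le> (LINT t:I11|lborel. 2 * (cmod (f t))\<^sup>2 + 2 * (cmod (g t))\<^sup>2)"
    by (rule set_integral_mono[OF i bi le])
  also have "\<dots> = 2 * (LINT t:I11|lborel. (cmod (f t))\<^sup>2) + 2 * (LINT t:I11|lborel. (cmod (g t))\<^sup>2)"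
    using sq by simp
  finally show "(LINT t:I11|lborel. (cmod (f t + g t))\<^sup>2)
      \<le> 2 * (LINT t:I11|lborel. (cmod (f t))\<^sup>2) + 2 * (LINT t:I11|lborel. (cmod (g t))\<^sup>2)" .
qed

lemma weak_derivsD:
  assumes "weak_derivs m u v"
  shows weak_derivs_0: "\<And>t. t \<in> I11 \<Longrightarrow> v 0 t = u t"
    and weak_derivs_L2I: "\<And>j. j \<le> m \<Longrightarrow> L2I (v j)"
    and weak_derivs_eq: "\<And>j \<phi>. j \<le> m \<Longrightarrow> test_fun \<phi> \<Longrightarrow>
      (LINT t:I11|lborel. u t * complex_of_real ((deriv ^^ j) \<phi> t)) =
        (-1)^j * (LINT t:I11|lborel. v j t * complex_of_real (\<phi> t))"
  using assms unfolding weak_derivs_def by blast+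

lemma weak_derivs_set_integrable:
  assumes "weak_derivs m u v"
  shows "set_integrable lborel I11 u"
proof -
  have "set_integrable lborel I11 (v 0) = set_integrable lborel I11 u"
    by (rule set_integrable_cong) (use weak_derivs_0[OF assms] in auto)
  then show ?thesis using L2I_imp_set_integrable[OF weak_derivs_L2I[OF assms]] by simp
qed

lemma weak_derivs_unique:
  assumes v: "weak_derivs m u v" and w: "weak_derivs m u w" and j: "j \<le> m"
  shows "AE t in lborel. t \<in> I11 \<longrightarrow> v j t = w j t"
proof -
  note vi = L2I_imp_set_integrable[OF weak_derivs_L2I[OF v j]]
    and wi = L2I_imp_set_integrable[OF weak_derivs_L2I[OF w j]]
  have "AE t in lborel. t \<in> I11 \<longrightarrow> v j t - w j t = 0"
  proof (rule fundamental_lemma_test_fun)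
    show "set_integrable lborel I11 (\<lambda>t. v j t - w j t)" using vi wi by (rule set_integral_diff(1))
    fix \<phi> assume \<phi>: "test_fun \<phi>"
    have "(LINT t:I11|lborel. (v j t - w j t) * complex_of_real (\<phi> t))
       = (LINT t:I11|lborel. v j t * complex_of_real (\<phi> t) - w j t * complex_of_real (\<phi> t))"
      by (simp only: left_diff_distrib)
    also have "\<dots> = (LINT t:I11|lborel. v j t * complex_of_real (\<phi> t)) - (LINT t:I11|lborel. w j t * complex_of_real (\<phi> t))"
      using set_integrable_test_mult[OF vi \<phi>, of 0] set_integrable_test_mult[OF wi \<phi>, of 0] by simp
    also have "\<dots> = 0"
      using weak_derivs_eq[OF v j \<phi>] weak_derivs_eq[OF w j \<phi>] by simp
    finally show "(LINT t:I11|lborel. (v j t - w j t) * complex_of_real (\<phi> t)) = 0" .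
  qed
  then show ?thesis by simp
qed

text \<open>Uniqueness up to null sets frees the norm from the choice made by \<open>SOME\<close>:
  any convenient family of weak derivatives computes it.\<close>

lemma Hm_norm_eq:
  assumes "weak_derivs m u v"
  shows "Hm_norm m u = sqrt (\<Sum>j\<le>m. LINT t:I11|lborel. (cmod (v j t))\<^sup>2)"
proof -
  define w where "w = (SOME v. weak_derivs m u v)"
  have w: "weak_derivs m u w" unfolding w_def by (rule someI[of "weak_derivs m u", OF assms])
  have "(LINT t:I11|lborel. (cmod (w j t))\<^sup>2) = (LINT t:I11|lborel. (cmod (v j t))\<^sup>2)" if "j \<le> m" for j
  proof (rule set_integral_AE_eq)
    show "AE t in lborel. t \<in> I11 \<longrightarrow> (cmod (w j t))\<^sup>2 = (cmod (v j t))\<^sup>2"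
      using weak_derivs_unique[OF w assms that] by eventually_elim auto
  qed (use weak_derivs_L2I[OF w that] weak_derivs_L2I[OF assms that] in \<open>auto simp: L2I_def\<close>)
  then show ?thesis unfolding Hm_norm_def w_def[symmetric] Let_def by simp
qed

section \<open>Sobolev bounds with explicit constants\<close>

definition Hm_bounded :: "nat \<Rightarrow> real \<Rightarrow> (real \<Rightarrow> complex) \<Rightarrow> bool" where
  "Hm_bounded m c u \<longleftrightarrow> in_Hm m u \<and> Hm_norm m u \<le> c"

lemma Hm_boundedI:
  assumes v: "weak_derivs m u v" and c: "c \<ge> 0" "(\<Sum>j\<le>m. LINT t:I11|lborel. (cmod (v j t))\<^sup>2) \<le> c\<^sup>2"
  shows "Hm_bounded m c u"
  unfolding Hm_bounded_def Hm_norm_eq[OF v] in_Hm_def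
  using v c by (auto intro: real_le_lsqrt)

lemma Hm_boundedE:
  assumes "Hm_bounded m c u"
  obtains v where "weak_derivs m u v" "(\<Sum>j\<le>m. LINT t:I11|lborel. (cmod (v j t))\<^sup>2) \<le> c\<^sup>2" "c \<ge> 0"
proof -
  obtain v where v: "weak_derivs m u v" using assms unfolding Hm_bounded_def in_Hm_def by blast
  let ?S = "\<Sum>j\<le>m. LINT t:I11|lborel. (cmod (v j t))\<^sup>2"
  have c: "sqrt ?S \<le> c" using assms unfolding Hm_bounded_def Hm_norm_eq[OF v] by blast
  have "0 \<le> ?S" by (intro sum_nonneg set_integral_square_nonneg)
  then have "0 \<le> c" using c real_sqrt_ge_zero order_trans by blast
  then show thesis using v c by (intro that[of v]) (auto simp: sqrt_le_D)
qed

lemma Hm_bounded_add: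
  assumes "Hm_bounded m c u" "Hm_bounded m d w"
  shows "Hm_bounded m (2 * (c + d)) (\<lambda>t. u t + w t)"
proof -
  obtain v where v: "weak_derivs m u v" "(\<Sum>j\<le>m. LINT t:I11|lborel. (cmod (v j t))\<^sup>2) \<le> c\<^sup>2" "c \<ge> 0"
    using Hm_boundedE[OF assms(1)] by blast
  obtain x where x: "weak_derivs m w x" "(\<Sum>j\<le>m. LINT t:I11|lborel. (cmod (x j t))\<^sup>2) \<le> d\<^sup>2" "d \<ge> 0"
    using Hm_boundedE[OF assms(2)] by blast
  note vi = weak_derivs_L2I[OF v(1)] and xi = weak_derivs_L2I[OF x(1)]
  have ui: "set_integrable lborel I11 u"
    by (rule weak_derivs_set_integrable[OF v(1)])
  have wi: "set_integrable lborel I11 w"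
    by (rule weak_derivs_set_integrable[OF x(1)])
  have "weak_derivs m (\<lambda>t. u t + w t) (\<lambda>j t. v j t + x j t)"
    unfolding weak_derivs_def
  proof (intro conjI allI ballI impI)
    fix j \<phi> assume j: "j \<le> m" and \<phi>: "test_fun \<phi>"
    have "(LINT t:I11|lborel. (u t + w t) * complex_of_real ((deriv ^^ j) \<phi> t))
       = (LINT t:I11|lborel. u t * complex_of_real ((deriv ^^ j) \<phi> t)) + (LINT t:I11|lborel. w t * complex_of_real ((deriv ^^ j) \<phi> t))"
      unfolding distrib_right by (intro set_integral_add(2) set_integrable_test_mult ui wi \<phi>)
    moreover have "(LINT t:I11|lborel. (v j t + x j t) * complex_of_real (\<phi> t))
       = (LINT t:I11|lborel. v j t * complex_of_real (\<phi> t)) + (LINT t:I11|lborel. x j t * complex_of_real (\<phi> t))"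
      unfolding distrib_right
      by (intro set_integral_add(2) set_integrable_test_mult[where k=0, simplified] L2I_imp_set_integrable vi xi \<phi> j)
    ultimately show "(LINT t:I11|lborel. (u t + w t) * complex_of_real ((deriv ^^ j) \<phi> t))
      = (-1)^j * (LINT t:I11|lborel. (v j t + x j t) * complex_of_real (\<phi> t))"
      using weak_derivs_eq[OF v(1) j \<phi>] weak_derivs_eq[OF x(1) j \<phi>] by (simp add: distrib_left)
  qed (use weak_derivs_0[OF v(1)] weak_derivs_0[OF x(1)] L2I_add[OF vi xi] in auto)
  moreover have "(\<Sum>j\<le>m. LINT t:I11|lborel. (cmod (v j t + x j t))\<^sup>2) \<le> (2 * (c + d))\<^sup>2"
  proof -
    have "(\<Sum>j\<le>m. LINT t:I11|lborel. (cmod (v j t + x j t))\<^sup>2)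
      \<le> (\<Sum>j\<le>m. 2 * (LINT t:I11|lborel. (cmod (v j t))\<^sup>2) + 2 * (LINT t:I11|lborel. (cmod (x j t))\<^sup>2))"
      by (intro sum_mono L2I_add_bound vi xi) auto
    also have "\<dots> = 2 * (\<Sum>j\<le>m. LINT t:I11|lborel. (cmod (v j t))\<^sup>2) + 2 * (\<Sum>j\<le>m. LINT t:I11|lborel. (cmod (x j t))\<^sup>2)"
      by (simp add: sum.distrib sum_distrib_left)
    also have "\<dots> \<le> 2 * c\<^sup>2 + 2 * d\<^sup>2" using v(2) x(2) by simp
    also have "\<dots> \<le> (2 * (c + d))\<^sup>2"
      using v(3) x(3) by (simp add: power2_eq_square algebra_simps)
    finally show ?thesis .
  qed
  ultimately show ?thesis using v(3) x(3) by (intro Hm_boundedI) auto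
qed

lemma primitive_of_weak_derivative:
  assumes bg: "primitive_of b g" and \<phi>: "test_fun \<phi>"
  shows "(LINT t:I11|lborel. b t * complex_of_real (deriv \<phi> t)) = - (LINT t:I11|lborel. g t * complex_of_real (\<phi> t))"
proof -
  have "((\<lambda>t. complex_of_real (\<phi> t)) has_vector_derivative complex_of_real (deriv \<phi> t)) (at t within I11)" for t
    using has_vector_derivative_of_real[OF test_fun_has_derivative[OF \<phi>, of 0 t]]
    by (auto intro: has_vector_derivative_at_within)
  moreover have "continuous_on I11 (\<lambda>t. complex_of_real (deriv \<phi> t))"
    using test_fun_continuous[OF \<phi>, of I11 1] by (intro continuous_intros) simp
  ultimately have "(LINT t:I11|lborel. complex_of_real (\<phi> t) * g t) =
      complex_of_real (\<phi> 1) * b 1 - complex_of_real (\<phi> (-1)) * b (-1) - (LINT t:I11|lborel. complex_of_real (deriv \<phi> t) * b t)"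
    by (intro integration_by_parts_primitive[OF _ _ bg]) auto
  also have "\<dots> = - (LINT t:I11|lborel. complex_of_real (deriv \<phi> t) * b t)"
    using test_fun_zero[OF \<phi>, of _ 0] by simp
  finally show ?thesis by (simp add: mult.commute)
qed

text \<open>By du Bois-Reymond, \<open>v j\<close> differs from the primitive of
  \<open>v (Suc j)\<close> almost everywhere by a constant, which gives an absolutely continuous
  representative \<open>W j\<close>. The function \<open>u\<close> agrees with \<open>W 0\<close>
  only almost everywhere, since weak derivatives ignore null sets; under an integral sign this is
  enough.\<close>

lemma Hm_bounded_chain:
  assumes "Hm_bounded m c u" "m \<ge> 1"
  obtains W where "AE t in lborel. t \<in> I11 \<longrightarrow> u t = W 0 t" "set_integrable lborel I11 u"
    "\<And>j. j < m \<Longrightarrow> primitive_of (W j) (W (Suc j))"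
    "\<And>j. j \<le> m \<Longrightarrow> set_integrable lborel I11 (W j)"
    "\<And>j. j \<le> m \<Longrightarrow> (LINT t:I11|lborel. norm (W j t)) \<le> 1 + c\<^sup>2"
proof -
  obtain v where v: "weak_derivs m u v" "(\<Sum>j\<le>m. LINT t:I11|lborel. (cmod (v j t))\<^sup>2) \<le> c\<^sup>2"
    using Hm_boundedE[OF assms(1)] by blast
  have vi: "set_integrable lborel I11 (v j)" if "j \<le> m" for j
    by (rule L2I_imp_set_integrable[OF weak_derivs_L2I[OF v(1) that]])
  have vb: "(LINT t:I11|lborel. norm (v j t)) \<le> 1 + c\<^sup>2" if "j \<le> m" for j
  proof -
    have "(LINT t:I11|lborel. (cmod (v j t))\<^sup>2) \<le> (\<Sum>j\<le>m. LINT t:I11|lborel. (cmod (v j t))\<^sup>2)"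
      by (rule member_le_sum) (use that set_integral_square_nonneg in auto)
    then show ?thesis using v(2) L2I_imp_L1_bound[OF weak_derivs_L2I[OF v(1) that]] by linarith
  qed
  define G where "G j t = (LINT r:{-1..t}|lborel. v (Suc j) r)" for j t
  have G1: "G j (-1) = 0" for j
    unfolding G_def set_lebesgue_integral_def
    by (rule integral_eq_zero_AE) (use AE_lborel_singleton[of "-1"] in \<open>eventually_elim, auto\<close>)
  have G: "primitive_of (G j) (v (Suc j))" if "j < m" for j
    using vi[of "Suc j"] that G1[of j] by (auto simp: primitive_of_def G_def)
  have "\<exists>k. AE t in lborel. t \<in> I11 \<longrightarrow> v j t - G j t = k" if j: "j < m" for j
  proof -
    note Gi = primitive_of_set_integrable[OF G[OF j]]
    have "set_integrable lborel I11 (\<lambda>t. v j t - G j t)"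
      using vi[of j] j Gi by (intro set_integral_diff(1)) auto
    moreover have "(LINT t:I11|lborel. (v j t - G j t) * complex_of_real (deriv \<phi> t)) = 0" if \<phi>: "test_fun \<phi>" for \<phi>
    proof -
      note \<phi>' = test_fun_deriv[OF \<phi>]
      \<comment> \<open>All weak derivatives are defined relative to \<open>u\<close>. Testing order
        j with the derivative of \<phi> and order j + 1 with \<phi> shows that
        \<open>v (Suc j)\<close> is the weak derivative of \<open>v j\<close>.\<close>
      have "(-1)^j * (LINT t:I11|lborel. v j t * complex_of_real (deriv \<phi> t))
          = (-1)^Suc j * (LINT t:I11|lborel. v (Suc j) t * complex_of_real (\<phi> t))"
        using weak_derivs_eq[OF v(1) _ \<phi>', of j] weak_derivs_eq[OF v(1) _ \<phi>, of "Suc j"] j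
        by (simp add: funpow_Suc_right del: funpow.simps)
      then have "(LINT t:I11|lborel. v j t * complex_of_real (deriv \<phi> t))
          = - (LINT t:I11|lborel. v (Suc j) t * complex_of_real (\<phi> t))"
        by (cases "even j") (simp_all, metis minus_minus)
      also have "\<dots> = (LINT t:I11|lborel. G j t * complex_of_real (deriv \<phi> t))"
        using primitive_of_weak_derivative[OF G[OF j] \<phi>] by simp
      finally show ?thesis
        using set_integrable_test_mult[OF vi[of j] \<phi>', of 0] set_integrable_test_mult[OF Gi \<phi>', of 0] j
        by (simp add: left_diff_distrib)
    qed
    ultimately show ?thesis using du_bois_reymond by blast
  qed
  then obtain k where k: "\<And>j. j < m \<Longrightarrow> AE t in lborel. t \<in> I11 \<longrightarrow> v j t - G j t = k j" by metis
  \<comment> \<open>Orders below m receive the absolutely continuous representative; at the top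
    order no further derivative is available to integrate, so \<open>v m\<close> stays.\<close>
  define W where "W j t = (if j < m then k j + G j t else v j t)" for j t
  have ae: "AE t in lborel. t \<in> I11 \<longrightarrow> v j t = W j t" if "j \<le> m" for j
  proof (cases "j < m")
    case True
    from k[OF True] show ?thesis
      by eventually_elim (use True in \<open>auto simp: W_def algebra_simps\<close>)
  qed (simp add: W_def)
  have Wi: "set_integrable lborel I11 (W j)" if "j \<le> m" for j
  proof (cases "j < m")
    case True
    then show ?thesis
      unfolding W_def
      by (auto intro!: set_integral_add(1) borel_integrable_atLeastAtMost' continuous_intros primitive_of_continuous[OF G])
  qed (use vi[OF that] in \<open>simp add: W_def[abs_def]\<close>)
  show thesis
  proof (rule that[of W])
    show "AE t in lborel. t \<in> I11 \<longrightarrow> u t = W 0 t"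
      using ae[OF le0] by eventually_elim (use weak_derivs_0[OF v(1)] in auto)
    show "set_integrable lborel I11 u"
      by (rule weak_derivs_set_integrable[OF v(1)])
    show "primitive_of (W j) (W (Suc j))" if "j < m" for j
      unfolding primitive_of_def
    proof (intro conjI ballI)
      show "set_integrable lborel I11 (W (Suc j))" using Wi that by simp
      fix t assume t: "t \<in> I11"
      have "(LINT r:{-1..t}|lborel. v (Suc j) r) = (LINT r:{-1..t}|lborel. W (Suc j) r)"
        by (rule set_integral_AE_eq[OF vi Wi ae]) (use that t in auto)
      then show "W j t = W j (-1) + (LINT r:{-1..t}|lborel. W (Suc j) r)"
        using that G1[of j] by (simp add: W_def G_def)
    qed
    show "set_integrable lborel I11 (W j)" if "j \<le> m" for j by (rule Wi[OF that])
    show "(LINT t:I11|lborel. norm (W j t)) \<le> 1 + c\<^sup>2" if "j \<le> m" for j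
    proof -
      have "(LINT t:I11|lborel. norm (v j t)) = (LINT t:I11|lborel. norm (W j t))"
      proof (rule set_integral_AE_eq[OF set_integrable_norm[OF vi[OF that]] set_integrable_norm[OF Wi[OF that]]])
        show "AE t in lborel. t \<in> I11 \<longrightarrow> cmod (v j t) = cmod (W j t)"
          using ae[OF that] by eventually_elim auto
      qed auto
      then show ?thesis using vb[OF that] by simp
    qed
  qed
qed

text \<open>Derivatives are peeled off one at a time, in step with inductions on the number of
  derivatives still to be taken. Continuity is demanded only of the last one, since
  differentiability supplies it for the others.\<close>

fun Cm_bounded :: "nat \<Rightarrow> real \<Rightarrow> (real \<Rightarrow> complex) \<Rightarrow> bool" where
  "Cm_bounded 0 C f \<longleftrightarrow> continuous_on I11 f \<and> (\<forall>t\<in>I11. cmod (f t) \<le> C)"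
| "Cm_bounded (Suc k) C f \<longleftrightarrow> (\<forall>t\<in>I11. cmod (f t) \<le> C) \<and>
     (\<exists>g. (\<forall>t\<in>I11. (f has_vector_derivative g t) (at t within I11)) \<and> Cm_bounded k C g)"

lemma Cm_bounded_norm: "Cm_bounded k C f \<Longrightarrow> t \<in> I11 \<Longrightarrow> cmod (f t) \<le> C"
  by (cases k) auto

lemma Cm_bounded_mono: "Cm_bounded k C f \<Longrightarrow> C \<le> D \<Longrightarrow> Cm_bounded k D f"
  by (induction k arbitrary: f) (fastforce intro: order_trans)+

lemma Cm_bounded_add:
  "Cm_bounded k C f \<Longrightarrow> Cm_bounded k D g \<Longrightarrow> Cm_bounded k (C + D) (\<lambda>t. f t + g t)"
proof (induction k arbitrary: f g)
  case 0
  then show ?case by (auto intro!: continuous_intros norm_triangle_mono)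
next
  case (Suc k)
  obtain f' where f': "\<forall>t\<in>I11. (f has_vector_derivative f' t) (at t within I11)" "Cm_bounded k C f'"
    using Suc.prems(1) by auto
  obtain g' where g': "\<forall>t\<in>I11. (g has_vector_derivative g' t) (at t within I11)" "Cm_bounded k D g'"
    using Suc.prems(2) by auto
  show ?case
    using Suc.IH[OF f'(2) g'(2)] f' g' Suc.prems
    by (auto intro!: norm_triangle_mono exI[of _ "\<lambda>t. f' t + g' t"] has_vector_derivative_add)
qed

lemma Cm_bounded_mult_const:
  "Cm_bounded k C f \<Longrightarrow> cmod z = 1 \<Longrightarrow> Cm_bounded k C (\<lambda>t. z * f t)"
proof (induction k arbitrary: f)
  case 0
  then show ?case by (auto intro!: continuous_intros simp: norm_mult)
next
  case (Suc k)
  obtain f' where f': "\<forall>t\<in>I11. (f has_vector_derivative f' t) (at t within I11)" "Cm_bounded k C f'"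
    using Suc.prems(1) by auto
  show ?case
    using Suc.IH[OF f'(2) Suc.prems(2)] f' Suc.prems
    by (auto intro!: exI[of _ "\<lambda>t. z * f' t"] has_vector_derivative_mult_right simp: norm_mult)
qed

lemma Cm_bounded_sum4:
  assumes "Cm_bounded m C f1" "Cm_bounded m C f2" "Cm_bounded m C f3" "Cm_bounded m C f4"
  shows "Cm_bounded m (4 * C) (\<lambda>s. f1 s + f2 s + f3 s + f4 s)"
proof -
  have "Cm_bounded m (C + C + C + C) (\<lambda>s. f1 s + f2 s + f3 s + f4 s)"
    by (intro Cm_bounded_add assms)
  then show ?thesis by simp
qed

lemma Cm_bounded_times4:
  assumes "Cm_bounded m C f"
  shows "Cm_bounded m (4 * C) f"
proof -
  have "0 \<le> C" using order_trans[OF norm_ge_zero Cm_bounded_norm[OF assms, of 0]] by simp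
  then show ?thesis by (intro Cm_bounded_mono[OF assms]) simp
qed

lemma Cm_bounded_derivs:
  assumes "Cm_bounded m C f"
  obtains v where "v 0 = f" "\<And>j. j \<le> m \<Longrightarrow> continuous_on I11 (v j)"
    "\<And>j t. j \<le> m \<Longrightarrow> t \<in> I11 \<Longrightarrow> cmod (v j t) \<le> C"
    "\<And>j t. j < m \<Longrightarrow> t \<in> I11 \<Longrightarrow> (v j has_vector_derivative v (Suc j) t) (at t within I11)"
  using assms
proof (induction m arbitrary: f thesis)
  case 0
  then show ?case by (intro "0.prems"(1)[of "\<lambda>_. f"]) auto
next
  case (Suc m)
  obtain g where g: "\<forall>t\<in>I11. (f has_vector_derivative g t) (at t within I11)" "Cm_bounded m C g"
    using Suc.prems(2) by auto
  obtain v where v: "v 0 = g" "\<And>j. j \<le> m \<Longrightarrow> continuous_on I11 (v j)"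
    "\<And>j t. j \<le> m \<Longrightarrow> t \<in> I11 \<Longrightarrow> cmod (v j t) \<le> C"
    "\<And>j t. j < m \<Longrightarrow> t \<in> I11 \<Longrightarrow> (v j has_vector_derivative v (Suc j) t) (at t within I11)"
    using Suc.IH[OF _ g(2)] by blast
  have "continuous_on I11 f"
    using g(1) has_vector_derivative_continuous continuous_on_eq_continuous_within by blast
  then show ?case
    using g v Suc.prems(2)
    by (intro Suc.prems(1)[of "\<lambda>j. case j of 0 \<Rightarrow> f | Suc i \<Rightarrow> v i"]) (auto split: nat.splits)
qed

lemma L2I_continuous:
  assumes "continuous_on I11 f" "\<And>t. t \<in> I11 \<Longrightarrow> cmod (f t) \<le> C"
  shows "L2I f" "(LINT t:I11|lborel. (cmod (f t))\<^sup>2) \<le> 2 * C\<^sup>2"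
proof -
  have i: "set_integrable lborel I11 (\<lambda>t. (cmod (f t))\<^sup>2)"
    by (intro borel_integrable_atLeastAtMost' continuous_intros assms)
  then show "L2I f"
    using borel_measurable_continuous_on_indicator[OF _ assms(1)] by (simp add: L2I_def set_borel_measurable_def)
  have "(LINT t:I11|lborel. (cmod (f t))\<^sup>2) \<le> (LINT t:I11|lborel. C\<^sup>2)"
    by (rule set_integral_mono[OF i]) (auto intro!: borel_integrable_atLeastAtMost' power_mono assms(2))
  also have "\<dots> = 2 * C\<^sup>2" by (simp add: set_lebesgue_integral_def)
  finally show "(LINT t:I11|lborel. (cmod (f t))\<^sup>2) \<le> 2 * C\<^sup>2" .
qed

text \<open>Classical derivatives are weak ones by repeated integration by parts. The squared norm
  has m + 1 terms of size at most 2 C^2, where 2 is the length of the interval. This is the way back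
  from C^m estimates to the Sobolev space.\<close>

lemma Cm_bounded_imp_Hm_bounded:
  assumes "Cm_bounded m C f"
  shows "Hm_bounded m (2 * real (Suc m) * C) f"
proof -
  obtain v where v: "v 0 = f" "\<And>j. j \<le> m \<Longrightarrow> continuous_on I11 (v j)"
    "\<And>j t. j \<le> m \<Longrightarrow> t \<in> I11 \<Longrightarrow> cmod (v j t) \<le> C"
    "\<And>j t. j < m \<Longrightarrow> t \<in> I11 \<Longrightarrow> (v j has_vector_derivative v (Suc j) t) (at t within I11)"
    using Cm_bounded_derivs[OF assms] by blast
  have C: "C \<ge> 0" using order_trans[OF norm_ge_zero v(3)[of 0 0]] by simp
  note L2 = L2I_continuous[OF v(2,3)]
  have "weak_derivs m f v"
    unfolding weak_derivs_def
  proof (intro conjI allI ballI impI)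
    show "(LINT t:I11|lborel. f t * complex_of_real ((deriv ^^ j) \<phi> t)) =
        (-1)^j * (LINT t:I11|lborel. v j t * complex_of_real (\<phi> t))" if "j \<le> m" "test_fun \<phi>" for j \<phi>
      using that
    proof (induction j arbitrary: \<phi>)
      case 0 then show ?case using v(1) by simp
    next
      case (Suc j)
      have "primitive_of (v j) (v (Suc j))"
        by (rule primitive_of_derivative) (use v(2,4) Suc.prems in auto)
      from primitive_of_weak_derivative[OF this Suc.prems(2)] Suc.IH[OF _ test_fun_deriv[OF Suc.prems(2)]] Suc.prems(1)
      show ?case by (simp add: funpow_Suc_right del: funpow.simps)
    qed
  qed (use v(1) L2(1) in auto)
  moreover have "(\<Sum>j\<le>m. LINT t:I11|lborel. (cmod (v j t))\<^sup>2) \<le> (2 * real (Suc m) * C)\<^sup>2"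
  proof -
    have "(\<Sum>j\<le>m. LINT t:I11|lborel. (cmod (v j t))\<^sup>2) \<le> (\<Sum>j\<le>m. 2 * C\<^sup>2)"
      by (intro sum_mono L2(2)) auto
    also have "\<dots> = (2 * real (Suc m)) * C\<^sup>2" by simp
    also have "\<dots> \<le> (2 * real (Suc m))\<^sup>2 * C\<^sup>2"
      by (intro mult_right_mono self_le_power) auto
    finally show ?thesis by (simp add: power_mult_distrib)
  qed
  ultimately show ?thesis using C by (intro Hm_boundedI) auto
qed

section \<open>Oscillatory Volterra kernels\<close>

lemma Cm_familyD:
  assumes "Cm_family m L P"
  shows Cm_family_0: "\<And>s t. s \<in> I11 \<Longrightarrow> t \<in> I11 \<Longrightarrow> P 0 0 s t = L s t"
    and Cm_family_ds: "\<And>\<alpha> \<beta> s t. \<alpha> < m \<Longrightarrow> \<beta> \<le> m \<Longrightarrow> s \<in> I11 \<Longrightarrow> t \<in> I11 \<Longrightarrow>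
      ((\<lambda>s. P \<alpha> \<beta> s t) has_vector_derivative P (Suc \<alpha>) \<beta> s t) (at s within I11)"
    and Cm_family_continuous: "\<And>\<alpha> \<beta>. \<alpha> \<le> m \<Longrightarrow> \<beta> \<le> m \<Longrightarrow> continuous_on (I11 \<times> I11) (\<lambda>(s,t). P \<alpha> \<beta> s t)"
proof -
  note h = assms[unfolded Cm_family_def]
  show "P 0 0 s t = L s t" if "s \<in> I11" "t \<in> I11" for s t
    using h[THEN conjunct1] that by blast
  show "((\<lambda>s. P \<alpha> \<beta> s t) has_vector_derivative P (Suc \<alpha>) \<beta> s t) (at s within I11)"
    if "\<alpha> < m" "\<beta> \<le> m" "s \<in> I11" "t \<in> I11" for \<alpha> \<beta> s t
    using h[THEN conjunct2, THEN conjunct2, THEN conjunct1] that by blast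
  show "continuous_on (I11 \<times> I11) (\<lambda>(s,t). P \<alpha> \<beta> s t)" if "\<alpha> \<le> m" "\<beta> \<le> m" for \<alpha> \<beta>
    using h[THEN conjunct2, THEN conjunct2, THEN conjunct2] that by blast
qed

text \<open>\<^const>\<open>Cm_family\<close> provides t-derivatives only for \<open>\<alpha> = 0\<close>; the others follow by
  differentiating the integrated identity under the integral sign.\<close>

lemma Cm_family_dt:
  assumes P: "Cm_family m L P" and \<beta>: "\<beta> < m"
  shows "\<alpha> \<le> m \<Longrightarrow> s \<in> I11 \<Longrightarrow> t \<in> I11 \<Longrightarrow>
    ((\<lambda>t. P \<alpha> \<beta> s t) has_vector_derivative P \<alpha> (Suc \<beta>) s t) (at t within I11)"
proof (induction \<alpha> arbitrary: s t)
  case 0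
  then show ?case using P \<beta> unfolding Cm_family_def by blast
next
  case (Suc \<alpha>)
  have eq: "P (Suc \<alpha>) \<beta> s x = P (Suc \<alpha>) \<beta> s (-1) + (LINT r:{-1..x}|lborel. P (Suc \<alpha>) (Suc \<beta>) s r)"
    if s: "s \<in> I11" and x: "x \<in> I11" for s x
  proof -
    \<comment> \<open>Moving the upper limit \<open>x\<close> into the density as an indicator makes
      the Leibniz rule for fixed limits applicable.\<close>
    let ?g = "\<lambda>t. indicator {-1..x} t :: complex"
    have g: "set_integrable lborel I11 ?g"
    proof -
      have "set_integrable lborel {-1..x} (\<lambda>_. 1::complex)"
        by (intro borel_integrable_atLeastAtMost' continuous_intros)
      then have "integrable lborel (\<lambda>t. indicator {-1..x} t *\<^sub>R (1::complex))"
        by (simp only: set_integrable_def)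
      also have "(\<lambda>t. indicator {-1..x} t *\<^sub>R (1::complex)) = (\<lambda>t. indicator I11 t *\<^sub>R ?g t)"
        using x by (auto simp: indicator_def fun_eq_iff)
      finally show ?thesis by (simp only: set_integrable_def)
    qed
    have ind: "(LINT t:I11|lborel. h t * ?g t) = (LINT r:{-1..x}|lborel. h r)" for h :: "real \<Rightarrow> complex"
      unfolding set_lebesgue_integral_def by (rule Bochner_Integration.integral_cong) (use x in \<open>auto simp: indicator_def\<close>)
    have "((\<lambda>s. LINT t:I11|lborel. P \<alpha> (Suc \<beta>) s t * ?g t) has_vector_derivative
       (LINT t:I11|lborel. P (Suc \<alpha>) (Suc \<beta>) s t * ?g t)) (at s within I11)"
      by (rule leibniz_rectangle[OF Cm_family_continuous[OF P] Cm_family_continuous[OF P] Cm_family_ds[OF P] g s])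
         (use Suc.prems \<beta> in auto)
    then have "((\<lambda>s. P \<alpha> \<beta> s (-1) + (LINT r:{-1..x}|lborel. P \<alpha> (Suc \<beta>) s r)) has_vector_derivative
       P (Suc \<alpha>) \<beta> s (-1) + (LINT r:{-1..x}|lborel. P (Suc \<alpha>) (Suc \<beta>) s r)) (at s within I11)"
      unfolding ind
      by (intro has_vector_derivative_add Cm_family_ds[OF P]) (use s Suc.prems \<beta> in auto)
    then have "((\<lambda>s. P \<alpha> \<beta> s x) has_vector_derivative
       P (Suc \<alpha>) \<beta> s (-1) + (LINT r:{-1..x}|lborel. P (Suc \<alpha>) (Suc \<beta>) s r)) (at s within I11)"
    proof (rule has_vector_derivative_transform[OF s, rotated])
      fix y assume y: "y \<in> I11"
      have "(LINT r:{-1..x}|lborel. P \<alpha> (Suc \<beta>) y r) = P \<alpha> \<beta> y x - P \<alpha> \<beta> y (-1)"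
        by (rule set_integral_derivative[OF Suc.IH continuous_on_square_section(1)[OF Cm_family_continuous[OF P] y]])
           (use Suc.prems \<beta> x y in auto)
      then show "P \<alpha> \<beta> y x = P \<alpha> \<beta> y (-1) + (LINT r:{-1..x}|lborel. P \<alpha> (Suc \<beta>) y r)" by simp
    qed
    moreover have "((\<lambda>s. P \<alpha> \<beta> s x) has_vector_derivative P (Suc \<alpha>) \<beta> s x) (at s within I11)"
      by (rule Cm_family_ds[OF P]) (use s x Suc.prems \<beta> in auto)
    \<comment> \<open>Two derivatives of the same function of \<open>s\<close> must agree. This
      yields the integral formula for \<open>P (Suc \<alpha>) \<beta>\<close>, which can then be
      differentiated in \<open>t\<close>.\<close>
    ultimately show ?thesis
      using vector_derivative_unique_within_closed_interval[of "-1" 1 s] s by auto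
  qed
  have "((\<lambda>x. P (Suc \<alpha>) \<beta> s (-1) + (LINT r:{-1..x}|lborel. P (Suc \<alpha>) (Suc \<beta>) s r)) has_vector_derivative
      0 + P (Suc \<alpha>) (Suc \<beta>) s t) (at t within I11)"
    by (intro has_vector_derivative_add has_vector_derivative_const indefinite_integral_has_derivative
        continuous_on_square_section(1)[OF Cm_family_continuous[OF P]]) (use Suc.prems \<beta> in auto)
  then show ?case
    using has_vector_derivative_transform[OF Suc.prems(3) eq[OF Suc.prems(2)]] by simp
qed

definition osc :: "real \<Rightarrow> real \<Rightarrow> complex" where
  "osc \<omega> t = exp (\<i> * complex_of_real (\<omega> * t))"

lemma osc_add: "osc \<omega> (s + t) = osc \<omega> s * osc \<omega> t"
  by (simp add: osc_def distrib_left exp_add)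

lemma norm_osc [simp]: "cmod (osc \<omega> t) = 1"
  by (simp add: osc_def)

lemma continuous_on_osc [continuous_intros]: "continuous_on S f \<Longrightarrow> continuous_on S (\<lambda>x. osc \<omega> (f x))"
  unfolding osc_def by (intro continuous_intros)

lemma osc_diff_derivative:
  "((\<lambda>s. osc \<omega> (s - t)) has_vector_derivative \<i> * \<omega> * osc \<omega> (s - t)) (at s within S)"
  "((\<lambda>t. osc \<omega> (s - t)) has_vector_derivative - (\<i> * \<omega> * osc \<omega> (s - t))) (at t within S)"
proof -
  have d: "((\<lambda>z. exp (\<i> * (of_real \<omega> * z))) has_field_derivative \<i> * \<omega> * exp (\<i> * (of_real \<omega> * z))) (at z)" for z
    by (auto intro!: derivative_eq_intros)
  have s: "((\<lambda>s. complex_of_real (s - t)) has_vector_derivative 1) (at s within S)"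
    and t: "((\<lambda>t. complex_of_real (s - t)) has_vector_derivative -1) (at t within S)"
    by (auto intro!: derivative_eq_intros simp: has_vector_derivative_def scaleR_conv_of_real fun_eq_iff)
  show "((\<lambda>s. osc \<omega> (s - t)) has_vector_derivative \<i> * \<omega> * osc \<omega> (s - t)) (at s within S)"
    using field_vector_diff_chain_within[OF s has_field_derivative_at_within[OF d]]
    by (simp add: osc_def o_def)
  show "((\<lambda>t. osc \<omega> (s - t)) has_vector_derivative - (\<i> * \<omega> * osc \<omega> (s - t))) (at t within S)"
    using field_vector_diff_chain_within[OF t has_field_derivative_at_within[OF d]]
    by (simp add: osc_def o_def)
qed

text \<open>\<open>\<theta> i\<close> plays the i-th derivative of a cutoff, \<open>W j\<close> the
  j-th derivative of the density, and \<open>P\<close> collects those of the kernel.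
  \<open>N\<close>, \<open>X\<close> and \<open>M\<close> bound them with no reference to \<omega>,
  so a constant built from these three is uniform in the frequency.\<close>

locale oscillatory_kernel =
  fixes m :: nat and L :: "real \<Rightarrow> real \<Rightarrow> complex" and P and N :: real
    and \<theta> :: "nat \<Rightarrow> real \<Rightarrow> complex" and X :: real
    and W :: "nat \<Rightarrow> real \<Rightarrow> complex" and M :: real and \<omega> :: real
  assumes P: "Cm_family m L P"
    and PN: "\<And>\<alpha> \<beta> s t. \<alpha> \<le> m \<Longrightarrow> \<beta> \<le> m \<Longrightarrow> s \<in> I11 \<Longrightarrow> t \<in> I11 \<Longrightarrow> cmod (P \<alpha> \<beta> s t) \<le> N"
    and \<theta>d: "\<And>i t. i < m \<Longrightarrow> t \<in> I11 \<Longrightarrow> (\<theta> i has_vector_derivative \<theta> (Suc i) t) (at t within I11)"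
    and \<theta>c: "\<And>i. i \<le> m \<Longrightarrow> continuous_on I11 (\<theta> i)"
    and \<theta>X: "\<And>i t. i \<le> m \<Longrightarrow> t \<in> I11 \<Longrightarrow> cmod (\<theta> i t) \<le> X"
    and Wp: "\<And>j. j < m \<Longrightarrow> primitive_of (W j) (W (Suc j))"
    and Wi: "\<And>j. j \<le> m \<Longrightarrow> set_integrable lborel I11 (W j)"
    and WM: "\<And>j. j \<le> m \<Longrightarrow> (LINT t:I11|lborel. norm (W j t)) \<le> M"
begin

text \<open>The indices record where derivatives have landed: \<alpha> and \<beta> on the kernel,
  \<open>i\<close> on the cutoff. The oscillating factor carries no index because its derivatives in
  \<open>s\<close> and \<open>t\<close> cancel in the sum.\<close>

definition K :: "nat \<Rightarrow> nat \<Rightarrow> nat \<Rightarrow> real \<Rightarrow> real \<Rightarrow> complex" where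
  "K \<alpha> \<beta> i s t = P \<alpha> \<beta> s t * osc \<omega> (s - t) * \<theta> i t"

lemma N_nonneg: "0 \<le> N" and X_nonneg: "0 \<le> X" and M_nonneg: "0 \<le> M"
proof -
  show "0 \<le> N" using order_trans[OF norm_ge_zero PN[of 0 0 0 0]] by simp
  show "0 \<le> X" using order_trans[OF norm_ge_zero \<theta>X[of 0 0]] by simp
  have "0 \<le> (LINT t:I11|lborel. norm (W 0 t))"
    unfolding set_lebesgue_integral_def by (rule Bochner_Integration.integral_nonneg) simp
  then show "0 \<le> M" using WM[of 0] by simp
qed

lemma K_continuous:
  assumes "\<alpha> \<le> m" "\<beta> \<le> m" "i \<le> m"
  shows "continuous_on (I11 \<times> I11) (\<lambda>(s,t). K \<alpha> \<beta> i s t)"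
  using Cm_family_continuous[OF P assms(1,2)] unfolding K_def split_beta'
  by (intro continuous_intros continuous_on_compose2[OF \<theta>c[OF assms(3)]]) auto

lemma K_bound:
  assumes "\<alpha> \<le> m" "\<beta> \<le> m" "i \<le> m" "s \<in> I11" "t \<in> I11"
  shows "cmod (K \<alpha> \<beta> i s t) \<le> N * X"
  unfolding K_def norm_mult norm_osc using PN[OF assms(1,2,4,5)] \<theta>X[OF assms(3,5)] N_nonneg
  by (simp add: mult_mono)

lemma integral_bound:
  assumes k: "continuous_on I11 k" "\<And>t. t \<in> I11 \<Longrightarrow> cmod (k t) \<le> N * X" and "j \<le> m" "{a..b} \<subseteq> I11"
  shows "cmod (LINT t:{a..b}|lborel. k t * W j t) \<le> N * X * M"
proof -
  have "cmod (LINT t:{a..b}|lborel. k t * W j t) \<le> N * X * (LINT t:I11|lborel. norm (W j t))"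
    by (rule norm_set_integral_mult_le[OF continuous_on_subset[OF k(1)]])
       (use assms Wi N_nonneg X_nonneg in auto)
  also have "\<dots> \<le> N * X * M" using WM[OF assms(3)] N_nonneg X_nonneg by (simp add: mult_left_mono)
  finally show ?thesis .
qed

lemma K_integral_bound:
  assumes "\<alpha> \<le> m" "\<beta> \<le> m" "i \<le> m" "j \<le> m" "s \<in> I11" "{a..b} \<subseteq> I11"
  shows "cmod (LINT t:{a..b}|lborel. K \<alpha> \<beta> i s t * W j t) \<le> N * X * M"
  by (rule integral_bound[OF continuous_on_square_section(1)[OF K_continuous]])
     (use assms K_bound in auto)

lemma K_integrable:
  assumes "\<alpha> \<le> m" "\<beta> \<le> m" "i \<le> m" "j \<le> m" "s \<in> I11" "{a..b} \<subseteq> I11"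
  shows "set_integrable lborel {a..b} (\<lambda>t. K \<alpha> \<beta> i s t * W j t)"
  by (rule set_integrable_subset[OF set_integrable_continuous_mult[OF
        continuous_on_square_section(1)[OF K_continuous] Wi]]) (use assms in auto)

text \<open>Along the diagonal direction the oscillating factor is constant, so that
  \<open>\<partial>\<^sub>s + \<partial>\<^sub>t\<close> never produces a power of the frequency.\<close>

lemma K_volterra_derivative:
  assumes lt: "\<alpha> < m" "\<beta> < m" "i < m" "j < m" and s: "s \<in> I11"
  shows K_left_derivative: "\<theta> i (-1) = 0 \<Longrightarrow> ((\<lambda>s. LINT t:{-1..s}|lborel. K \<alpha> \<beta> i s t * W j t) has_vector_derivative
      (LINT t:{-1..s}|lborel. K (Suc \<alpha>) \<beta> i s t * W j t) + (LINT t:{-1..s}|lborel. K \<alpha> (Suc \<beta>) i s t * W j t)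
    + (LINT t:{-1..s}|lborel. K \<alpha> \<beta> (Suc i) s t * W j t) + (LINT t:{-1..s}|lborel. K \<alpha> \<beta> i s t * W (Suc j) t))
      (at s within I11)"
    and K_right_derivative: "\<theta> i 1 = 0 \<Longrightarrow> ((\<lambda>s. LINT t:{s..1}|lborel. K \<alpha> \<beta> i s t * W j t) has_vector_derivative
      (LINT t:{s..1}|lborel. K (Suc \<alpha>) \<beta> i s t * W j t) + (LINT t:{s..1}|lborel. K \<alpha> (Suc \<beta>) i s t * W j t)
    + (LINT t:{s..1}|lborel. K \<alpha> \<beta> (Suc i) s t * W j t) + (LINT t:{s..1}|lborel. K \<alpha> \<beta> i s t * W (Suc j) t))
      (at s within I11)"
proof -
  let ?A = "\<lambda>s t. K (Suc \<alpha>) \<beta> i s t + \<i> * \<omega> * K \<alpha> \<beta> i s t"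
  let ?B = "\<lambda>s t. K \<alpha> (Suc \<beta>) i s t - \<i> * \<omega> * K \<alpha> \<beta> i s t + K \<alpha> \<beta> (Suc i) s t"
  let ?C = "\<lambda>s t. K (Suc \<alpha>) \<beta> i s t + K \<alpha> (Suc \<beta>) i s t + K \<alpha> \<beta> (Suc i) s t"
  have cK: "continuous_on (I11 \<times> I11) (\<lambda>x. K a b c (fst x) (snd x))"
    if "a \<le> Suc \<alpha>" "b \<le> Suc \<beta>" "c \<le> Suc i" for a b c
    using K_continuous[of a b c] that lt by (simp add: split_beta')
  have 1: "continuous_on (I11 \<times> I11) (\<lambda>(s,t). K \<alpha> \<beta> i s t)"
    "continuous_on (I11 \<times> I11) (\<lambda>(s,t). ?A s t)" "continuous_on (I11 \<times> I11) (\<lambda>(s,t). ?B s t)"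
    unfolding split_beta' by (intro continuous_intros cK; simp)+
  have dA: "((\<lambda>s. K \<alpha> \<beta> i s t) has_vector_derivative ?A s t) (at s within I11)" if "s \<in> I11" "t \<in> I11" for s t
    unfolding K_def
    by (rule derivative_eq_intros Cm_family_ds[OF P] osc_diff_derivative refl | use that lt in \<open>simp add: algebra_simps\<close>)+
  have dB: "((\<lambda>t. K \<alpha> \<beta> i s t) has_vector_derivative ?B s t) (at t within I11)" if "s \<in> I11" "t \<in> I11" for s t
    unfolding K_def
    by (rule derivative_eq_intros Cm_family_dt[OF P] osc_diff_derivative \<theta>d refl | use that lt in \<open>simp add: algebra_simps\<close>)+
  have C: "?A s t + ?B s t = ?C s t" for s t by simp
  have split: "(LINT t:{a..b}|lborel. ?C s t * W j t) = (LINT t:{a..b}|lborel. K (Suc \<alpha>) \<beta> i s t * W j t)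
      + (LINT t:{a..b}|lborel. K \<alpha> (Suc \<beta>) i s t * W j t) + (LINT t:{a..b}|lborel. K \<alpha> \<beta> (Suc i) s t * W j t)"
    if "{a..b} \<subseteq> I11" for a b
    using K_integrable[of "Suc \<alpha>" \<beta> i j s a b] K_integrable[of \<alpha> "Suc \<beta>" i j s a b]
      K_integrable[of \<alpha> \<beta> "Suc i" j s a b] that lt s
    by (simp add: distrib_right set_integral_add)
  note vd = volterra_derivative[OF 1 dA dB C Wp[OF lt(4)] s]
  show "((\<lambda>s. LINT t:{-1..s}|lborel. K \<alpha> \<beta> i s t * W j t) has_vector_derivative
      (LINT t:{-1..s}|lborel. K (Suc \<alpha>) \<beta> i s t * W j t) + (LINT t:{-1..s}|lborel. K \<alpha> (Suc \<beta>) i s t * W j t)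
    + (LINT t:{-1..s}|lborel. K \<alpha> \<beta> (Suc i) s t * W j t) + (LINT t:{-1..s}|lborel. K \<alpha> \<beta> i s t * W (Suc j) t))
      (at s within I11)" if "\<theta> i (-1) = 0"
    using vd(1) split[of "-1" s] s that by (simp add: K_def[of \<alpha> \<beta> i s "-1"])
  show "((\<lambda>s. LINT t:{s..1}|lborel. K \<alpha> \<beta> i s t * W j t) has_vector_derivative
      (LINT t:{s..1}|lborel. K (Suc \<alpha>) \<beta> i s t * W j t) + (LINT t:{s..1}|lborel. K \<alpha> (Suc \<beta>) i s t * W j t)
    + (LINT t:{s..1}|lborel. K \<alpha> \<beta> (Suc i) s t * W j t) + (LINT t:{s..1}|lborel. K \<alpha> \<beta> i s t * W (Suc j) t))
      (at s within I11)" if "\<theta> i 1 = 0"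
    using vd(2) split[of s 1] s that by (simp add: K_def[of \<alpha> \<beta> i s 1])
qed

lemma Cm_bounded_four:
  assumes "Cm_bounded k (4 ^ k * C) f1" "Cm_bounded k (4 ^ k * C) f2"
    "Cm_bounded k (4 ^ k * C) f3" "Cm_bounded k (4 ^ k * C) f4"
  shows "Cm_bounded k (4 ^ Suc k * C) (\<lambda>s. f1 s + f2 s + f3 s + f4 s)"
  using Cm_bounded_sum4[OF assms] by (simp add: mult.assoc)

lemma bound_le_power: "N * X * M \<le> 4 ^ k * (N * X * M)"
  using mult_right_mono[of 1 "4 ^ k" "N * X * M"] N_nonneg X_nonneg M_nonneg by simp

text \<open>Each derivative in \<open>s\<close> raises exactly one of the four indices and so
  produces four terms of the same kind, hence 4^k. The budget \<alpha> + \<beta> + i + j + k = m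
  keeps every index below m while derivatives remain to be taken. As \<open>i\<close> grows, every
  \<open>\<theta> i\<close> has to vanish at -1.\<close>

lemma left_Cm_bounded:
  assumes \<theta>0: "\<And>i. i \<le> m \<Longrightarrow> \<theta> i (-1) = 0"
  shows "\<alpha> + \<beta> + i + j + k = m \<Longrightarrow>
    Cm_bounded k (4 ^ k * (N * X * M)) (\<lambda>s. LINT t:{-1..s}|lborel. K \<alpha> \<beta> i s t * W j t)"
proof (induction k arbitrary: \<alpha> \<beta> i j)
  case 0
  then show ?case
    using K_integral_bound[of \<alpha> \<beta> i j]
    by (auto intro!: continuous_on_parametric_integral(1) K_continuous Wi)
next
  case (Suc k)
  let ?J = "\<lambda>\<alpha> \<beta> i j s. LINT t:{-1..s}|lborel. K \<alpha> \<beta> i s t * W j t"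
  have "(?J \<alpha> \<beta> i j has_vector_derivative
      ?J (Suc \<alpha>) \<beta> i j s + ?J \<alpha> (Suc \<beta>) i j s + ?J \<alpha> \<beta> (Suc i) j s + ?J \<alpha> \<beta> i (Suc j) s) (at s within I11)"
    if "s \<in> I11" for s
    by (rule K_left_derivative) (use Suc.prems that \<theta>0 in auto)
  moreover have "Cm_bounded k (4 ^ Suc k * (N * X * M))
     (\<lambda>s. ?J (Suc \<alpha>) \<beta> i j s + ?J \<alpha> (Suc \<beta>) i j s + ?J \<alpha> \<beta> (Suc i) j s + ?J \<alpha> \<beta> i (Suc j) s)"
    by (intro Cm_bounded_four Suc.IH) (use Suc.prems in auto)
  moreover have "cmod (?J \<alpha> \<beta> i j s) \<le> 4 ^ Suc k * (N * X * M)" if "s \<in> I11" for s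
    by (rule order_trans[OF K_integral_bound bound_le_power]) (use Suc.prems that in auto)
  ultimately show ?case
    unfolding Cm_bounded.simps by (intro conjI ballI exI)
qed

lemma right_Cm_bounded:
  assumes \<theta>0: "\<And>i. i \<le> m \<Longrightarrow> \<theta> i 1 = 0"
  shows "\<alpha> + \<beta> + i + j + k = m \<Longrightarrow>
    Cm_bounded k (4 ^ k * (N * X * M)) (\<lambda>s. LINT t:{s..1}|lborel. K \<alpha> \<beta> i s t * W j t)"
proof (induction k arbitrary: \<alpha> \<beta> i j)
  case 0
  \<comment> \<open>Continuity in the lower limit is read off from the full integral minus the left
    part.\<close>
  have "continuous_on I11 (\<lambda>s. (LINT t:I11|lborel. K \<alpha> \<beta> i s t * W j t) - (LINT t:{-1..s}|lborel. K \<alpha> \<beta> i s t * W j t))"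
    by (intro continuous_intros continuous_on_parametric_integral K_continuous Wi) (use 0 in auto)
  then have "continuous_on I11 (\<lambda>s. LINT t:{s..1}|lborel. K \<alpha> \<beta> i s t * W j t)"
    by (rule continuous_on_eq) (use set_integral_split[OF K_integrable] 0 in simp)
  then show ?case
    using K_integral_bound[of \<alpha> \<beta> i j] 0 by auto
next
  case (Suc k)
  let ?J = "\<lambda>\<alpha> \<beta> i j s. LINT t:{s..1}|lborel. K \<alpha> \<beta> i s t * W j t"
  have "(?J \<alpha> \<beta> i j has_vector_derivative
      ?J (Suc \<alpha>) \<beta> i j s + ?J \<alpha> (Suc \<beta>) i j s + ?J \<alpha> \<beta> (Suc i) j s + ?J \<alpha> \<beta> i (Suc j) s) (at s within I11)"
    if "s \<in> I11" for s
    by (rule K_right_derivative) (use Suc.prems that \<theta>0 in auto)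
  moreover have "Cm_bounded k (4 ^ Suc k * (N * X * M))
     (\<lambda>s. ?J (Suc \<alpha>) \<beta> i j s + ?J \<alpha> (Suc \<beta>) i j s + ?J \<alpha> \<beta> (Suc i) j s + ?J \<alpha> \<beta> i (Suc j) s)"
    by (intro Cm_bounded_four Suc.IH) (use Suc.prems in auto)
  moreover have "cmod (?J \<alpha> \<beta> i j s) \<le> 4 ^ Suc k * (N * X * M)" if "s \<in> I11" for s
    by (rule order_trans[OF K_integral_bound bound_le_power]) (use Suc.prems that in auto)
  ultimately show ?case
    unfolding Cm_bounded.simps by (intro conjI ballI exI)
qed

text \<open>The limits are fixed and the factor e^(i \<omega> s) has been taken out, so \<omega>
  survives only in the unimodular weight e^(-i \<omega> t) and \<open>s\<close> occurs in
  \<open>P\<close> alone. Each derivative therefore gives a single term, and no power of 4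
  appears.\<close>

lemma full_Cm_bounded:
  "\<alpha> + k = m \<Longrightarrow> Cm_bounded k (N * X * M) (\<lambda>s. LINT t:I11|lborel. P \<alpha> 0 s t * (osc \<omega> (- t) * \<theta> 0 t) * W 0 t)"
proof (induction k arbitrary: \<alpha>)
  have c: "continuous_on (I11 \<times> I11) (\<lambda>(s,t). P \<alpha> 0 s t * (osc \<omega> (- t) * \<theta> 0 t))" if "\<alpha> \<le> m" for \<alpha>
    using Cm_family_continuous[OF P that, of 0] unfolding split_beta'
    by (intro continuous_intros continuous_on_compose2[OF \<theta>c[of 0]]) auto
  have bd: "cmod (LINT t:I11|lborel. P \<alpha> 0 s t * (osc \<omega> (- t) * \<theta> 0 t) * W 0 t) \<le> N * X * M"
    if "\<alpha> \<le> m" "s \<in> I11" for \<alpha> s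
    by (rule integral_bound[OF continuous_on_square_section(1)[OF c]])
       (use that PN \<theta>X N_nonneg in \<open>auto simp: norm_mult intro!: mult_mono\<close>)
  {
    case 0
    then show ?case using bd by (auto intro!: continuous_on_parametric_integral(2) c Wi)
  next
    case (Suc k)
    let ?F = "\<lambda>\<alpha> s. LINT t:I11|lborel. P \<alpha> 0 s t * (osc \<omega> (- t) * \<theta> 0 t) * W 0 t"
    have "(?F \<alpha> has_vector_derivative ?F (Suc \<alpha>) s) (at s within I11)" if "s \<in> I11" for s
    proof (rule leibniz_rectangle[OF c c _ Wi that])
      show "((\<lambda>s. P \<alpha> 0 s t * (osc \<omega> (- t) * \<theta> 0 t)) has_vector_derivative
          P (Suc \<alpha>) 0 s t * (osc \<omega> (- t) * \<theta> 0 t)) (at s within I11)" if "s \<in> I11" "t \<in> I11" for s t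
        by (rule has_vector_derivative_mult_left[OF Cm_family_ds[OF P]]) (use that Suc.prems in auto)
    qed (use Suc.prems in auto)
    moreover have "Cm_bounded k (N * X * M) (?F (Suc \<alpha>))" by (rule Suc.IH) (use Suc.prems in simp)
    moreover have "cmod (?F \<alpha> s) \<le> N * X * M" if "s \<in> I11" for s by (rule bd) (use that Suc.prems in auto)
    ultimately show ?case unfolding Cm_bounded.simps by (intro conjI ballI exI)
  }
qed

end

section \<open>Frequency-uniform decomposition\<close>

text \<open>One minus the primitive of a test function of unit mass: its derivatives are minus those
  of the bump and vanish at both ends, while the unit mass brings the value from 1 down to
  0.\<close>

lemma cutoff_exists:
  obtains \<eta> :: "nat \<Rightarrow> real \<Rightarrow> complex" where
    "\<And>i t. t \<in> I11 \<Longrightarrow> (\<eta> i has_vector_derivative \<eta> (Suc i) t) (at t within I11)"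
    "\<And>i. \<eta> i 1 = 0" "\<And>i. \<eta> i (-1) = of_bool (i = 0)"
proof -
  obtain \<psi> where \<psi>: "test_fun \<psi>" "integral I11 \<psi> = 1" by (rule test_fun_unit)
  define \<eta> :: "nat \<Rightarrow> real \<Rightarrow> complex" where
    "\<eta> i t = of_real (case i of 0 \<Rightarrow> 1 - integral {-1..t} \<psi> | Suc j \<Rightarrow> - (deriv ^^ j) \<psi> t)" for i t
  show thesis
  proof (rule that[of \<eta>])
    fix i and t :: real assume t: "t \<in> I11"
    show "(\<eta> i has_vector_derivative \<eta> (Suc i) t) (at t within I11)"
    proof (cases i)
      case 0
      have "((\<lambda>t. 1 - integral {-1..t} \<psi>) has_real_derivative 0 - \<psi> t) (at t within I11)"
        by (intro DERIV_diff DERIV_const integral_has_real_derivative)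
           (use t test_fun_continuous[OF \<psi>(1), of I11 0] in auto)
      from has_vector_derivative_of_real[OF this] show ?thesis by (simp add: \<eta>_def[abs_def] 0)
    next
      case (Suc j)
      have "((\<lambda>t. - (deriv ^^ j) \<psi> t) has_real_derivative - (deriv ^^ Suc j) \<psi> t) (at t within I11)"
        by (rule DERIV_minus[OF has_field_derivative_at_within[OF test_fun_has_derivative[OF \<psi>(1)]]])
      from has_vector_derivative_of_real[OF this] show ?thesis by (simp add: \<eta>_def[abs_def] Suc)
    qed
  next
    fix i
    show "\<eta> i 1 = 0" "\<eta> i (-1) = of_bool (i = 0)"
      using \<psi>(2) test_fun_zero[OF \<psi>(1), of 1 "i - 1"] test_fun_zero[OF \<psi>(1), of "-1" "i - 1"]
      by (cases i; simp add: \<eta>_def)+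
  qed
qed

lemma continuous_functions_bound:
  fixes f :: "nat \<Rightarrow> real \<Rightarrow> complex"
  assumes "\<And>i. i \<le> m \<Longrightarrow> continuous_on I11 (f i)"
  obtains X where "\<And>i t. i \<le> m \<Longrightarrow> t \<in> I11 \<Longrightarrow> cmod (f i t) \<le> X"
proof -
  have "bounded (\<Union>i\<le>m. f i ` I11)"
    by (intro bounded_UN ballI compact_imp_bounded[OF compact_continuous_image[OF assms compact_Icc]]) auto
  then show thesis using that unfolding bounded_iff by fastforce
qed

text \<open>\<open>B\<close> is obtained ahead of the kernel, the density and the frequency, so the
  bound depends on \<open>N\<close> and \<open>c\<close> only; this is possible because one cutoff
  serves all frequencies.\<close>

lemma volterra_decomposition:
  assumes m: "m \<ge> 1"
  obtains B :: "real \<Rightarrow> real \<Rightarrow> real" where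
    "\<And>L P N u c \<omega>. Cm_family m L P \<Longrightarrow>
       (\<And>\<alpha> \<beta> s t. \<alpha> \<le> m \<Longrightarrow> \<beta> \<le> m \<Longrightarrow> s \<in> I11 \<Longrightarrow> t \<in> I11 \<Longrightarrow> cmod (P \<alpha> \<beta> s t) \<le> N) \<Longrightarrow>
       Hm_bounded m c u \<Longrightarrow>
       (\<exists>v0 v1. Cm_bounded m (B N c) v0 \<and> Cm_bounded m (B N c) v1 \<and>
          (\<forall>s\<in>I11. (LINT t:{-1..s}|lborel. L s t * osc \<omega> (s - t) * u t) = v0 s + osc \<omega> s * v1 s)) \<and>
       (\<exists>v0 v1. Cm_bounded m (B N c) v0 \<and> Cm_bounded m (B N c) v1 \<and>
          (\<forall>s\<in>I11. (LINT t:{s..1}|lborel. L s t * osc \<omega> (s - t) * u t) = v0 s + osc \<omega> s * v1 s))"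
proof -
  obtain \<eta> :: "nat \<Rightarrow> real \<Rightarrow> complex" where
    \<eta>d: "\<And>i t. t \<in> I11 \<Longrightarrow> (\<eta> i has_vector_derivative \<eta> (Suc i) t) (at t within I11)"
    and \<eta>1: "\<And>i. \<eta> i 1 = 0" and \<eta>0: "\<And>i. \<eta> i (-1) = of_bool (i = 0)"
    by (rule cutoff_exists) blast
  \<comment> \<open>These are the derivatives of 1 - \<eta>; \<open>of_bool\<close> supplies the
    constant 1 at order 0 only.\<close>
  define \<theta> :: "nat \<Rightarrow> real \<Rightarrow> complex" where "\<theta> i t = of_bool (i = 0) - \<eta> i t" for i t
  have \<theta>d: "(\<theta> i has_vector_derivative \<theta> (Suc i) t) (at t within I11)" if "t \<in> I11" for i t
    using has_vector_derivative_diff[OF has_vector_derivative_const \<eta>d[OF that], of "of_bool (i = 0)"]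
    by (simp add: \<theta>_def[abs_def])
  have \<eta>c: "continuous_on I11 (\<eta> i)" and \<theta>c: "continuous_on I11 (\<theta> i)" for i
    using \<eta>d[of _ i] \<theta>d[of _ i] has_vector_derivative_continuous continuous_on_eq_continuous_within by blast+
  obtain X1 where X1: "\<And>i t. i \<le> m \<Longrightarrow> t \<in> I11 \<Longrightarrow> cmod (\<eta> i t) \<le> X1"
    using continuous_functions_bound[of m \<eta>] \<eta>c by blast
  obtain X2 where X2: "\<And>i t. i \<le> m \<Longrightarrow> t \<in> I11 \<Longrightarrow> cmod (\<theta> i t) \<le> X2"
    using continuous_functions_bound[of m \<theta>] \<theta>c by blast
  define X where "X = max X1 X2"
  \<comment> \<open>Two summands, because the component without the factor e^(i \<omega> s) is a
    difference of a left and a right integral, each bounded by 4^m N X (1 + c^2).\<close>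
  define B where "B N c = 4 ^ m * (N * X * (1 + c\<^sup>2)) + 4 ^ m * (N * X * (1 + c\<^sup>2))" for N c :: real
  show thesis
  proof (rule that[of B])
    fix L P N u c \<omega>
    assume P: "Cm_family m L P"
      and PN: "\<And>\<alpha> \<beta> s t. \<alpha> \<le> m \<Longrightarrow> \<beta> \<le> m \<Longrightarrow> s \<in> I11 \<Longrightarrow> t \<in> I11 \<Longrightarrow> cmod (P \<alpha> \<beta> s t) \<le> N"
      and u: "Hm_bounded m c u"
    obtain W where W: "AE t in lborel. t \<in> I11 \<longrightarrow> u t = W 0 t" "set_integrable lborel I11 u"
      "\<And>j. j < m \<Longrightarrow> primitive_of (W j) (W (Suc j))"
      "\<And>j. j \<le> m \<Longrightarrow> set_integrable lborel I11 (W j)"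
      "\<And>j. j \<le> m \<Longrightarrow> (LINT t:I11|lborel. norm (W j t)) \<le> 1 + c\<^sup>2"
      using Hm_bounded_chain[OF u m] by blast
    \<comment> \<open>\<open>c\<close> carries \<eta> and suits integrals over
      \<open>{s..1}\<close>; \<open>d\<close> carries 1 - \<eta> and suits integrals over
      \<open>{-1..s}\<close>.\<close>
    interpret c: oscillatory_kernel m L P N \<eta> X W "1 + c\<^sup>2" \<omega>
      by unfold_locales (use P PN \<eta>d \<eta>c X1 W(3-5) in \<open>auto simp: X_def intro: max.coboundedI1\<close>)
    interpret d: oscillatory_kernel m L P N \<theta> X W "1 + c\<^sup>2" \<omega>
      by unfold_locales (use P PN \<theta>d \<theta>c X2 W(3-5) in \<open>auto simp: X_def intro: max.coboundedI2\<close>)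
    let ?C = "4 ^ m * (N * X * (1 + c\<^sup>2))"
    let ?l = "\<lambda>s. LINT t:{-1..s}|lborel. d.K 0 0 0 s t * W 0 t"
    let ?r = "\<lambda>s. LINT t:{s..1}|lborel. c.K 0 0 0 s t * W 0 t"
    let ?fc = "\<lambda>s. LINT t:I11|lborel. P 0 0 s t * (osc \<omega> (- t) * \<eta> 0 t) * W 0 t"
    let ?fd = "\<lambda>s. LINT t:I11|lborel. P 0 0 s t * (osc \<omega> (- t) * \<theta> 0 t) * W 0 t"
    have l: "Cm_bounded m ?C ?l"
      by (rule d.left_Cm_bounded) (auto simp: \<theta>_def \<eta>0)
    have r: "Cm_bounded m ?C ?r"
      by (rule c.right_Cm_bounded) (auto simp: \<eta>1)
    have "0 \<le> N * X * (1 + c\<^sup>2)"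
      by (intro mult_nonneg_nonneg c.N_nonneg c.X_nonneg c.M_nonneg)
    then have fB: "N * X * (1 + c\<^sup>2) \<le> B N c"
      using c.bound_le_power[of m] unfolding B_def by linarith
    have fc: "Cm_bounded m (B N c) ?fc" and fd: "Cm_bounded m (B N c) ?fd"
      by (rule Cm_bounded_mono[OF c.full_Cm_bounded fB] Cm_bounded_mono[OF d.full_Cm_bounded fB]; simp)+
    have lr: "Cm_bounded m (B N c) (\<lambda>s. ?l s + - 1 * ?r s)" and rl: "Cm_bounded m (B N c) (\<lambda>s. ?r s + - 1 * ?l s)"
      unfolding B_def by (intro Cm_bounded_add Cm_bounded_mult_const l r; simp)+
    have full: "(LINT t:I11|lborel. c.K 0 0 0 s t * W 0 t) = osc \<omega> s * ?fc s"
      "(LINT t:I11|lborel. d.K 0 0 0 s t * W 0 t) = osc \<omega> s * ?fd s" for s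
      unfolding c.K_def d.K_def diff_conv_add_uminus osc_add set_integral_mult_right[symmetric]
      by (intro arg_cong[where f="set_lebesgue_integral lborel I11"] ext; simp add: ac_simps)+
    have split: "(LINT t:{a..b}|lborel. L s t * osc \<omega> (s - t) * u t)
      = (LINT t:{a..b}|lborel. d.K 0 0 0 s t * W 0 t) + (LINT t:{a..b}|lborel. c.K 0 0 0 s t * W 0 t)"
      if s: "s \<in> I11" and ab: "{a..b} \<subseteq> I11" for s a b
    proof -
      have ck: "continuous_on I11 (\<lambda>t. P 0 0 s t * osc \<omega> (s - t))"
        by (intro continuous_intros continuous_on_square_section(1)[OF Cm_family_continuous[OF P] s]) auto
      have "(LINT t:{a..b}|lborel. L s t * osc \<omega> (s - t) * u t)
          = (LINT t:{a..b}|lborel. (P 0 0 s t * osc \<omega> (s - t)) * u t)"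
        by (rule set_lebesgue_integral_cong) (use Cm_family_0[OF P s] ab in auto)
      also have "\<dots> = (LINT t:{a..b}|lborel. (P 0 0 s t * osc \<omega> (s - t)) * W 0 t)"
        by (rule set_integral_AE_eq[OF set_integrable_continuous_mult[OF ck W(2)] set_integrable_continuous_mult[OF ck W(4)]])
           (use W(1) ab in \<open>auto elim: eventually_mono\<close>)
      also have "\<dots> = (LINT t:{a..b}|lborel. d.K 0 0 0 s t * W 0 t + c.K 0 0 0 s t * W 0 t)"
        by (simp add: c.K_def d.K_def \<theta>_def algebra_simps)
      also have "\<dots> = (LINT t:{a..b}|lborel. d.K 0 0 0 s t * W 0 t) + (LINT t:{a..b}|lborel. c.K 0 0 0 s t * W 0 t)"
        by (intro set_integral_add(2) c.K_integrable d.K_integrable s ab) auto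
      finally show ?thesis .
    qed
    have spc: "(LINT t:I11|lborel. c.K 0 0 0 s t * W 0 t) = (LINT t:{-1..s}|lborel. c.K 0 0 0 s t * W 0 t) + ?r s"
      and spd: "(LINT t:I11|lborel. d.K 0 0 0 s t * W 0 t) = ?l s + (LINT t:{s..1}|lborel. d.K 0 0 0 s t * W 0 t)"
      if "s \<in> I11" for s
      by (intro set_integral_split c.K_integrable d.K_integrable that; simp)+
    \<comment> \<open>In each half the part whose cutoff fails to vanish at the fixed endpoint is
      rewritten as the full integral minus the other half: the \<eta> part on the left, the 1 -
      \<eta> part on the right.\<close>
    have "(LINT t:{-1..s}|lborel. L s t * osc \<omega> (s - t) * u t) = (?l s + - 1 * ?r s) + osc \<omega> s * ?fc s"
      if s: "s \<in> I11" for s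
      using split[OF s, of "-1" s] spc[OF s] full[of s] s by simp
    moreover have "(LINT t:{s..1}|lborel. L s t * osc \<omega> (s - t) * u t) = (?r s + - 1 * ?l s) + osc \<omega> s * ?fd s"
      if s: "s \<in> I11" for s
      using split[OF s, of s 1] spd[OF s] full[of s] s by simp
    ultimately show "(\<exists>v0 v1. Cm_bounded m (B N c) v0 \<and> Cm_bounded m (B N c) v1 \<and>
          (\<forall>s\<in>I11. (LINT t:{-1..s}|lborel. L s t * osc \<omega> (s - t) * u t) = v0 s + osc \<omega> s * v1 s)) \<and>
       (\<exists>v0 v1. Cm_bounded m (B N c) v0 \<and> Cm_bounded m (B N c) v1 \<and>
          (\<forall>s\<in>I11. (LINT t:{s..1}|lborel. L s t * osc \<omega> (s - t) * u t) = v0 s + osc \<omega> s * v1 s))"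
      using lr fc rl fd by (intro conjI exI ballI)
  qed
qed

section \<open>Families in the parameter with eventually constant bounds\<close>

lemma Hk0I:
  assumes "\<And>\<kappa>. \<kappa> > 1 \<Longrightarrow> Hm_bounded m (c \<kappa>) (u \<kappa>)" "\<And>\<kappa>. \<kappa> \<ge> k \<Longrightarrow> \<kappa> > 1 \<Longrightarrow> c \<kappa> \<le> C"
  shows "u \<in> Hk0 m"
proof -
  \<comment> \<open>The maxima with 1 provide the positive constants that \<open>Hk0\<close>
    demands.\<close>
  have "Hm_norm m (u \<kappa>) \<le> max C 1" if "\<kappa> \<ge> max k 1" "\<kappa> > 1" for \<kappa>
    using assms(1)[OF that(2)] assms(2)[of \<kappa>] that unfolding Hm_bounded_def by auto
  moreover have "max C 1 > 0" "max k 1 > 0" by auto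
  ultimately show ?thesis using assms(1) unfolding Hk0_def Hm_bounded_def by blast
qed

text \<open>One function \<open>c\<close> covers both bare membership for small \<kappa> and the
  uniform bound for large \<kappa>. It is eventually equal to a constant, so
  \<open>B (N \<kappa>) (c \<kappa>)\<close> becomes constant too and monotonicity of
  \<open>B\<close> never has to be proved.\<close>

lemma Hk0E:
  assumes "u \<in> Hk0 m"
  obtains c \<kappa>0 C where "\<And>\<kappa>. \<kappa> > 1 \<Longrightarrow> Hm_bounded m (c \<kappa>) (u \<kappa>)" "\<And>\<kappa>. \<kappa> \<ge> \<kappa>0 \<Longrightarrow> c \<kappa> = C"
proof -
  obtain C \<kappa>0 where "\<And>\<kappa>. \<kappa> \<ge> \<kappa>0 \<Longrightarrow> \<kappa> > 1 \<Longrightarrow> Hm_norm m (u \<kappa>) \<le> C" "\<And>\<kappa>. \<kappa> > 1 \<Longrightarrow> in_Hm m (u \<kappa>)"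
    using assms unfolding Hk0_def by blast
  then show thesis
    by (intro that[of "\<lambda>\<kappa>. if \<kappa> \<ge> \<kappa>0 then C else Hm_norm m (u \<kappa>)" \<kappa>0 C]) (auto simp: Hm_bounded_def)
qed

definition Cm_kernel :: "nat \<Rightarrow> real \<Rightarrow> (real \<Rightarrow> real \<Rightarrow> complex) \<Rightarrow> bool" where
  "Cm_kernel m N L \<longleftrightarrow> (\<exists>P. Cm_family m L P \<and>
     (\<forall>\<alpha>\<le>m. \<forall>\<beta>\<le>m. \<forall>s\<in>I11. \<forall>t\<in>I11. cmod (P \<alpha> \<beta> s t) \<le> N))"

lemma Cm_family_bounded:
  assumes P: "Cm_family m L P"
  obtains N where "Cm_kernel m N L"
proof -
  have "bounded (\<Union>\<alpha>\<le>m. \<Union>\<beta>\<le>m. (\<lambda>(s,t). P \<alpha> \<beta> s t) ` (I11 \<times> I11))"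
    by (intro bounded_UN compact_imp_bounded compact_continuous_image Cm_family_continuous[OF P] compact_Times ballI) auto
  then obtain N where "\<forall>x\<in>(\<Union>\<alpha>\<le>m. \<Union>\<beta>\<le>m. (\<lambda>(s,t). P \<alpha> \<beta> s t) ` (I11 \<times> I11)). cmod x \<le> N"
    unfolding bounded_iff by blast
  then have "\<forall>\<alpha>\<le>m. \<forall>\<beta>\<le>m. \<forall>s\<in>I11. \<forall>t\<in>I11. cmod (P \<alpha> \<beta> s t) \<le> N" by force
  then show thesis using that P unfolding Cm_kernel_def by blast
qed

text \<open>Below the threshold the bound comes from compactness of the square, above it from the
  hypothesis; the two are merged into one eventually constant function as in
  \<open>Hk0E\<close>.\<close>

lemma Ck0E:
  assumes "L \<in> Ck0 m"
  obtains N \<kappa>0 C where "\<And>\<kappa>. \<kappa> > 1 \<Longrightarrow> Cm_kernel m (N \<kappa>) (L \<kappa>)" "\<And>\<kappa>. \<kappa> \<ge> \<kappa>0 \<Longrightarrow> N \<kappa> = C"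
proof -
  have L: "(\<forall>\<kappa>>1. \<exists>P. Cm_family m (L \<kappa>) P)"
    "\<exists>c \<kappa>0. c > 0 \<and> \<kappa>0 > 0 \<and> (\<forall>\<kappa>. \<kappa> \<ge> \<kappa>0 \<and> \<kappa> > 1 \<longrightarrow> Cm_kernel m c (L \<kappa>))"
    using assms unfolding Ck0_def Cm_kernel_def by simp_all
  then obtain C \<kappa>0 where 1: "\<And>\<kappa>. \<kappa> \<ge> \<kappa>0 \<Longrightarrow> \<kappa> > 1 \<Longrightarrow> Cm_kernel m C (L \<kappa>)"
    by blast
  have "\<exists>N. \<kappa> > 1 \<longrightarrow> Cm_kernel m N (L \<kappa>)" for \<kappa>
    using L(1) Cm_family_bounded by metis
  then obtain N where "\<And>\<kappa>. \<kappa> > 1 \<Longrightarrow> Cm_kernel m (N \<kappa>) (L \<kappa>)" by metis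
  with 1 show thesis
    by (intro that[of "\<lambda>\<kappa>. if \<kappa> \<ge> \<kappa>0 then C else N \<kappa>" \<kappa>0 C]) auto
qed

lemma Cm_kernel_mono: "Cm_kernel m N L \<Longrightarrow> N \<le> N' \<Longrightarrow> Cm_kernel m N' L"
  unfolding Cm_kernel_def by (meson order_trans)

lemma Hm_bounded_mono: "Hm_bounded m c u \<Longrightarrow> c \<le> d \<Longrightarrow> Hm_bounded m d u"
  unfolding Hm_bounded_def by auto

lemma exp_eq_osc:
  "exp (\<i> * complex_of_real (\<kappa> * t)) = osc \<kappa> t" "exp (- (\<i> * complex_of_real (\<kappa> * t))) = osc \<kappa> (- t)"
  by (simp_all add: osc_def)

lemma osc_0 [simp]: "osc 0 t = 1" by (simp add: osc_def)

lemma osc_scale: "osc (a * \<omega>) t = osc \<omega> (a * t)" by (simp add: osc_def mult.assoc mult.left_commute)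

text \<open>The shape of \<open>tHk0\<close> at a single \<kappa>, with C^m bounds in place of
  Sobolev bounds; the operators produce this stronger form.\<close>

definition osc_sum :: "nat \<Rightarrow> real \<Rightarrow> real \<Rightarrow> (real \<Rightarrow> complex) \<Rightarrow> bool" where
  "osc_sum m C \<kappa> f \<longleftrightarrow> (\<exists>w0 w1 w2. Cm_bounded m C w0 \<and> Cm_bounded m C w1 \<and> Cm_bounded m C w2 \<and>
     (\<forall>s\<in>I11. f s = w0 s + w1 s * osc \<kappa> s + w2 s * osc \<kappa> (- s)))"

lemma osc_sum_add:
  assumes "osc_sum m C \<kappa> f" "osc_sum m C \<kappa> g" "cmod z = 1"
  shows "osc_sum m (2 * C) \<kappa> (\<lambda>s. f s + z * g s)"
proof -
  obtain w0 w1 w2 where w: "Cm_bounded m C w0" "Cm_bounded m C w1" "Cm_bounded m C w2"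
     "\<forall>s\<in>I11. f s = w0 s + w1 s * osc \<kappa> s + w2 s * osc \<kappa> (- s)"
    using assms(1) unfolding osc_sum_def by blast
  obtain x0 x1 x2 where x: "Cm_bounded m C x0" "Cm_bounded m C x1" "Cm_bounded m C x2"
     "\<forall>s\<in>I11. g s = x0 s + x1 s * osc \<kappa> s + x2 s * osc \<kappa> (- s)"
    using assms(2) unfolding osc_sum_def by blast
  have "Cm_bounded m (2 * C) (\<lambda>s. a s + z * b s)" if "Cm_bounded m C a" "Cm_bounded m C b" for a b
    using Cm_bounded_add[OF that(1) Cm_bounded_mult_const[OF that(2) assms(3)]] by simp
  note c = this[OF w(1) x(1)] this[OF w(2) x(2)] this[OF w(3) x(3)]
  show ?thesis
    unfolding osc_sum_def
    by (rule exI[of _ "\<lambda>s. w0 s + z * x0 s"], rule exI[of _ "\<lambda>s. w1 s + z * x1 s"],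
        rule exI[of _ "\<lambda>s. w2 s + z * x2 s"]) (use c w(4) x(4) in \<open>auto simp: algebra_simps\<close>)
qed

text \<open>On the left the components of \<open>u\<close> give frequencies \<kappa>, 0, 2 \<kappa>
  with outer factors 1, e^(i \<kappa> s), e^(-i \<kappa> s); on the right the frequencies are
  -\<kappa>, -2 \<kappa>, 0. Outer factor times e^(i \<omega> s) is always e^(i \<kappa> s) on the
  left and e^(-i \<kappa> s) on the right, so no new exponential arises.\<close>

lemma volterra_osc_sum:
  assumes m: "m \<ge> 1"
  obtains B :: "real \<Rightarrow> real \<Rightarrow> real" where
    "\<And>L N c u0 u1 u2 u \<kappa>. Cm_kernel m N L \<Longrightarrow> Hm_bounded m c u0 \<Longrightarrow> Hm_bounded m c u1 \<Longrightarrow> Hm_bounded m c u2 \<Longrightarrow>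
       (\<And>t. t \<in> I11 \<Longrightarrow> u t = u0 t + u1 t * osc \<kappa> t + u2 t * osc \<kappa> (- t)) \<Longrightarrow>
       osc_sum m (B N c) \<kappa> (\<lambda>s. LINT t:{-1..s}|lborel. L s t * osc \<kappa> (s - t) * u t) \<and>
       osc_sum m (B N c) \<kappa> (\<lambda>s. LINT t:{s..1}|lborel. L s t * osc \<kappa> (t - s) * u t)"
proof -
  obtain B where B: "\<And>L P N u c \<omega>. Cm_family m L P \<Longrightarrow>
       (\<And>\<alpha> \<beta> s t. \<alpha> \<le> m \<Longrightarrow> \<beta> \<le> m \<Longrightarrow> s \<in> I11 \<Longrightarrow> t \<in> I11 \<Longrightarrow> cmod (P \<alpha> \<beta> s t) \<le> N) \<Longrightarrow>
       Hm_bounded m c u \<Longrightarrow>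
       (\<exists>v0 v1. Cm_bounded m (B N c) v0 \<and> Cm_bounded m (B N c) v1 \<and>
          (\<forall>s\<in>I11. (LINT t:{-1..s}|lborel. L s t * osc \<omega> (s - t) * u t) = v0 s + osc \<omega> s * v1 s)) \<and>
       (\<exists>v0 v1. Cm_bounded m (B N c) v0 \<and> Cm_bounded m (B N c) v1 \<and>
          (\<forall>s\<in>I11. (LINT t:{s..1}|lborel. L s t * osc \<omega> (s - t) * u t) = v0 s + osc \<omega> s * v1 s))"
    using volterra_decomposition[OF m] by blast
  show thesis
  \<comment> \<open>Four pieces bounded by \<open>B N c\<close> meet on one of the
    exponentials.\<close>
  proof (rule that[of "\<lambda>N c. 4 * B N c"], rule conjI)
    fix L N c u0 u1 u2 u \<kappa>
    assume "Cm_kernel m N L"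
    then obtain P where P: "Cm_family m L P"
      and PN: "\<And>\<alpha> \<beta> s t. \<alpha> \<le> m \<Longrightarrow> \<beta> \<le> m \<Longrightarrow> s \<in> I11 \<Longrightarrow> t \<in> I11 \<Longrightarrow> cmod (P \<alpha> \<beta> s t) \<le> N"
      unfolding Cm_kernel_def by blast
    assume uc: "Hm_bounded m c u0" "Hm_bounded m c u1" "Hm_bounded m c u2"
    assume u: "\<And>t. t \<in> I11 \<Longrightarrow> u t = u0 t + u1 t * osc \<kappa> t + u2 t * osc \<kappa> (- t)"
    have int: "set_integrable lborel I11 (\<lambda>t. L s t * osc \<omega> (s - t) * v t)"
      if "Hm_bounded m c v" "s \<in> I11" for v s \<omega>
    proof -
      have vi: "set_integrable lborel I11 v" using Hm_boundedE[OF that(1)] weak_derivs_set_integrable by metis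
      have "set_integrable lborel I11 (\<lambda>t. (P 0 0 s t * osc \<omega> (s - t)) * v t)"
        by (intro set_integrable_continuous_mult vi continuous_intros
            continuous_on_square_section(1)[OF Cm_family_continuous[OF P] that(2)]) auto
      moreover have "set_integrable lborel I11 (\<lambda>t. (P 0 0 s t * osc \<omega> (s - t)) * v t)
          = set_integrable lborel I11 (\<lambda>t. L s t * osc \<omega> (s - t) * v t)"
        by (rule set_integrable_cong) (use Cm_family_0[OF P that(2)] in auto)
      ultimately show ?thesis by simp
    qed
    let ?I = "\<lambda>a b \<omega> v s. LINT t:{a..b}|lborel. L s t * osc \<omega> (s - t) * v t"
    \<comment> \<open>\<open>e\<close> = 1 treats the left integral, \<open>e\<close> = -1 the right
      one with its phase \<kappa> (t - s).\<close>
    have split: "(LINT t:{a..b}|lborel. L s t * osc \<kappa> (e * (s - t)) * u t)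
       = ?I a b (e * \<kappa>) u0 s + osc \<kappa> s * ?I a b ((e - 1) * \<kappa>) u1 s + osc \<kappa> (- s) * ?I a b ((e + 1) * \<kappa>) u2 s"
      if s: "s \<in> I11" and ab: "{a..b} \<subseteq> I11" for a b e s
    proof -
      have o: "osc \<kappa> (e * (s - t)) * osc \<kappa> t = osc \<kappa> s * osc ((e - 1) * \<kappa>) (s - t)"
        "osc \<kappa> (e * (s - t)) * osc \<kappa> (- t) = osc \<kappa> (- s) * osc ((e + 1) * \<kappa>) (s - t)" for t
        unfolding osc_scale osc_add[symmetric] by (simp_all add: algebra_simps)
      have "(LINT t:{a..b}|lborel. L s t * osc \<kappa> (e * (s - t)) * u t)
         = (LINT t:{a..b}|lborel. L s t * osc (e * \<kappa>) (s - t) * u0 t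
            + osc \<kappa> s * (L s t * osc ((e - 1) * \<kappa>) (s - t) * u1 t)
            + osc \<kappa> (- s) * (L s t * osc ((e + 1) * \<kappa>) (s - t) * u2 t))"
      proof (rule set_lebesgue_integral_cong, simp, intro allI impI)
        fix t assume "t \<in> {a..b}"
        then have ut: "u t = u0 t + u1 t * osc \<kappa> t + u2 t * osc \<kappa> (- t)" using ab by (intro u) auto
        show "L s t * osc \<kappa> (e * (s - t)) * u t = L s t * osc (e * \<kappa>) (s - t) * u0 t
            + osc \<kappa> s * (L s t * osc ((e - 1) * \<kappa>) (s - t) * u1 t)
            + osc \<kappa> (- s) * (L s t * osc ((e + 1) * \<kappa>) (s - t) * u2 t)"
          unfolding ut osc_scale[of e] using o[of t] by algebra
      qed
      also have "\<dots> = ?I a b (e * \<kappa>) u0 s + osc \<kappa> s * ?I a b ((e - 1) * \<kappa>) u1 s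
          + osc \<kappa> (- s) * ?I a b ((e + 1) * \<kappa>) u2 s"
        using set_integrable_subset[OF int[OF uc(1) s] _ ab] set_integrable_subset[OF int[OF uc(2) s] _ ab]
          set_integrable_subset[OF int[OF uc(3) s] _ ab] by (simp add: set_integral_add)
      finally show ?thesis .
    qed
    obtain a0 a1 where a: "Cm_bounded m (B N c) a0" "Cm_bounded m (B N c) a1"
      "\<And>s. s \<in> I11 \<Longrightarrow> ?I (-1) s \<kappa> u0 s = a0 s + osc \<kappa> s * a1 s"
      using B[OF P PN uc(1), of \<kappa>] by blast
    obtain b0 b1 where b: "Cm_bounded m (B N c) b0" "Cm_bounded m (B N c) b1"
      "\<And>s. s \<in> I11 \<Longrightarrow> ?I (-1) s 0 u1 s = b0 s + osc 0 s * b1 s"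
      using B[OF P PN uc(2), of 0] by blast
    obtain c0 c1 where c: "Cm_bounded m (B N c) c0" "Cm_bounded m (B N c) c1"
      "\<And>s. s \<in> I11 \<Longrightarrow> ?I (-1) s (2 * \<kappa>) u2 s = c0 s + osc (2 * \<kappa>) s * c1 s"
      using B[OF P PN uc(3), of "2 * \<kappa>"] by blast
    have "(LINT t:{-1..s}|lborel. L s t * osc \<kappa> (s - t) * u t)
      = a0 s + (a1 s + b0 s + b1 s + c1 s) * osc \<kappa> s + c0 s * osc \<kappa> (- s)" if s: "s \<in> I11" for s
    proof -
      have "osc \<kappa> (- s) * osc (2 * \<kappa>) s = osc \<kappa> s" unfolding osc_scale osc_add[symmetric] by simp
      then show ?thesis
        using split[OF s, of "-1" s 1] a(3)[OF s] b(3)[OF s] c(3)[OF s] s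
        by (simp add: distrib_left distrib_right mult.commute mult.left_commute)
    qed
    then show "osc_sum m (4 * B N c) \<kappa> (\<lambda>s. LINT t:{-1..s}|lborel. L s t * osc \<kappa> (s - t) * u t)"
      using Cm_bounded_times4[OF a(1)] Cm_bounded_sum4[OF a(2) b(1) b(2) c(2)]
        Cm_bounded_times4[OF c(1)] unfolding osc_sum_def by blast
    obtain a0 a1 where a: "Cm_bounded m (B N c) a0" "Cm_bounded m (B N c) a1"
      "\<And>s. s \<in> I11 \<Longrightarrow> ?I s 1 (- \<kappa>) u0 s = a0 s + osc (- \<kappa>) s * a1 s"
      using B[OF P PN uc(1), of "- \<kappa>"] by blast
    obtain b0 b1 where b: "Cm_bounded m (B N c) b0" "Cm_bounded m (B N c) b1"
      "\<And>s. s \<in> I11 \<Longrightarrow> ?I s 1 (-2 * \<kappa>) u1 s = b0 s + osc (-2 * \<kappa>) s * b1 s"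
      using B[OF P PN uc(2), of "-2 * \<kappa>"] by blast
    obtain c0 c1 where c: "Cm_bounded m (B N c) c0" "Cm_bounded m (B N c) c1"
      "\<And>s. s \<in> I11 \<Longrightarrow> ?I s 1 0 u2 s = c0 s + osc 0 s * c1 s"
      using B[OF P PN uc(3), of 0] by blast
    have "(LINT t:{s..1}|lborel. L s t * osc \<kappa> (t - s) * u t)
      = a0 s + b0 s * osc \<kappa> s + (a1 s + b1 s + c0 s + c1 s) * osc \<kappa> (- s)" if s: "s \<in> I11" for s
    proof -
      have "osc \<kappa> s * osc (-2 * \<kappa>) s = osc \<kappa> (- s)" unfolding osc_scale osc_add[symmetric] by simp
      moreover have "osc (- \<kappa>) s = osc \<kappa> (- s)" using osc_scale[of "-1" \<kappa> s] by simp
      ultimately show ?thesis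
        using split[OF s, of s 1 "-1"] a(3)[OF s] b(3)[OF s] c(3)[OF s] s
        by (simp add: distrib_left distrib_right mult.commute mult.left_commute)
    qed
    then show "osc_sum m (4 * B N c) \<kappa> (\<lambda>s. LINT t:{s..1}|lborel. L s t * osc \<kappa> (t - s) * u t)"
      using Cm_bounded_times4[OF a(1)] Cm_bounded_times4[OF b(1)]
        Cm_bounded_sum4[OF a(2) b(2) c(1) c(2)] unfolding osc_sum_def by blast
  qed
qed

text \<open>Nothing relates different values of \<kappa>, so the three components are chosen
  separately for each; only the bound has to be uniform eventually.\<close>

lemma tHk0I:
  assumes "\<And>\<kappa>. \<kappa> > 1 \<Longrightarrow> osc_sum m (C \<kappa>) \<kappa> (u \<kappa>)" "\<And>\<kappa>. \<kappa> \<ge> \<kappa>0 \<Longrightarrow> C \<kappa> = C0"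
  shows "u \<in> tHk0 m"
proof -
  have "\<exists>w0 w1 w2. \<kappa> > 1 \<longrightarrow> Cm_bounded m (C \<kappa>) w0 \<and> Cm_bounded m (C \<kappa>) w1 \<and> Cm_bounded m (C \<kappa>) w2 \<and>
     (\<forall>s\<in>I11. u \<kappa> s = w0 s + w1 s * osc \<kappa> s + w2 s * osc \<kappa> (- s))" for \<kappa>
    using assms(1)[of \<kappa>] unfolding osc_sum_def by blast
  then obtain w0 w1 w2 where w: "\<And>\<kappa>. \<kappa> > 1 \<Longrightarrow> Cm_bounded m (C \<kappa>) (w0 \<kappa>)"
    "\<And>\<kappa>. \<kappa> > 1 \<Longrightarrow> Cm_bounded m (C \<kappa>) (w1 \<kappa>)" "\<And>\<kappa>. \<kappa> > 1 \<Longrightarrow> Cm_bounded m (C \<kappa>) (w2 \<kappa>)"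
    "\<And>\<kappa> s. \<kappa> > 1 \<Longrightarrow> s \<in> I11 \<Longrightarrow> u \<kappa> s = w0 \<kappa> s + w1 \<kappa> s * osc \<kappa> s + w2 \<kappa> s * osc \<kappa> (- s)"
    by metis
  have "w \<in> Hk0 m" if "\<And>\<kappa>. \<kappa> > 1 \<Longrightarrow> Cm_bounded m (C \<kappa>) (w \<kappa>)" for w
    by (rule Hk0I[OF Cm_bounded_imp_Hm_bounded[OF that], where k=\<kappa>0 and C="2 * real (Suc m) * C0"])
       (use assms(2) in auto)
  then have "w0 \<in> Hk0 m" "w1 \<in> Hk0 m" "w2 \<in> Hk0 m" using w(1-3) by blast+
  then show ?thesis unfolding tHk0_def exp_eq_osc using w(4) by blast
qed

lemma tHk0E:
  assumes "u \<in> tHk0 m"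
  obtains u0 u1 u2 c \<kappa>0 C where
    "\<And>\<kappa>. \<kappa> > 1 \<Longrightarrow> Hm_bounded m (c \<kappa>) (u0 \<kappa>)" "\<And>\<kappa>. \<kappa> > 1 \<Longrightarrow> Hm_bounded m (c \<kappa>) (u1 \<kappa>)"
    "\<And>\<kappa>. \<kappa> > 1 \<Longrightarrow> Hm_bounded m (c \<kappa>) (u2 \<kappa>)" "\<And>\<kappa>. \<kappa> \<ge> \<kappa>0 \<Longrightarrow> c \<kappa> = C"
    "\<And>\<kappa> t. \<kappa> > 1 \<Longrightarrow> t \<in> I11 \<Longrightarrow> u \<kappa> t = u0 \<kappa> t + u1 \<kappa> t * osc \<kappa> t + u2 \<kappa> t * osc \<kappa> (- t)"
proof -
  obtain u0 u1 u2 where u: "u0 \<in> Hk0 m" "u1 \<in> Hk0 m" "u2 \<in> Hk0 m"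
    "\<And>\<kappa> t. \<kappa> > 1 \<Longrightarrow> t \<in> I11 \<Longrightarrow> u \<kappa> t = u0 \<kappa> t + u1 \<kappa> t * osc \<kappa> t + u2 \<kappa> t * osc \<kappa> (- t)"
    using assms unfolding tHk0_def exp_eq_osc by blast
  obtain c0 k0 C0 where 0: "\<And>\<kappa>. \<kappa> > 1 \<Longrightarrow> Hm_bounded m (c0 \<kappa>) (u0 \<kappa>)" "\<And>\<kappa>. \<kappa> \<ge> k0 \<Longrightarrow> c0 \<kappa> = C0"
    using Hk0E[OF u(1)] by metis
  obtain c1 k1 C1 where 1: "\<And>\<kappa>. \<kappa> > 1 \<Longrightarrow> Hm_bounded m (c1 \<kappa>) (u1 \<kappa>)" "\<And>\<kappa>. \<kappa> \<ge> k1 \<Longrightarrow> c1 \<kappa> = C1"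
    using Hk0E[OF u(2)] by metis
  obtain c2 k2 C2 where 2: "\<And>\<kappa>. \<kappa> > 1 \<Longrightarrow> Hm_bounded m (c2 \<kappa>) (u2 \<kappa>)" "\<And>\<kappa>. \<kappa> \<ge> k2 \<Longrightarrow> c2 \<kappa> = C2"
    using Hk0E[OF u(3)] by metis
  define c where "c \<kappa> = max (c0 \<kappa>) (max (c1 \<kappa>) (c2 \<kappa>))" for \<kappa>
  show thesis
  proof (rule that[OF _ _ _ _ u(4)])
    fix \<kappa> :: real assume \<kappa>: "\<kappa> > 1"
    show "Hm_bounded m (c \<kappa>) (u0 \<kappa>)" by (rule Hm_bounded_mono[OF 0(1)[OF \<kappa>]]) (simp add: c_def)
    show "Hm_bounded m (c \<kappa>) (u1 \<kappa>)" by (rule Hm_bounded_mono[OF 1(1)[OF \<kappa>]]) (simp add: c_def)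
    show "Hm_bounded m (c \<kappa>) (u2 \<kappa>)" by (rule Hm_bounded_mono[OF 2(1)[OF \<kappa>]]) (simp add: c_def)
  next
    show "c \<kappa> = max C0 (max C1 C2)" if "\<kappa> \<ge> max k0 (max k1 k2)" for \<kappa>
      using that 0(2) 1(2) 2(2) by (simp add: c_def)
  qed
qed

lemma opsA_closed:
  assumes m: "m \<ge> 1" and T: "T \<in> opsA m" and u: "u \<in> tHk0 m"
  shows "T u \<in> tHk0 m"
proof -
  obtain \<epsilon> L1 L2 where L: "L1 \<in> Ck0 m" "L2 \<in> Ck0 m" and T_eq: "T = opA \<epsilon> L1 L2"
    using T unfolding opsA_def by blast
  obtain u0 u1 u2 c k0 C where uc:
    "\<And>\<kappa>. \<kappa> > 1 \<Longrightarrow> Hm_bounded m (c \<kappa>) (u0 \<kappa>)" "\<And>\<kappa>. \<kappa> > 1 \<Longrightarrow> Hm_bounded m (c \<kappa>) (u1 \<kappa>)"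
    "\<And>\<kappa>. \<kappa> > 1 \<Longrightarrow> Hm_bounded m (c \<kappa>) (u2 \<kappa>)" "\<And>\<kappa>. \<kappa> \<ge> k0 \<Longrightarrow> c \<kappa> = C"
    "\<And>\<kappa> t. \<kappa> > 1 \<Longrightarrow> t \<in> I11 \<Longrightarrow> u \<kappa> t = u0 \<kappa> t + u1 \<kappa> t * osc \<kappa> t + u2 \<kappa> t * osc \<kappa> (- t)"
    by (rule tHk0E[OF u]) (rule that)
  obtain N1 k1 C1 where 1: "\<And>\<kappa>. \<kappa> > 1 \<Longrightarrow> Cm_kernel m (N1 \<kappa>) (L1 \<kappa>)" "\<And>\<kappa>. \<kappa> \<ge> k1 \<Longrightarrow> N1 \<kappa> = C1"
    using Ck0E[OF L(1)] by metis
  obtain N2 k2 C2 where 2: "\<And>\<kappa>. \<kappa> > 1 \<Longrightarrow> Cm_kernel m (N2 \<kappa>) (L2 \<kappa>)" "\<And>\<kappa>. \<kappa> \<ge> k2 \<Longrightarrow> N2 \<kappa> = C2"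
    using Ck0E[OF L(2)] by metis
  \<comment> \<open>A bound common to both kernels, since \<open>osc_sum_add\<close> takes the same
    constant for both summands.\<close>
  define N where "N \<kappa> = max (N1 \<kappa>) (N2 \<kappa>)" for \<kappa>
  obtain B where B: "\<And>L N c u0 u1 u2 u \<kappa>. Cm_kernel m N L \<Longrightarrow> Hm_bounded m c u0 \<Longrightarrow> Hm_bounded m c u1 \<Longrightarrow> Hm_bounded m c u2 \<Longrightarrow>
       (\<And>t. t \<in> I11 \<Longrightarrow> u t = u0 t + u1 t * osc \<kappa> t + u2 t * osc \<kappa> (- t)) \<Longrightarrow>
       osc_sum m (B N c) \<kappa> (\<lambda>s. LINT t:{-1..s}|lborel. L s t * osc \<kappa> (s - t) * u t) \<and>
       osc_sum m (B N c) \<kappa> (\<lambda>s. LINT t:{s..1}|lborel. L s t * osc \<kappa> (t - s) * u t)"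
    using volterra_osc_sum[OF m] by blast
  show ?thesis
  proof (rule tHk0I)
    fix \<kappa> :: real assume \<kappa>: "\<kappa> > 1"
    have K: "Cm_kernel m (N \<kappa>) (L1 \<kappa>)" "Cm_kernel m (N \<kappa>) (L2 \<kappa>)"
      using Cm_kernel_mono[OF 1(1)[OF \<kappa>]] Cm_kernel_mono[OF 2(1)[OF \<kappa>]] by (auto simp: N_def)
    have "osc_sum m (2 * B (N \<kappa>) (c \<kappa>)) \<kappa> (\<lambda>s. (LINT t:{-1..s}|lborel. L1 \<kappa> s t * osc \<kappa> (s - t) * u \<kappa> t)
        + (-1)^\<epsilon> * (LINT t:{s..1}|lborel. L2 \<kappa> s t * osc \<kappa> (t - s) * u \<kappa> t))"
      by (rule osc_sum_add[OF conjunct1[OF B[OF K(1)]] conjunct2[OF B[OF K(2)]]])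
         (use uc(1-3,5) \<kappa> in \<open>auto simp: norm_power\<close>)
    then show "osc_sum m (2 * B (N \<kappa>) (c \<kappa>)) \<kappa> (T u \<kappa>)"
      unfolding T_eq opA_def exp_eq_osc .
  next
    show "2 * B (N \<kappa>) (c \<kappa>) = 2 * B (max C1 C2) C" if "\<kappa> \<ge> max k0 (max k1 k2)" for \<kappa>
      using that uc(4) 1(2) 2(2) by (simp add: N_def)
  qed
qed

section \<open>Closure under sums, powers and products of operators\<close>

lemma Hk0_add:
  assumes "u \<in> Hk0 m" "w \<in> Hk0 m"
  shows "(\<lambda>\<kappa> t. u \<kappa> t + w \<kappa> t) \<in> Hk0 m"
proof -
  obtain c0 k0 C0 where 0: "\<And>\<kappa>. \<kappa> > 1 \<Longrightarrow> Hm_bounded m (c0 \<kappa>) (u \<kappa>)" "\<And>\<kappa>. \<kappa> \<ge> k0 \<Longrightarrow> c0 \<kappa> = C0"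
    using Hk0E[OF assms(1)] by metis
  obtain c1 k1 C1 where 1: "\<And>\<kappa>. \<kappa> > 1 \<Longrightarrow> Hm_bounded m (c1 \<kappa>) (w \<kappa>)" "\<And>\<kappa>. \<kappa> \<ge> k1 \<Longrightarrow> c1 \<kappa> = C1"
    using Hk0E[OF assms(2)] by metis
  show ?thesis
    by (rule Hk0I[OF Hm_bounded_add[OF 0(1) 1(1)], where k="max k0 k1" and C="2 * (C0 + C1)"]) (use 0(2) 1(2) in auto)
qed

lemma tHk0_add:
  assumes "u \<in> tHk0 m" "w \<in> tHk0 m"
  shows "(\<lambda>\<kappa> t. u \<kappa> t + w \<kappa> t) \<in> tHk0 m"
proof -
  obtain u0 u1 u2 where u: "u0 \<in> Hk0 m" "u1 \<in> Hk0 m" "u2 \<in> Hk0 m"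
    "\<And>\<kappa> t. \<kappa> > 1 \<Longrightarrow> t \<in> I11 \<Longrightarrow> u \<kappa> t = u0 \<kappa> t + u1 \<kappa> t * osc \<kappa> t + u2 \<kappa> t * osc \<kappa> (- t)"
    using assms(1) unfolding tHk0_def exp_eq_osc by blast
  obtain w0 w1 w2 where w: "w0 \<in> Hk0 m" "w1 \<in> Hk0 m" "w2 \<in> Hk0 m"
    "\<And>\<kappa> t. \<kappa> > 1 \<Longrightarrow> t \<in> I11 \<Longrightarrow> w \<kappa> t = w0 \<kappa> t + w1 \<kappa> t * osc \<kappa> t + w2 \<kappa> t * osc \<kappa> (- t)"
    using assms(2) unfolding tHk0_def exp_eq_osc by blast
  have "u \<kappa> t + w \<kappa> t = (u0 \<kappa> t + w0 \<kappa> t) + (u1 \<kappa> t + w1 \<kappa> t) * osc \<kappa> t + (u2 \<kappa> t + w2 \<kappa> t) * osc \<kappa> (- t)"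
    if "\<kappa> > 1" "t \<in> I11" for \<kappa> t
    using u(4)[OF that] w(4)[OF that] by (simp add: distrib_right)
  then show ?thesis
    unfolding tHk0_def exp_eq_osc using Hk0_add[OF u(1) w(1)] Hk0_add[OF u(2) w(2)] Hk0_add[OF u(3) w(3)]
    by (intro CollectI exI[of _ "\<lambda>\<kappa> t. u0 \<kappa> t + w0 \<kappa> t"] exI[of _ "\<lambda>\<kappa> t. u1 \<kappa> t + w1 \<kappa> t"]
        exI[of _ "\<lambda>\<kappa> t. u2 \<kappa> t + w2 \<kappa> t"]) simp
qed

text \<open>The induction starts at a singleton, so the zero function never has to be placed in the
  space; nonemptiness of the index set is supplied by n \<ge> 1.\<close>

lemma tHk0_sum:
  assumes "finite S" "S \<noteq> {}" "\<And>l. l \<in> S \<Longrightarrow> f l \<in> tHk0 m"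
  shows "(\<lambda>\<kappa> s. \<Sum>l\<in>S. f l \<kappa> s) \<in> tHk0 m"
  using assms
proof (induction S rule: finite_ne_induct)
  case (insert x F)
  then show ?case using tHk0_add[of "f x" m "\<lambda>\<kappa> s. \<Sum>l\<in>F. f l \<kappa> s"] by simp
qed simp

lemma funpow_closed: "(\<And>u. u \<in> S \<Longrightarrow> f u \<in> S) \<Longrightarrow> u \<in> S \<Longrightarrow> (f ^^ k) u \<in> S"
  by (induction k) auto

text \<open>The factor of highest index acts first, so the induction hypothesis is applied to its
  image and \<open>u\<close> has to stay arbitrary.\<close>

lemma op_prod_closed:
  assumes "\<And>j u. j \<ge> 1 \<Longrightarrow> u \<in> S \<Longrightarrow> T j u \<in> S"
  shows "u \<in> S \<Longrightarrow> op_prod T b k u \<in> S"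
proof (induction k arbitrary: u)
  case (Suc k)
  have "(T (Suc k) ^^ b (Suc k)) u \<in> S" by (rule funpow_closed) (use assms Suc.prems in auto)
  then show ?case using Suc.IH by simp
qed simp

theorem theorem4p4:
  fixes m n :: nat and T :: "nat \<Rightarrow> kop" and \<alpha> \<beta> :: "nat \<Rightarrow> nat"
  assumes "m \<ge> 1" and "n \<ge> 1"
    and "\<forall>j\<ge>1. T j \<in> opsA m"
  shows "\<forall>u \<in> tHk0 m. (\<lambda>\<kappa> s. \<Sum>l=1..n. op_prod T \<beta> (\<alpha> l) u \<kappa> s) \<in> tHk0 m"
proof
  fix u assume u: "u \<in> tHk0 m"
  have "op_prod T \<beta> k u \<in> tHk0 m" for k
    by (rule op_prod_closed[OF _ u]) (use assms opsA_closed in auto)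
  then show "(\<lambda>\<kappa> s. \<Sum>l=1..n. op_prod T \<beta> (\<alpha> l) u \<kappa> s) \<in> tHk0 m"
    using assms(2) by (intro tHk0_sum) auto
qed

end
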